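(* The functor $\Gamma_{\mathbb Q}:\mathbf{uQVL}\to\mathbf{DMV}$ defined on objects by $\Gamma_{\mathbb Q}(V,u)=[0,u]_V$ and on arrows $f:(V,u)\to(W,w)$ by $\Gamma_{\mathbb Q}(f)=f|_{[0,u]_V}$ establishes a categorical equivalence between $\mathbf{uQVL}$ and $\mathbf{DMV}$.
   Context: An MV-algebra is a structure $(A,\oplus,{}^*,0)$ such that $(A,\oplus,0)$ is an Abelian monoid, $(x^* )^*=x$, $(x^*\oplus y)^*\oplus y=(y^*\oplus x)^*\oplus x$ and $0^*\oplus x=0^*$; $x\odot y=(x^*\oplus y^* )^*$, and $mx$ is the $m$-fold $\oplus$-sum of $x$. A DMV-algebra is an MV-algebra $A$ with unary operators $\{\delta_n\}_{n\ge1}$ satisfying $n\delta_nx=x$ and $\delta_nx\odot(n-1)\delta_nx=0$ for all $x\in A$, $n\ge1$. $\mathbf{DMV}$ is the category of DMV-algebras with homomorphisms of DMV-algebras (maps preserving $\oplus,{}^*,0$ and all $\delta_n$). $\mathbf{uQVL}$ is the category whose objects are pairs $(V,u)$, where $V$ is a $\mathbb Q$-vector lattice (a lattice-ordered linear space over $\mathbb Q$) and $u\in V$ is a strong unit ($u\ge 0$ and for each $v\in V$ there is $n\in\mathbb N$ with $|v|\le nu$), and whose arrows are the linear maps over $\mathbb Q$ preserving the lattice operations and the strong unit. For $(V,u)$ in $\mathbf{uQVL}$, $[0,u]_V$ is the set $\{x\in V\mid 0\le x\le u\}$ with $x\oplus y=u\wedge(x+y)$, $x^*=u-x$, and the scalar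 multiplication of $V$ by rationals in $[0,1]$; as a DMV-algebra, $\delta_n(x)=\frac1nx$. *)

theory Defs
  imports Complex_Main "HOL-Algebra.Module" "HOL-Algebra.Lattice"
begin

section \<open>Categories, functors, equivalences\<close>

record ('o, 'm) category =
  Ob :: "'o set"
  Hom :: "'o \<Rightarrow> 'o \<Rightarrow> 'm set"
  Ident :: "'o \<Rightarrow> 'm"
  Comp :: "'o \<Rightarrow> 'o \<Rightarrow> 'o \<Rightarrow> 'm \<Rightarrow> 'm \<Rightarrow> 'm"

text \<open>
  \<open>Comp C X Y Z g f\<close> is the composite of \<open>f : X \<rightarrow> Y\<close> followed by \<open>g : Y \<rightarrow> Z\<close>.  Only the values on
  objects in \<open>Ob C\<close> and on arrows in the respective hom-sets are meaningful.  Hom-sets need not be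
  disjoint: an arrow is always taken together with its domain and codomain.
\<close>

locale category =
  fixes C :: "('o, 'm) category"
  assumes Ident_in_Hom:
      "X \<in> Ob C \<Longrightarrow> Ident C X \<in> Hom C X X"
    and Comp_in_Hom:
      "\<lbrakk>X \<in> Ob C; Y \<in> Ob C; Z \<in> Ob C; f \<in> Hom C X Y; g \<in> Hom C Y Z\<rbrakk>
        \<Longrightarrow> Comp C X Y Z g f \<in> Hom C X Z"
    and Comp_Ident_right:
      "\<lbrakk>X \<in> Ob C; Y \<in> Ob C; f \<in> Hom C X Y\<rbrakk> \<Longrightarrow> Comp C X X Y f (Ident C X) = f"
    and Comp_Ident_left:
      "\<lbrakk>X \<in> Ob C; Y \<in> Ob C; f \<in> Hom C X Y\<rbrakk> \<Longrightarrow> Comp C X Y Y (Ident C Y) f = f"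
    and Comp_assoc:
      "\<lbrakk>W \<in> Ob C; X \<in> Ob C; Y \<in> Ob C; Z \<in> Ob C;
        f \<in> Hom C W X; g \<in> Hom C X Y; h \<in> Hom C Y Z\<rbrakk>
        \<Longrightarrow> Comp C W X Z (Comp C X Y Z h g) f = Comp C W Y Z h (Comp C W X Y g f)"

record ('o, 'm, 'p, 'n) cat_functor =
  fobj :: "'o \<Rightarrow> 'p"
  farr :: "'o \<Rightarrow> 'o \<Rightarrow> 'm \<Rightarrow> 'n"

locale is_functor = C: category C + D: category D
  for C :: "('o, 'm) category" and D :: "('p, 'n) category" +
  fixes F :: "('o, 'm, 'p, 'n) cat_functor"
  assumes fobj_in_Ob:
      "X \<in> Ob C \<Longrightarrow> fobj F X \<in> Ob D"
    and farr_in_Hom: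
      "\<lbrakk>X \<in> Ob C; Y \<in> Ob C; f \<in> Hom C X Y\<rbrakk> \<Longrightarrow> farr F X Y f \<in> Hom D (fobj F X) (fobj F Y)"
    and farr_Ident:
      "X \<in> Ob C \<Longrightarrow> farr F X X (Ident C X) = Ident D (fobj F X)"
    and farr_Comp:
      "\<lbrakk>X \<in> Ob C; Y \<in> Ob C; Z \<in> Ob C; f \<in> Hom C X Y; g \<in> Hom C Y Z\<rbrakk>
        \<Longrightarrow> farr F X Z (Comp C X Y Z g f)
            = Comp D (fobj F X) (fobj F Y) (fobj F Z) (farr F Y Z g) (farr F X Y f)"

definition id_functor :: "('o, 'm, 'o, 'm) cat_functor" where
  "id_functor = \<lparr>fobj = (\<lambda>X. X), farr = (\<lambda>X Y f. f)\<rparr>"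

definition comp_functor ::
  "('p, 'n, 'q, 'k) cat_functor \<Rightarrow> ('o, 'm, 'p, 'n) cat_functor \<Rightarrow> ('o, 'm, 'q, 'k) cat_functor"
  where
  "comp_functor G F =
    \<lparr>fobj = (\<lambda>X. fobj G (fobj F X)),
     farr = (\<lambda>X Y f. farr G (fobj F X) (fobj F Y) (farr F X Y f))\<rparr>"

definition is_iso :: "('o, 'm) category \<Rightarrow> 'o \<Rightarrow> 'o \<Rightarrow> 'm \<Rightarrow> bool" where
  "is_iso C X Y f \<longleftrightarrow>
    f \<in> Hom C X Y \<and>
    (\<exists>g \<in> Hom C Y X. Comp C X Y X g f = Ident C X \<and> Comp C Y X Y f g = Ident C Y)"

locale natural_isomorphism = F: is_functor C D F + G: is_functor C D G
  for C :: "('o, 'm) category" and D :: "('p, 'n) category"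
    and F G :: "('o, 'm, 'p, 'n) cat_functor" +
  fixes \<eta> :: "'o \<Rightarrow> 'n"
  assumes component_iso:
      "X \<in> Ob C \<Longrightarrow> is_iso D (fobj F X) (fobj G X) (\<eta> X)"
    and naturality:
      "\<lbrakk>X \<in> Ob C; Y \<in> Ob C; f \<in> Hom C X Y\<rbrakk>
        \<Longrightarrow> Comp D (fobj F X) (fobj F Y) (fobj G Y) (\<eta> Y) (farr F X Y f)
            = Comp D (fobj F X) (fobj G X) (fobj G Y) (farr G X Y f) (\<eta> X)"

definition categorical_equivalence ::
  "('o, 'm) category \<Rightarrow> ('p, 'n) category \<Rightarrow> ('o, 'm, 'p, 'n) cat_functor \<Rightarrow> bool" where
  "categorical_equivalence C D F \<longleftrightarrow>
    is_functor C D F \<and>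
    (\<exists>G. is_functor D C G \<and>
      (\<exists>\<eta>. natural_isomorphism C C id_functor (comp_functor G F) \<eta>) \<and>
      (\<exists>\<epsilon>. natural_isomorphism D D (comp_functor F G) id_functor \<epsilon>))"


section \<open>MV-algebras and DMV-algebras\<close>

record 'a mv_alg = "'a partial_object" +
  mv_plus :: "['a, 'a] \<Rightarrow> 'a" (infixl \<open>\<boxplus>\<index>\<close> 65)
  mv_neg :: "'a \<Rightarrow> 'a"
  mv_zero :: "'a"

definition mv_monoid :: "('a, 'b) mv_alg_scheme \<Rightarrow> 'a monoid" where
  "mv_monoid A = \<lparr>carrier = carrier A, monoid.mult = mv_plus A, one = mv_zero A\<rparr>"

definition mv_times :: "[('a, 'b) mv_alg_scheme, 'a, 'a] \<Rightarrow> 'a" (infixl \<open>\<boxdot>\<index>\<close> 70) where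
  "x \<boxdot>\<^bsub>A\<^esub> y = mv_neg A (mv_neg A x \<boxplus>\<^bsub>A\<^esub> mv_neg A y)"

definition mv_nsum :: "('a, 'b) mv_alg_scheme \<Rightarrow> nat \<Rightarrow> 'a \<Rightarrow> 'a" where
  "mv_nsum A m x = x [^]\<^bsub>mv_monoid A\<^esub> m"

locale mv_algebra =
  fixes A (structure)
  assumes plus_comm_monoid: "comm_monoid (mv_monoid A)"
    and neg_closed: "x \<in> carrier A \<Longrightarrow> mv_neg A x \<in> carrier A"
    and neg_neg: "x \<in> carrier A \<Longrightarrow> mv_neg A (mv_neg A x) = x"
    and lukasiewicz:
      "\<lbrakk>x \<in> carrier A; y \<in> carrier A\<rbrakk>
        \<Longrightarrow> mv_neg A (mv_neg A x \<boxplus> y) \<boxplus> y = mv_neg A (mv_neg A y \<boxplus> x) \<boxplus> x"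
    and neg_zero_plus: "x \<in> carrier A \<Longrightarrow> mv_neg A (mv_zero A) \<boxplus> x = mv_neg A (mv_zero A)"

text \<open>The operators \<open>dmv_delta A n\<close> are only constrained, and only meaningful, for \<open>n \<ge> 1\<close>.\<close>

record 'a dmv_alg = "'a mv_alg" +
  dmv_delta :: "nat \<Rightarrow> 'a \<Rightarrow> 'a"

locale dmv_algebra = mv_algebra A for A :: "('a, 'b) dmv_alg_scheme" (structure) +
  assumes delta_closed:
      "\<lbrakk>n \<ge> 1; x \<in> carrier A\<rbrakk> \<Longrightarrow> dmv_delta A n x \<in> carrier A"
    and nsum_delta:
      "\<lbrakk>n \<ge> 1; x \<in> carrier A\<rbrakk> \<Longrightarrow> mv_nsum A n (dmv_delta A n x) = x"
    and delta_times_nsum_delta: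
      "\<lbrakk>n \<ge> 1; x \<in> carrier A\<rbrakk>
        \<Longrightarrow> dmv_delta A n x \<boxdot> mv_nsum A (n - 1) (dmv_delta A n x) = mv_zero A"

text \<open>
  Arrows are extensional functions (\<open>\<rightarrow>\<^sub>E\<close>), so that two arrows are equal iff they agree on the
  carrier of their domain.
\<close>

definition dmv_hom :: "'a dmv_alg \<Rightarrow> 'b dmv_alg \<Rightarrow> ('a \<Rightarrow> 'b) set" where
  "dmv_hom A B =
    {f \<in> carrier A \<rightarrow>\<^sub>E carrier B.
      (\<forall>x \<in> carrier A. \<forall>y \<in> carrier A. f (x \<boxplus>\<^bsub>A\<^esub> y) = f x \<boxplus>\<^bsub>B\<^esub> f y) \<and>
      (\<forall>x \<in> carrier A. f (mv_neg A x) = mv_neg B (f x)) \<and>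
      f (mv_zero A) = mv_zero B \<and>
      (\<forall>n \<ge> 1. \<forall>x \<in> carrier A. f (dmv_delta A n x) = dmv_delta B n (f x))}"

definition DMV :: "('a dmv_alg, 'a \<Rightarrow> 'a) category" where
  "DMV =
    \<lparr>Ob = {A. dmv_algebra A},
     Hom = dmv_hom,
     Ident = (\<lambda>A. \<lambda>x \<in> carrier A. x),
     Comp = (\<lambda>A B C g f. compose (carrier A) g f)\<rparr>"


section \<open>Rational vector lattices with strong unit\<close>

definition rat_ring :: "rat ring" where
  "rat_ring = \<lparr>carrier = UNIV, monoid.mult = (*), one = 1, ring.zero = 0, add = (+)\<rparr>"

text \<open>
  As usual for \<^locale>\<open>module\<close>, the fields \<open>mult\<close> and \<open>one\<close> that are inherited from the
  record of rings are present but play no role.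
\<close>

record 'a q_vec_lat = "(rat, 'a) module" +
  vle :: "['a, 'a] \<Rightarrow> bool" (infix \<open>\<preceq>\<index>\<close> 50)

definition vorder :: "('a, 'b) q_vec_lat_scheme \<Rightarrow> 'a gorder" where
  "vorder V = \<lparr>carrier = carrier V, eq = (=), le = vle V\<rparr>"

definition vjoin :: "[('a, 'b) q_vec_lat_scheme, 'a, 'a] \<Rightarrow> 'a" where
  "vjoin V x y = x \<squnion>\<^bsub>vorder V\<^esub> y"

definition vmeet :: "[('a, 'b) q_vec_lat_scheme, 'a, 'a] \<Rightarrow> 'a" where
  "vmeet V x y = x \<sqinter>\<^bsub>vorder V\<^esub> y"

definition vabs :: "('a, 'b) q_vec_lat_scheme \<Rightarrow> 'a \<Rightarrow> 'a" where
  "vabs V x = vjoin V x (\<ominus>\<^bsub>V\<^esub> x)"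

locale q_vector_lattice =
  fixes V :: "('a, 'b) q_vec_lat_scheme" (structure)
  assumes linear_space: "module rat_ring V"
    and lattice_order: "lattice (vorder V)"
    and add_mono:
      "\<lbrakk>x \<in> carrier V; y \<in> carrier V; z \<in> carrier V; x \<preceq> y\<rbrakk> \<Longrightarrow> x \<oplus> z \<preceq> y \<oplus> z"
    and smult_nonneg:
      "\<lbrakk>x \<in> carrier V; q \<ge> 0; \<zero> \<preceq> x\<rbrakk> \<Longrightarrow> \<zero> \<preceq> q \<odot> x"

record 'a u_q_vec_lat = "'a q_vec_lat" +
  vunit :: 'a

locale unital_q_vector_lattice = q_vector_lattice V
  for V :: "('a, 'b) u_q_vec_lat_scheme" (structure) +
  assumes unit_closed: "vunit V \<in> carrier V"
    and unit_nonneg: "\<zero> \<preceq> vunit V"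
    and unit_strong:
      "v \<in> carrier V \<Longrightarrow> \<exists>n::nat. vabs V v \<preceq> rat_of_nat n \<odot> vunit V"

definition uqvl_hom :: "'a u_q_vec_lat \<Rightarrow> 'b u_q_vec_lat \<Rightarrow> ('a \<Rightarrow> 'b) set" where
  "uqvl_hom V W =
    {f \<in> carrier V \<rightarrow>\<^sub>E carrier W.
      (\<forall>x \<in> carrier V. \<forall>y \<in> carrier V. f (x \<oplus>\<^bsub>V\<^esub> y) = f x \<oplus>\<^bsub>W\<^esub> f y) \<and>
      (\<forall>q. \<forall>x \<in> carrier V. f (q \<odot>\<^bsub>V\<^esub> x) = q \<odot>\<^bsub>W\<^esub> f x) \<and>
      (\<forall>x \<in> carrier V. \<forall>y \<in> carrier V. f (vjoin V x y) = vjoin W (f x) (f y)) \<and>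
      (\<forall>x \<in> carrier V. \<forall>y \<in> carrier V. f (vmeet V x y) = vmeet W (f x) (f y)) \<and>
      f (vunit V) = vunit W}"

definition uQVL :: "('a u_q_vec_lat, 'a \<Rightarrow> 'a) category" where
  "uQVL =
    \<lparr>Ob = {V. unital_q_vector_lattice V},
     Hom = uqvl_hom,
     Ident = (\<lambda>V. \<lambda>x \<in> carrier V. x),
     Comp = (\<lambda>U V W g f. compose (carrier U) g f)\<rparr>"


section \<open>The functor\<close>

definition unit_interval :: "'a u_q_vec_lat \<Rightarrow> 'a dmv_alg" where
  "unit_interval V =
    \<lparr>carrier = {x \<in> carrier V. \<zero>\<^bsub>V\<^esub> \<preceq>\<^bsub>V\<^esub> x \<and> x \<preceq>\<^bsub>V\<^esub> vunit V},
     mv_plus = (\<lambda>x y. vmeet V (vunit V) (x \<oplus>\<^bsub>V\<^esub> y)),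
     mv_neg = (\<lambda>x. vunit V \<ominus>\<^bsub>V\<^esub> x),
     mv_zero = \<zero>\<^bsub>V\<^esub>,
     dmv_delta = (\<lambda>n x. (1 / rat_of_nat n) \<odot>\<^bsub>V\<^esub> x)\<rparr>"

definition Gamma_Q :: "('a u_q_vec_lat, 'a \<Rightarrow> 'a, 'a dmv_alg, 'a \<Rightarrow> 'a) cat_functor" where
  "Gamma_Q =
    \<lparr>fobj = unit_interval,
     farr = (\<lambda>V W f. restrict f (carrier (unit_interval V)))\<rparr>"

text \<open>
  The type variable \<open>'a\<close> of \<^const>\<open>uQVL\<close> and \<^const>\<open>DMV\<close> plays the role of a universe: the objects are all
  structures whose carrier is a subset of the type \<open>'a\<close>.  The two categories can share this universe
  because a non-trivial DMV-algebra is infinite and has the same cardinality as the vector lattice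
  it is the unit interval of.
\<close>

end

theory Submission
  imports Defs
begin

text \<open>
  Fullness and faithfulness rest on the fact that every vector of a \<open>\<rat>\<close>-vector lattice with strong
  unit \<open>u\<close> is of the form \<open>N (x - y)\<close> with \<open>x\<close>, \<open>y\<close> in \<open>[0, u]\<close>: a homomorphism \<open>g\<close> of DMV-algebras
  preserves subconvex combinations, hence \<open>N (x - y) \<mapsto> N (g x - g y)\<close> is a well-defined extension of \<open>g\<close>.

  For essential surjectivity, a DMV-algebra \<open>A\<close> has a multiplication by rationals in \<open>[0, 1]\<close>, so
  formal combinations of its elements with nonnegative coefficients of total weight at most \<open>1\<close> can be
  evaluated in \<open>A\<close>. The free \<open>\<rat>\<close>-vector space on \<open>A\<close> is preordered by declaring \<open>N (\<alpha> - \<beta>) \<ge> 0\<close> when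
  \<open>\<beta>\<close> evaluates to something below the value of \<open>\<alpha>\<close>. The quotient by the induced equivalence is a vector
  lattice whose unit interval is \<open>A\<close>.
\<close>

section \<open>Fully faithful, essentially surjective functors\<close>

text \<open>The obstacle throughout is truncation: a sum in \<open>A\<close> can be cancelled or
  rescaled only if it is exact, that is, if its summands are orthogonal. Two expressions with
  factors \<open>N\<close> and \<open>M\<close> are therefore never added directly. They receive the
  weights \<open>N/(N+M)\<close> and \<open>M/(N+M)\<close>, whose sum is 1, so that every sum stays
  exact and the common factor \<open>N+M\<close> can be restored outside. Independence of
  representations then needs division inside \<open>A\<close>: \<open>n x \<le> n y\<close> must
  imply \<open>x \<le> y\<close> for exact multiples. This is proved from disjointness of
  remainders, with no embedding of \<open>A\<close> into a product of chains or into a group. Joins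
  in the quotient need that scaling by a rational preserves least upper bounds, which follows from
  an explicit upper adjoint of the scaling map. A last obstacle is the universe: both categories
  consist of structures on the same type \<open>'a\<close>, so the quotient cannot be formed from
  sets of functions. Its classes are coded by elements of \<open>'a\<close>, which takes a
  cardinality argument for infinite carriers and a separate treatment of the trivial
  algebra.\<close>

lemma categorical_equivalence_if_fully_faithful_ess_surj:
  fixes C :: "('o, 'm) category" and D :: "('p, 'n) category"
  assumes F: "is_functor C D F"
    and full: "\<And>X Y g. \<lbrakk>X \<in> Ob C; Y \<in> Ob C; g \<in> Hom D (fobj F X) (fobj F Y)\<rbrakk>
      \<Longrightarrow> \<exists>f \<in> Hom C X Y. farr F X Y f = g"
    and faithful: "\<And>X Y f f'. \<lbrakk>X \<in> Ob C; Y \<in> Ob C; f \<in> Hom C X Y; f' \<in> Hom C X Y;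
      farr F X Y f = farr F X Y f'\<rbrakk> \<Longrightarrow> f = f'"
    and ess: "\<And>Z. Z \<in> Ob D \<Longrightarrow> \<exists>X \<in> Ob C. \<exists>e. is_iso D (fobj F X) Z e"
  shows "categorical_equivalence C D F"
proof -
  interpret F: is_functor C D F by (rule F)
  \<comment> \<open>Fullness provides a preimage under \<open>F\<close>; faithfulness makes it
    unique, so equations between lifts can be checked after applying \<open>F\<close>.\<close>
  define lift where "lift X Y g = (SOME f. f \<in> Hom C X Y \<and> farr F X Y f = g)" for X Y g
  have lift: "lift X Y g \<in> Hom C X Y" "farr F X Y (lift X Y g) = g"
    if "X \<in> Ob C" "Y \<in> Ob C" "g \<in> Hom D (fobj F X) (fobj F Y)" for X Y g
    using someI_ex[of "\<lambda>f. f \<in> Hom C X Y \<and> farr F X Y f = g"] full[OF that]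
    by (auto simp: lift_def)
  have "\<forall>Z \<in> Ob D. \<exists>p. fst p \<in> Ob C \<and> is_iso D (fobj F (fst p)) Z (snd p)"
    using ess by force
  then obtain p where p: "\<And>Z. Z \<in> Ob D \<Longrightarrow> fst (p Z) \<in> Ob C"
    "\<And>Z. Z \<in> Ob D \<Longrightarrow> is_iso D (fobj F (fst (p Z))) Z (snd (p Z))"
    by metis
  define G0 where "G0 Z = fst (p Z)" for Z
  define e where "e Z = snd (p Z)" for Z
  define T where "T Z = fobj F (G0 Z)" for Z
  have G0 [simp]: "G0 Z \<in> Ob C" if "Z \<in> Ob D" for Z using p that by (simp add: G0_def)
  have FOb [simp]: "fobj F X \<in> Ob D" if "X \<in> Ob C" for X using F.fobj_in_Ob that .
  have T [simp]: "T Z \<in> Ob D" if "Z \<in> Ob D" for Z using that by (simp add: T_def)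
  have iso_e: "is_iso D (T Z) Z (e Z)" if "Z \<in> Ob D" for Z
    using p that by (simp add: T_def G0_def e_def)
  then have "\<forall>Z \<in> Ob D. \<exists>h. h \<in> Hom D Z (T Z) \<and> Comp D (T Z) Z (T Z) h (e Z) = Ident D (T Z)
      \<and> Comp D Z (T Z) Z (e Z) h = Ident D Z"
    unfolding is_iso_def by blast
  then obtain e' where e': "\<And>Z. Z \<in> Ob D \<Longrightarrow> e' Z \<in> Hom D Z (T Z)"
    and e'e: "\<And>Z. Z \<in> Ob D \<Longrightarrow> Comp D (T Z) Z (T Z) (e' Z) (e Z) = Ident D (T Z)"
    and ee': "\<And>Z. Z \<in> Ob D \<Longrightarrow> Comp D Z (T Z) Z (e Z) (e' Z) = Ident D Z"
    by metis
  have e: "e Z \<in> Hom D (T Z) Z" if "Z \<in> Ob D" for Z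
    using iso_e[OF that] by (simp add: is_iso_def)
  \<comment> \<open>\<open>K\<close> conjugates \<open>g\<close> with the chosen isomorphisms
    \<open>e\<close>. It is an arrow between objects in the image of \<open>F\<close>, so its lift
    can serve as the value of the inverse functor at \<open>g\<close>.\<close>
  define K where "K Z Z' g = Comp D (T Z) Z (T Z') (Comp D Z Z' (T Z') (e' Z') g) (e Z)" for Z Z' g
  have K: "K Z Z' g \<in> Hom D (T Z) (T Z')"
    if "Z \<in> Ob D" "Z' \<in> Ob D" "g \<in> Hom D Z Z'" for Z Z' g
    unfolding K_def using that e e' F.D.Comp_in_Hom T by metis
  have K_Ident: "K Z Z (Ident D Z) = Ident D (T Z)" if "Z \<in> Ob D" for Z
    unfolding K_def using that e' e'e F.D.Comp_Ident_right T by metis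
  \<comment> \<open>This equation is already the naturality of \<open>e\<close>, the counit of the
    equivalence.\<close>
  have e_K: "Comp D (T Z) (T Z') Z' (e Z') (K Z Z' g) = Comp D (T Z) Z Z' g (e Z)"
    if Z: "Z \<in> Ob D" "Z' \<in> Ob D" "g \<in> Hom D Z Z'" for Z Z' g
  proof -
    have "Comp D (T Z) (T Z') Z' (e Z') (K Z Z' g)
      = Comp D (T Z) Z Z' (Comp D Z (T Z') Z' (e Z') (Comp D Z Z' (T Z') (e' Z') g)) (e Z)"
      unfolding K_def using Z e e' T F.D.Comp_in_Hom F.D.Comp_assoc by metis
    also have "Comp D Z (T Z') Z' (e Z') (Comp D Z Z' (T Z') (e' Z') g) = g"
      using Z e e' T ee' F.D.Comp_assoc F.D.Comp_Ident_left by metis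
    finally show ?thesis .
  qed
  have K_Comp: "K X Z (Comp D X Y Z g f) = Comp D (T X) (T Y) (T Z) (K Y Z g) (K X Y f)"
    if X: "X \<in> Ob D" "Y \<in> Ob D" "Z \<in> Ob D" "f \<in> Hom D X Y" "g \<in> Hom D Y Z" for X Y Z f g
  proof -
    have "K X Z (Comp D X Y Z g f)
      = Comp D (T X) X (T Z) (Comp D X Y (T Z) (Comp D Y Z (T Z) (e' Z) g) f) (e X)"
      unfolding K_def using X F.D.Comp_assoc[of X Y Z "T Z" f g "e' Z"] e' T by simp
    also have "\<dots> = Comp D (T X) Y (T Z) (Comp D Y Z (T Z) (e' Z) g) (Comp D (T X) X Y f (e X))"
      using X e e' T F.D.Comp_in_Hom F.D.Comp_assoc by metis
    also have "\<dots> = Comp D (T X) Y (T Z) (Comp D Y Z (T Z) (e' Z) g)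
        (Comp D (T X) (T Y) Y (e Y) (K X Y f))"
      using e_K X by simp
    also have "\<dots> = Comp D (T X) (T Y) (T Z) (K Y Z g) (K X Y f)"
      unfolding K_def[of Y Z g]
      using F.D.Comp_assoc[of "T X" "T Y" Y "T Z" "K X Y f" "e Y" "Comp D Y Z (T Z) (e' Z) g"]
        X K e e' T F.D.Comp_in_Hom by metis
    finally show ?thesis .
  qed
  define G where "G = \<lparr>fobj = G0, farr = (\<lambda>Z Z' g. lift (G0 Z) (G0 Z') (K Z Z' g))\<rparr>"
  have Garr: "farr G Z Z' g \<in> Hom C (G0 Z) (G0 Z')" "farr F (G0 Z) (G0 Z') (farr G Z Z' g) = K Z Z' g"
    if "Z \<in> Ob D" "Z' \<in> Ob D" "g \<in> Hom D Z Z'" for Z Z' g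
    using lift[of "G0 Z" "G0 Z'" "K Z Z' g"] K[OF that] that by (simp_all add: G_def T_def)
  have G_obj [simp]: "fobj G Z = G0 Z" for Z by (simp add: G_def)
  have G: "is_functor D C G"
  proof (intro is_functor.intro F.C.category_axioms F.D.category_axioms is_functor_axioms.intro)
    fix X assume X: "X \<in> Ob D"
    show "farr G X X (Ident D X) = Ident C (fobj G X)"
      by (rule faithful[of "G0 X" "G0 X"])
        (use X Garr K_Ident F.D.Ident_in_Hom F.C.Ident_in_Hom F.farr_Ident in \<open>simp_all add: T_def\<close>)
  next
    fix X Y Z f g assume X: "X \<in> Ob D" "Y \<in> Ob D" "Z \<in> Ob D" "f \<in> Hom D X Y" "g \<in> Hom D Y Z"
    show "farr G X Z (Comp D X Y Z g f)
        = Comp C (fobj G X) (fobj G Y) (fobj G Z) (farr G Y Z g) (farr G X Y f)"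
    proof (rule faithful[of "G0 X" "G0 Z"])
      show "Comp C (fobj G X) (fobj G Y) (fobj G Z) (farr G Y Z g) (farr G X Y f) \<in> Hom C (G0 X) (G0 Z)"
        using F.C.Comp_in_Hom X Garr by simp
      show "farr F (G0 X) (G0 Z) (farr G X Z (Comp D X Y Z g f)) =
        farr F (G0 X) (G0 Z) (Comp C (fobj G X) (fobj G Y) (fobj G Z) (farr G Y Z g) (farr G X Y f))"
        using X Garr F.farr_Comp[of "G0 X" "G0 Y" "G0 Z" "farr G X Y f" "farr G Y Z g"]
          F.D.Comp_in_Hom K_Comp[OF X] by (simp add: T_def)
    qed (use X Garr F.D.Comp_in_Hom in simp_all)
  qed (use Garr in simp_all)
  have idC: "is_functor C C id_functor" and idD: "is_functor D D id_functor"
    by (unfold_locales; simp add: id_functor_def)+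
  have GF: "is_functor C C (comp_functor G F)"
    using G F by (unfold_locales)
      (simp_all add: comp_functor_def is_functor.farr_Ident is_functor.farr_Comp
        is_functor.farr_in_Hom is_functor.fobj_in_Ob del: G_obj)
  have FG: "is_functor D D (comp_functor F G)"
    using G F by (unfold_locales)
      (simp_all add: comp_functor_def is_functor.farr_Ident is_functor.farr_Comp
        is_functor.farr_in_Hom is_functor.fobj_in_Ob del: G_obj)
  \<comment> \<open>The unit at \<open>X\<close> is the lift of the inverse isomorphism at
    \<open>fobj F X\<close>, and \<open>\<eta>'\<close> lifts the isomorphism itself; that they are
    mutually inverse is inherited through faithfulness.\<close>
  define \<eta> where "\<eta> X = lift X (G0 (fobj F X)) (e' (fobj F X))" for X
  define \<eta>' where "\<eta>' X = lift (G0 (fobj F X)) X (e (fobj F X))" for X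
  have \<eta>: "\<eta> X \<in> Hom C X (G0 (fobj F X))" "farr F X (G0 (fobj F X)) (\<eta> X) = e' (fobj F X)"
    and \<eta>': "\<eta>' X \<in> Hom C (G0 (fobj F X)) X" "farr F (G0 (fobj F X)) X (\<eta>' X) = e (fobj F X)"
    if "X \<in> Ob C" for X
    using that lift e[of "fobj F X"] e'[of "fobj F X"] unfolding \<eta>_def \<eta>'_def T_def by simp_all
  have "natural_isomorphism C C id_functor (comp_functor G F) \<eta>"
  proof (intro natural_isomorphism.intro idC GF natural_isomorphism_axioms.intro)
    fix X assume X: "X \<in> Ob C"
    let ?Y = "G0 (fobj F X)"
    have Y: "?Y \<in> Ob C" using X by simp
    have "Comp C X ?Y X (\<eta>' X) (\<eta> X) = Ident C X"
      by (rule faithful[of X X])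
        (use X Y \<eta>[OF X] \<eta>'[OF X] ee'[of "fobj F X"] F.C.Comp_in_Hom F.C.Ident_in_Hom
          F.farr_Ident F.farr_Comp in \<open>simp_all add: T_def\<close>)
    moreover have "Comp C ?Y X ?Y (\<eta> X) (\<eta>' X) = Ident C ?Y"
      by (rule faithful[of ?Y ?Y])
        (use X Y \<eta>[OF X] \<eta>'[OF X] e'e[of "fobj F X"] F.C.Comp_in_Hom F.C.Ident_in_Hom
          F.farr_Ident F.farr_Comp in \<open>simp_all add: T_def\<close>)
    ultimately show "is_iso C (fobj id_functor X) (fobj (comp_functor G F) X) (\<eta> X)"
      using \<eta>[OF X] \<eta>'[OF X] by (auto simp: is_iso_def id_functor_def comp_functor_def)
  next
    fix X Y f assume X: "X \<in> Ob C" "Y \<in> Ob C" "f \<in> Hom C X Y"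
    let ?GX = "G0 (fobj F X)" and ?GY = "G0 (fobj F Y)"
    let ?f = "farr F X Y f"
    have f: "?f \<in> Hom D (fobj F X) (fobj F Y)" using F.farr_in_Hom X by simp
    have "Comp C X Y ?GY (\<eta> Y) f = Comp C X ?GX ?GY (farr G (fobj F X) (fobj F Y) ?f) (\<eta> X)"
    proof (rule faithful[of X ?GY])
      have "Comp D (fobj F X) (T (fobj F X)) (T (fobj F Y)) (K (fobj F X) (fobj F Y) ?f) (e' (fobj F X))
        = Comp D (fobj F X) (fobj F X) (T (fobj F Y))
            (Comp D (fobj F X) (fobj F Y) (T (fobj F Y)) (e' (fobj F Y)) ?f)
            (Comp D (fobj F X) (T (fobj F X)) (fobj F X) (e (fobj F X)) (e' (fobj F X)))"
        unfolding K_def using X f e e' T FOb F.D.Comp_in_Hom F.D.Comp_assoc by metis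
      also have "\<dots> = Comp D (fobj F X) (fobj F Y) (T (fobj F Y)) (e' (fobj F Y)) ?f"
        using X f e e' ee' T FOb F.D.Comp_in_Hom F.D.Comp_Ident_right by metis
      finally show "farr F X ?GY (Comp C X Y ?GY (\<eta> Y) f)
          = farr F X ?GY (Comp C X ?GX ?GY (farr G (fobj F X) (fobj F Y) ?f) (\<eta> X))"
        using X f \<eta> Garr F.farr_Comp[of X Y ?GY f "\<eta> Y"]
          F.farr_Comp[of X ?GX ?GY "\<eta> X" "farr G (fobj F X) (fobj F Y) ?f"] by (simp add: T_def)
    next
      show "Comp C X Y ?GY (\<eta> Y) f \<in> Hom C X ?GY"
        using X \<eta> F.C.Comp_in_Hom FOb G0 by metis
      show "Comp C X ?GX ?GY (farr G (fobj F X) (fobj F Y) ?f) (\<eta> X) \<in> Hom C X ?GY"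
        using X f \<eta> Garr F.C.Comp_in_Hom FOb G0 by metis
    qed (use X in simp_all)
    then show "Comp C (fobj id_functor X) (fobj id_functor Y) (fobj (comp_functor G F) Y) (\<eta> Y)
          (farr id_functor X Y f)
        = Comp C (fobj id_functor X) (fobj (comp_functor G F) X) (fobj (comp_functor G F) Y)
          (farr (comp_functor G F) X Y f) (\<eta> X)"
      by (simp add: id_functor_def comp_functor_def)
  qed
  moreover have "natural_isomorphism D D (comp_functor F G) id_functor e"
    using iso_e e_K Garr
    by (intro natural_isomorphism.intro idD FG natural_isomorphism_axioms.intro)
      (simp_all add: id_functor_def comp_functor_def T_def)
  ultimately show ?thesis
    unfolding categorical_equivalence_def using F G by blast
qed

section \<open>MV-algebras\<close>

context mv_algebra
begin

abbreviation neg where "neg \<equiv> mv_neg A"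
abbreviation zero (\<open>\<zero>\<^sub>A\<close>) where "\<zero>\<^sub>A \<equiv> mv_zero A"
abbreviation unit (\<open>\<one>\<^sub>A\<close>) where "\<one>\<^sub>A \<equiv> mv_neg A (mv_zero A)"

definition le (infix \<open>\<unlhd>\<close> 50) where "x \<unlhd> y \<longleftrightarrow> neg x \<boxplus> y = \<one>\<^sub>A"
text \<open>In the real interval [0,1] this is max(x - y, 0). Hence
  \<open>diff x y \<boxplus> y\<close> is the maximum, and the axiom \<open>lukasiewicz\<close> says
  precisely that this term is symmetric.\<close>

definition diff where "diff x y = neg (neg x \<boxplus> y)"
definition join where "join x y = diff x y \<boxplus> y"
definition meet where "meet x y = neg (join (neg x) (neg y))"
text \<open>\<open>x \<bottom> y\<close> says that \<open>x \<boxplus> y\<close> is an untruncated sum, and \<open>exact n x\<close> below says the same of the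
  \<open>n\<close>-fold sum of \<open>x\<close>.\<close>

definition orth (infix \<open>\<bottom>\<close> 50) where "x \<bottom> y \<longleftrightarrow> x \<unlhd> neg y"

section \<open>Monoid laws, natural order and lattice operations of an MV-algebra\<close>

lemma monoid_mv_monoid: "monoid (mv_monoid A)"
  using plus_comm_monoid by (rule comm_monoid.axioms(1))

lemma plus_closed [simp, intro]: "\<lbrakk>x \<in> carrier A; y \<in> carrier A\<rbrakk> \<Longrightarrow> x \<boxplus> y \<in> carrier A"
  using monoid_mv_monoid monoid.m_closed[of "mv_monoid A" x y]
  by (simp add: mv_monoid_def)

lemma zero_closed [simp, intro]: "\<zero>\<^sub>A \<in> carrier A"
  using monoid_mv_monoid monoid.one_closed[of "mv_monoid A"]
  by (simp add: mv_monoid_def)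

lemmas neg_closed' [simp, intro] = neg_closed
lemmas neg_neg' [simp] = neg_neg

lemma plus_assoc: "\<lbrakk>x \<in> carrier A; y \<in> carrier A; z \<in> carrier A\<rbrakk> \<Longrightarrow> (x \<boxplus> y) \<boxplus> z = x \<boxplus> (y \<boxplus> z)"
  using monoid_mv_monoid monoid.m_assoc[of "mv_monoid A" x y z]
  by (simp add: mv_monoid_def)

lemma plus_comm: "\<lbrakk>x \<in> carrier A; y \<in> carrier A\<rbrakk> \<Longrightarrow> x \<boxplus> y = y \<boxplus> x"
  using comm_monoid.m_comm[OF plus_comm_monoid, of x y] by (simp add: mv_monoid_def)

lemma plus_lcomm: "\<lbrakk>x \<in> carrier A; y \<in> carrier A; z \<in> carrier A\<rbrakk> \<Longrightarrow> x \<boxplus> (y \<boxplus> z) = y \<boxplus> (x \<boxplus> z)"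
  by (metis plus_assoc plus_comm)

lemmas plus_ac = plus_assoc plus_comm plus_lcomm

lemma zero_plus [simp]: "x \<in> carrier A \<Longrightarrow> \<zero>\<^sub>A \<boxplus> x = x"
  using monoid_mv_monoid monoid.l_one[of "mv_monoid A" x]
  by (simp add: mv_monoid_def)

lemma plus_zero [simp]: "x \<in> carrier A \<Longrightarrow> x \<boxplus> \<zero>\<^sub>A = x"
  by (metis zero_plus plus_comm zero_closed)

lemma unit_plus [simp]: "x \<in> carrier A \<Longrightarrow> \<one>\<^sub>A \<boxplus> x = \<one>\<^sub>A"
  by (rule neg_zero_plus)

lemma plus_unit [simp]: "x \<in> carrier A \<Longrightarrow> x \<boxplus> \<one>\<^sub>A = \<one>\<^sub>A"
  by (metis unit_plus plus_comm zero_closed neg_closed)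

text \<open>The axiom \<open>lukasiewicz\<close> with \<open>\<one>\<^sub>A\<close> as second
  argument: its left side is absorbed into \<open>\<one>\<^sub>A\<close>, and its right side reduces
  to the sum of \<open>x\<close> and its negation.\<close>

lemma neg_plus_self [simp]: "x \<in> carrier A \<Longrightarrow> neg x \<boxplus> x = \<one>\<^sub>A"
  using lukasiewicz[of x "\<one>\<^sub>A"] by simp

lemma diff_closed [simp, intro]: "\<lbrakk>x \<in> carrier A; y \<in> carrier A\<rbrakk> \<Longrightarrow> diff x y \<in> carrier A"
  by (simp add: diff_def)

lemma join_closed [simp, intro]: "\<lbrakk>x \<in> carrier A; y \<in> carrier A\<rbrakk> \<Longrightarrow> join x y \<in> carrier A"
  by (simp add: join_def)

lemma meet_closed [simp, intro]: "\<lbrakk>x \<in> carrier A; y \<in> carrier A\<rbrakk> \<Longrightarrow> meet x y \<in> carrier A"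
  by (simp add: meet_def)

lemma join_commute: "\<lbrakk>x \<in> carrier A; y \<in> carrier A\<rbrakk> \<Longrightarrow> join x y = join y x"
  by (simp add: join_def diff_def lukasiewicz)

lemma le_refl [simp]: "x \<in> carrier A \<Longrightarrow> x \<unlhd> x"
  by (simp add: le_def)

lemma le_plus1 [simp]: "\<lbrakk>x \<in> carrier A; y \<in> carrier A\<rbrakk> \<Longrightarrow> x \<unlhd> x \<boxplus> y"
  unfolding le_def using plus_assoc[of "neg x" x y] by simp

lemma le_plus2 [simp]: "\<lbrakk>x \<in> carrier A; y \<in> carrier A\<rbrakk> \<Longrightarrow> x \<unlhd> y \<boxplus> x"
  using le_plus1 plus_comm by metis

lemma le_imp_join: "\<lbrakk>x \<in> carrier A; y \<in> carrier A; x \<unlhd> y\<rbrakk> \<Longrightarrow> join x y = y"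
  by (simp add: join_def diff_def le_def)

lemma join_ge: "\<lbrakk>x \<in> carrier A; y \<in> carrier A\<rbrakk> \<Longrightarrow> y \<unlhd> join x y"
  "\<lbrakk>x \<in> carrier A; y \<in> carrier A\<rbrakk> \<Longrightarrow> x \<unlhd> join x y"
   apply (simp add: join_def)
  apply (subst join_commute; simp add: join_def)
  done

text \<open>Symmetry of the join gives \<open>join y x = y\<close>, whose unfolding is this sum. By
  \<open>orth_diff\<close> the sum is exact, so the truncated difference is the true complement of
  \<open>x\<close> in \<open>y\<close>.\<close>

lemma le_imp_decomp:
  "\<lbrakk>x \<in> carrier A; y \<in> carrier A; x \<unlhd> y\<rbrakk> \<Longrightarrow> y = x \<boxplus> diff y x"
  using le_imp_join join_commute plus_comm unfolding join_def by (metis diff_closed)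

lemma orth_diff [simp]: "\<lbrakk>x \<in> carrier A; y \<in> carrier A\<rbrakk> \<Longrightarrow> x \<bottom> diff y x"
  by (simp add: orth_def diff_def)

lemma le_antisym: "\<lbrakk>x \<in> carrier A; y \<in> carrier A; x \<unlhd> y; y \<unlhd> x\<rbrakk> \<Longrightarrow> x = y"
  by (metis le_imp_join join_commute)

lemma le_trans: "\<lbrakk>x \<in> carrier A; y \<in> carrier A; z \<in> carrier A; x \<unlhd> y; y \<unlhd> z\<rbrakk> \<Longrightarrow> x \<unlhd> z"
  by (metis le_imp_decomp diff_closed le_plus1 plus_assoc plus_closed)

lemma zero_le [simp]: "x \<in> carrier A \<Longrightarrow> \<zero>\<^sub>A \<unlhd> x"
  by (simp add: le_def)

lemma le_unit [simp]: "x \<in> carrier A \<Longrightarrow> x \<unlhd> \<one>\<^sub>A"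
  by (simp add: le_def)

lemma le_zero_iff: "x \<in> carrier A \<Longrightarrow> x \<unlhd> \<zero>\<^sub>A \<longleftrightarrow> x = \<zero>\<^sub>A"
  using le_antisym by auto

lemma neg_le_iff [simp]: "\<lbrakk>x \<in> carrier A; y \<in> carrier A\<rbrakk> \<Longrightarrow> neg x \<unlhd> neg y \<longleftrightarrow> y \<unlhd> x"
  by (simp add: le_def plus_comm)

lemma le_neg_iff: "\<lbrakk>x \<in> carrier A; y \<in> carrier A\<rbrakk> \<Longrightarrow> x \<unlhd> neg y \<longleftrightarrow> y \<unlhd> neg x"
  using neg_le_iff[of "neg x" y] by simp

lemma plus_mono_right:
  assumes "x \<in> carrier A" "y \<in> carrier A" "z \<in> carrier A" "x \<unlhd> y"
  shows "x \<boxplus> z \<unlhd> y \<boxplus> z"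
proof -
  have "y \<boxplus> z = (x \<boxplus> z) \<boxplus> diff y x"
    using le_imp_decomp[of x y] assms by (metis diff_closed plus_assoc plus_comm)
  then show ?thesis using assms by simp
qed

lemma plus_mono:
  assumes "x \<in> carrier A" "y \<in> carrier A" "x' \<in> carrier A" "y' \<in> carrier A" "x \<unlhd> y" "x' \<unlhd> y'"
  shows "x \<boxplus> x' \<unlhd> y \<boxplus> y'"
  using plus_mono_right[of x y x'] plus_mono_right[of x' y' y] assms plus_comm
    le_trans[of "x \<boxplus> x'" "y \<boxplus> x'" "y \<boxplus> y'"] by simp

lemma diff_le_iff:
  "\<lbrakk>x \<in> carrier A; y \<in> carrier A; z \<in> carrier A\<rbrakk> \<Longrightarrow> diff x y \<unlhd> z \<longleftrightarrow> x \<unlhd> y \<boxplus> z"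
  by (simp add: le_def diff_def plus_assoc)

lemma diff_mono:
  assumes "x \<in> carrier A" "y \<in> carrier A" "z \<in> carrier A" "x \<unlhd> y"
  shows "diff x z \<unlhd> diff y z"
  using assms plus_mono_right[of "neg y" "neg x" z] by (simp add: diff_def)

lemma diff_le: "\<lbrakk>x \<in> carrier A; y \<in> carrier A\<rbrakk> \<Longrightarrow> diff x y \<unlhd> x"
  by (simp add: diff_le_iff)

text \<open>Truncated difference is monotone, so the join \<open>diff x y \<boxplus> y\<close> lies
  below \<open>diff z y \<boxplus> y\<close>, which is \<open>z\<close> because \<open>y\<close> is
  below \<open>z\<close>.\<close>

lemma join_least:
  assumes "x \<in> carrier A" "y \<in> carrier A" "z \<in> carrier A" "x \<unlhd> z" "y \<unlhd> z"
  shows "join x y \<unlhd> z"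
  using plus_mono_right[of "diff x y" "diff z y" y] assms diff_mono le_imp_decomp[of y z]
    plus_comm[of y "diff z y"] by (simp add: join_def)

lemma meet_le: "\<lbrakk>x \<in> carrier A; y \<in> carrier A\<rbrakk> \<Longrightarrow> meet x y \<unlhd> x"
  "\<lbrakk>x \<in> carrier A; y \<in> carrier A\<rbrakk> \<Longrightarrow> meet x y \<unlhd> y"
  unfolding meet_def using join_ge[of "neg x" "neg y"] neg_le_iff neg_neg
  by (metis join_closed neg_closed)+

lemma meet_greatest:
  assumes "x \<in> carrier A" "y \<in> carrier A" "z \<in> carrier A" "z \<unlhd> x" "z \<unlhd> y"
  shows "z \<unlhd> meet x y"
  using join_least[of "neg x" "neg y" "neg z"] assms
    le_neg_iff[of "join (neg x) (neg y)" z] by (simp add: meet_def)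

subsection \<open>Orthogonal sums\<close>

lemma orth_sym: "\<lbrakk>x \<in> carrier A; y \<in> carrier A\<rbrakk> \<Longrightarrow> x \<bottom> y \<longleftrightarrow> y \<bottom> x"
  unfolding orth_def by (rule le_neg_iff)

lemma orth_zero [simp]: "x \<in> carrier A \<Longrightarrow> x \<bottom> \<zero>\<^sub>A" "x \<in> carrier A \<Longrightarrow> \<zero>\<^sub>A \<bottom> x"
  by (simp_all add: orth_def)

lemma orth_mono:
  assumes "x \<in> carrier A" "y \<in> carrier A" "x' \<in> carrier A" "y' \<in> carrier A"
    "x' \<bottom> y'" "x \<unlhd> x'" "y \<unlhd> y'"
  shows "x \<bottom> y"
  using assms unfolding orth_def
  by (meson le_trans neg_closed neg_le_iff)

text \<open>The negation of the left side is the join of \<open>neg x\<close> and \<open>z\<close>,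
  and orthogonality says that this join is \<open>neg x\<close>. All cancellation in exact sums
  comes from here.\<close>

lemma diff_plus_cancel:
  assumes "x \<in> carrier A" "z \<in> carrier A" "x \<bottom> z"
  shows "diff (x \<boxplus> z) z = x"
proof -
  have "z \<unlhd> neg x" using assms orth_sym orth_def by blast
  then have "join (neg x) z = neg x"
    using le_imp_join[of z "neg x"] join_commute assms by simp
  then show ?thesis using assms by (simp add: join_def diff_def)
qed

lemma plus_le_cancel:
  assumes "x \<in> carrier A" "y \<in> carrier A" "z \<in> carrier A" "x \<bottom> z" "y \<bottom> z" "x \<boxplus> z \<unlhd> y \<boxplus> z"
  shows "x \<unlhd> y"
  using diff_mono[of "x \<boxplus> z" "y \<boxplus> z" z] assms by (simp add: diff_plus_cancel)

text \<open>Subtracting \<open>y\<close> from \<open>x \<boxplus> y \<unlhd> neg z\<close> leaves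
  \<open>x\<close> on the left by cancellation and \<open>neg (y \<boxplus> z)\<close> on the right.
  Exactness thus survives rebracketing.\<close>

lemma orth_assoc:
  assumes "x \<in> carrier A" "y \<in> carrier A" "z \<in> carrier A" "x \<bottom> y" "x \<boxplus> y \<bottom> z"
  shows "y \<bottom> z" "x \<bottom> y \<boxplus> z"
proof -
  show "y \<bottom> z" using orth_mono[of y z "x \<boxplus> y" z] assms by simp
  have "diff (x \<boxplus> y) y \<unlhd> diff (neg z) y"
    using assms by (intro diff_mono) (simp_all add: orth_def)
  moreover have "diff (x \<boxplus> y) y = x" using assms by (simp add: diff_plus_cancel)
  moreover have "diff (neg z) y = neg (y \<boxplus> z)" using assms by (simp add: diff_def plus_comm)
  ultimately show "x \<bottom> y \<boxplus> z" by (simp add: orth_def)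
qed

text \<open>Repeated rebracketing with \<open>orth_assoc\<close> exchanges the two middle summands
  of a four-term exact sum. This is what relates the multiples of \<open>x \<boxplus> y\<close> to
  those of \<open>x\<close> and \<open>y\<close>.\<close>

lemma orth_interchange:
  assumes "a \<in> carrier A" "b \<in> carrier A" "c \<in> carrier A" "d \<in> carrier A"
    "a \<bottom> b" "c \<bottom> d" "a \<boxplus> b \<bottom> c \<boxplus> d"
  shows "a \<bottom> c" "b \<bottom> d" "a \<boxplus> c \<bottom> b \<boxplus> d"
proof -
  show "a \<bottom> c" "b \<bottom> d"
    using orth_mono[of a c "a \<boxplus> b" "c \<boxplus> d"] orth_mono[of b d "a \<boxplus> b" "c \<boxplus> d"] assms by simp_all
  have 1: "b \<bottom> c \<boxplus> d" "a \<bottom> b \<boxplus> (c \<boxplus> d)" using orth_assoc[of a b "c \<boxplus> d"] assms by simp_all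
  have "d \<boxplus> c \<bottom> b" "d \<bottom> c" using 1 assms by (simp_all add: orth_sym plus_comm)
  then have 2: "d \<bottom> c \<boxplus> b" "c \<bottom> b" using orth_assoc[of d c b] assms by simp_all
  have "b \<boxplus> d \<boxplus> c \<bottom> a" using 1 assms by (simp add: orth_sym plus_ac)
  moreover have "b \<boxplus> d \<bottom> c"
  proof -
    have "c \<boxplus> d \<bottom> b" using 1 assms by (simp add: orth_sym)
    then have "c \<bottom> d \<boxplus> b" using orth_assoc[of c d b] assms by simp
    then show ?thesis using assms by (simp add: orth_sym plus_comm)
  qed
  ultimately have "b \<boxplus> d \<bottom> c \<boxplus> a" using orth_assoc[of "b \<boxplus> d" c a] assms by simp
  then show "a \<boxplus> c \<bottom> b \<boxplus> d" using assms by (simp add: orth_sym plus_comm)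
qed

lemma plus_interchange:
  "\<lbrakk>a \<in> carrier A; b \<in> carrier A; c \<in> carrier A; d \<in> carrier A\<rbrakk>
    \<Longrightarrow> (a \<boxplus> b) \<boxplus> (c \<boxplus> d) = (a \<boxplus> c) \<boxplus> (b \<boxplus> d)"
  by (simp add: plus_ac)

text \<open>Lowering \<open>x\<close> to \<open>x'\<close> gives
  \<open>y \<boxplus> x' \<unlhd> y \<boxplus> x = y' \<boxplus> x'\<close>, where both outer sums
  are exact, so \<open>x'\<close> cancels.\<close>

lemma plus_eq_imp_le:
  assumes "x \<in> carrier A" "y \<in> carrier A" "x' \<in> carrier A" "y' \<in> carrier A"
    "x \<bottom> y" "x' \<bottom> y'" "x \<boxplus> y = x' \<boxplus> y'" "x' \<unlhd> x"
  shows "y \<unlhd> y'"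
proof (rule plus_le_cancel[of _ _ x'])
  show "y \<bottom> x'" using assms orth_mono[of x' y x y] orth_sym by simp
  show "y \<boxplus> x' \<unlhd> y' \<boxplus> x'"
    using assms plus_mono_right[of x' x y] by (simp add: plus_comm)
qed (use assms orth_sym in simp_all)

text \<open>Equivalent to a vanishing meet, but phrased with common lower bounds so that no
  distributive law is needed for sums.\<close>

definition disj where "disj x y \<longleftrightarrow> (\<forall>c \<in> carrier A. c \<unlhd> x \<longrightarrow> c \<unlhd> y \<longrightarrow> c = \<zero>\<^sub>A)"

text \<open>A common lower bound \<open>c\<close> of \<open>x\<close> and
  \<open>y \<boxplus> z\<close> has \<open>diff c y\<close> below both \<open>x\<close> and
  \<open>z\<close>, hence zero. So \<open>c\<close> is below \<open>y\<close> and therefore zero as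
  well.\<close>

lemma disj_plus:
  assumes "x \<in> carrier A" "y \<in> carrier A" "z \<in> carrier A" "disj x y" "disj x z"
  shows "disj x (y \<boxplus> z)"
  unfolding disj_def
proof (intro ballI impI)
  fix c assume c: "c \<in> carrier A" "c \<unlhd> x" "c \<unlhd> y \<boxplus> z"
  then have "diff c y \<unlhd> z" using assms by (simp add: diff_le_iff)
  moreover have "diff c y \<unlhd> x" using le_trans[of "diff c y" c x] diff_le c assms by simp
  ultimately have "diff c y = \<zero>\<^sub>A" using assms c unfolding disj_def by blast
  then have "c \<unlhd> y" using diff_le_iff[of c y "\<zero>\<^sub>A"] c assms by simp
  then show "c = \<zero>\<^sub>A" using assms c unfolding disj_def by blast
qed

text \<open>\<open>c\<close> is the meet. A common lower bound of the two remainders could be added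
  to the meet without leaving the lower bounds of \<open>x\<close> and \<open>y\<close>, so it
  cancels to zero.\<close>

lemma disj_decomposition:
  assumes xy: "x \<in> carrier A" "y \<in> carrier A"
  obtains c d e where "c \<in> carrier A" "d \<in> carrier A" "e \<in> carrier A"
    "c \<bottom> d" "c \<bottom> e" "x = c \<boxplus> d" "y = c \<boxplus> e" "disj d e"
proof
  let ?m = "meet x y"
  show "x = ?m \<boxplus> diff x ?m" "y = ?m \<boxplus> diff y ?m"
    using xy meet_le le_imp_decomp by simp_all
  then have eqs: "?m \<boxplus> diff x ?m = x" "?m \<boxplus> diff y ?m = y" by simp_all
  show "disj (diff x ?m) (diff y ?m)"
    unfolding disj_def
  proof (intro ballI impI)
    fix c assume c: "c \<in> carrier A" "c \<unlhd> diff x ?m" "c \<unlhd> diff y ?m"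
    have "?m \<boxplus> c \<unlhd> x" "?m \<boxplus> c \<unlhd> y"
      using plus_mono[of ?m ?m c "diff x ?m"] plus_mono[of ?m ?m c "diff y ?m"] xy c eqs by simp_all
    then have "?m \<boxplus> c \<unlhd> ?m" using xy c by (intro meet_greatest) simp_all
    then have "c \<boxplus> ?m \<unlhd> \<zero>\<^sub>A \<boxplus> ?m" using xy c by (simp add: plus_comm)
    moreover have "c \<bottom> ?m"
      using orth_mono[of c ?m "diff x ?m" ?m] c xy orth_sym[of ?m "diff x ?m"] by simp
    ultimately have "c \<unlhd> \<zero>\<^sub>A" using plus_le_cancel[of c "\<zero>\<^sub>A" ?m] xy c by simp
    then show "c = \<zero>\<^sub>A" using c le_zero_iff by simp
  qed
qed (use xy in simp_all)

subsection \<open>Multiples\<close>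

lemma nsum_0 [simp]: "mv_nsum A 0 x = \<zero>\<^sub>A"
  by (simp add: mv_nsum_def mv_monoid_def)

lemma nsum_Suc: "mv_nsum A (Suc n) x = mv_nsum A n x \<boxplus> x"
  by (simp add: mv_nsum_def mv_monoid_def)

lemma nsum_closed [simp, intro]: "x \<in> carrier A \<Longrightarrow> mv_nsum A n x \<in> carrier A"
  by (induction n) (simp_all add: nsum_Suc)

lemma nsum_1 [simp]: "x \<in> carrier A \<Longrightarrow> mv_nsum A (Suc 0) x = x"
  by (simp add: nsum_Suc)

lemma nsum_zero [simp]: "mv_nsum A n \<zero>\<^sub>A = \<zero>\<^sub>A"
  by (induction n) (simp_all add: nsum_Suc)

lemma nsum_add: "x \<in> carrier A \<Longrightarrow> mv_nsum A (m + n) x = mv_nsum A m x \<boxplus> mv_nsum A n x"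
  by (induction n) (simp_all add: nsum_Suc plus_assoc)

lemma nsum_nsum: "x \<in> carrier A \<Longrightarrow> mv_nsum A m (mv_nsum A n x) = mv_nsum A (m * n) x"
  by (induction m) (simp_all add: nsum_Suc nsum_add[symmetric] add.commute)

lemma nsum_plus:
  "\<lbrakk>x \<in> carrier A; y \<in> carrier A\<rbrakk> \<Longrightarrow> mv_nsum A n (x \<boxplus> y) = mv_nsum A n x \<boxplus> mv_nsum A n y"
  by (induction n) (simp_all add: nsum_Suc plus_ac)

lemma nsum_mono:
  "\<lbrakk>x \<in> carrier A; y \<in> carrier A; x \<unlhd> y\<rbrakk> \<Longrightarrow> mv_nsum A n x \<unlhd> mv_nsum A n y"
  by (induction n) (simp_all add: nsum_Suc plus_mono)

lemma nsum_mono_index: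
  assumes "x \<in> carrier A" "m \<le> n"
  shows "mv_nsum A m x \<unlhd> mv_nsum A n x"
  using nsum_add[of x m "n - m"] assms by simp

definition exact where "exact n x \<longleftrightarrow> x \<bottom> mv_nsum A (n - 1) x"

lemma exact_mono:
  assumes "x \<in> carrier A" "y \<in> carrier A" "exact n y" "x \<unlhd> y" "m \<le> n"
  shows "exact m x"
proof -
  have "mv_nsum A (m - 1) x \<unlhd> mv_nsum A (n - 1) y"
    using nsum_mono[of x y "m - 1"] nsum_mono_index[of y "m - 1" "n - 1"] assms
      le_trans[of "mv_nsum A (m - 1) x" "mv_nsum A (m - 1) y" "mv_nsum A (n - 1) y"] by simp
  then show ?thesis
    using assms orth_mono[of x "mv_nsum A (m - 1) x" y "mv_nsum A (n - 1) y"] by (simp add: exact_def)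
qed

text \<open>\<open>exact\<close> tests only the splitting of one summand from the remaining
  \<open>n - 1\<close>. Rebracketing moves summands across one at a time, which is why
  \<open>j\<close> is generalised in the induction on \<open>i\<close>.\<close>

lemma orth_nsum:
  assumes "x \<in> carrier A" "exact n x" "i + j \<le> n"
  shows "mv_nsum A i x \<bottom> mv_nsum A j x"
  using assms(3)
proof (induction i arbitrary: j)
  case 0
  then show ?case using assms by simp
next
  case (Suc i)
  have "exact (Suc j) x" using exact_mono[of x x n "Suc j"] assms Suc by simp
  then have 1: "x \<bottom> mv_nsum A j x" by (simp add: exact_def)
  have 2: "mv_nsum A i x \<bottom> mv_nsum A (Suc j) x" using Suc by simp
  have "mv_nsum A j x \<boxplus> x \<bottom> mv_nsum A i x"
    using 2 assms by (simp add: nsum_Suc orth_sym)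
  then have "mv_nsum A j x \<bottom> x \<boxplus> mv_nsum A i x"
    using orth_assoc[of "mv_nsum A j x" x "mv_nsum A i x"] 1 assms by (simp add: orth_sym)
  then show ?case using assms by (simp add: nsum_Suc orth_sym plus_comm)
qed

lemma exact_nsum:
  assumes "x \<in> carrier A" "exact (k * n) x"
  shows "exact k (mv_nsum A n x)"
proof (cases k)
  case (Suc j)
  then show ?thesis
    using assms orth_nsum[of x "k * n" n "j * n"] by (simp add: exact_def nsum_nsum)
qed (use assms in \<open>simp add: exact_def\<close>)

lemma exact_plus:
  assumes "x \<in> carrier A" "y \<in> carrier A" "exact n x" "exact n y"
    "mv_nsum A n x \<bottom> mv_nsum A n y"
  shows "exact n (x \<boxplus> y)"
proof (cases n)
  case 0
  with assms show ?thesis by (simp add: exact_def)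
next
  case (Suc k)
  then show ?thesis
    using orth_interchange[of x "mv_nsum A k x" y "mv_nsum A k y"] assms
    by (simp add: exact_def nsum_plus nsum_Suc plus_comm)
qed

text \<open>In the step, exactness makes the \<open>k\<close>-fold multiple of
  \<open>x \<boxplus> y\<close> orthogonal to one more copy of it, and
  \<open>orth_interchange\<close> regroups this into the next multiples of \<open>x\<close> and of
  \<open>y\<close>.\<close>

lemma exact_plusD:
  assumes "x \<in> carrier A" "y \<in> carrier A" "x \<bottom> y" "exact n (x \<boxplus> y)"
  shows "mv_nsum A n x \<bottom> mv_nsum A n y"
proof -
  have "mv_nsum A k x \<bottom> mv_nsum A k y" if "k \<le> n" for k
    using that
  proof (induction k)
    case (Suc k)
    have "mv_nsum A k (x \<boxplus> y) \<bottom> mv_nsum A 1 (x \<boxplus> y)"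
      using assms Suc by (intro orth_nsum) simp_all
    then show ?case
      using orth_interchange[of "mv_nsum A k x" "mv_nsum A k y" x y] assms Suc
      by (simp add: nsum_plus nsum_Suc)
  qed (use assms in simp)
  then show ?thesis by simp
qed

text \<open>After splitting off the meet of \<open>x\<close> and \<open>y\<close>, the remainders \<open>d\<close>, \<open>e\<close> are disjoint and
  \<open>n d \<le> n e\<close>, which forces \<open>d = 0\<close>.\<close>

lemma nsum_le_cancel:
  assumes "x \<in> carrier A" "y \<in> carrier A" "exact n x" "exact n y" "n \<ge> 1"
    "mv_nsum A n x \<unlhd> mv_nsum A n y"
  shows "x \<unlhd> y"
proof -
  obtain c d e where cde: "c \<in> carrier A" "d \<in> carrier A" "e \<in> carrier A"
    "c \<bottom> d" "c \<bottom> e" "x = c \<boxplus> d" "y = c \<boxplus> e" "disj d e"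
    using disj_decomposition[OF assms(1,2)] .
  have "exact n (c \<boxplus> d)" "exact n (c \<boxplus> e)" using assms(3,4) cde(6,7) by simp_all
  then have orth: "mv_nsum A n d \<bottom> mv_nsum A n c" "mv_nsum A n e \<bottom> mv_nsum A n c"
    using exact_plusD[of c d n] exact_plusD[of c e n] cde(1-5)
      orth_sym[of "mv_nsum A n c" "mv_nsum A n d"] orth_sym[of "mv_nsum A n c" "mv_nsum A n e"]
    by simp_all
  have "mv_nsum A n x = mv_nsum A n d \<boxplus> mv_nsum A n c"
    "mv_nsum A n y = mv_nsum A n e \<boxplus> mv_nsum A n c"
    unfolding cde(6,7) using cde(1-3) by (simp_all add: nsum_plus plus_comm)
  then have "mv_nsum A n d \<unlhd> mv_nsum A n e"
    using plus_le_cancel[of "mv_nsum A n d" "mv_nsum A n e" "mv_nsum A n c"] orth cde(1-3) assms(6)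
    by simp
  moreover have "d \<unlhd> mv_nsum A n d" using nsum_mono_index[of d 1 n] cde(2) assms(5) by simp
  ultimately have "d \<unlhd> mv_nsum A n e"
    using le_trans[of d "mv_nsum A n d" "mv_nsum A n e"] cde(2,3) by simp
  moreover have "disj d (mv_nsum A k e)" for k
  proof (induction k)
    case 0
    then show ?case by (simp add: disj_def le_zero_iff)
  next
    case (Suc k)
    then show ?case using disj_plus[of d "mv_nsum A k e" e] cde(2,3,8) by (simp add: nsum_Suc)
  qed
  ultimately have "d = \<zero>\<^sub>A" using cde(2) unfolding disj_def by (metis le_refl)
  then show ?thesis unfolding cde(6,7) using cde(1,3) by simp
qed

lemma nsum_eq_cancel:
  assumes "x \<in> carrier A" "y \<in> carrier A" "exact n x" "exact n y" "n \<ge> 1"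
    "mv_nsum A n x = mv_nsum A n y"
  shows "x = y"
  using assms nsum_le_cancel[of x y n] nsum_le_cancel[of y x n] by (intro le_antisym) simp_all

end

section \<open>DMV-algebras\<close>

lemma common_denominator:
  assumes "q \<ge> 0" "(r::rat) \<ge> 0"
  obtains m k n where "n \<ge> 1" "q = rat_of_nat m / rat_of_nat n" "r = rat_of_nat k / rat_of_nat n"
proof -
  obtain a b where "quotient_of q = (a, b)" by fastforce
  then have ab: "b > 0" "q = of_int a / of_int b"
    using quotient_of_denom_pos quotient_of_div by blast+
  obtain c d where "quotient_of r = (c, d)" by fastforce
  then have cd: "d > 0" "r = of_int c / of_int d"
    using quotient_of_denom_pos quotient_of_div by blast+
  have ge: "a \<ge> 0" "c \<ge> 0" using ab cd assms by (simp_all add: zero_le_divide_iff)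
  show ?thesis
  proof
    show "nat (b * d) \<ge> 1" using ab cd by (simp add: Suc_leI)
    show "q = rat_of_nat (nat (a * d)) / rat_of_nat (nat (b * d))"
      "r = rat_of_nat (nat (c * b)) / rat_of_nat (nat (b * d))"
      using ab cd ge by (simp_all add: of_nat_nat)
  qed
qed

lemma rat_le_1_fraction:
  assumes "q \<ge> 0" "(q::rat) \<le> 1"
  obtains m n where "n \<ge> 1" "m \<le> n" "q = rat_of_nat m / rat_of_nat n"
proof -
  obtain m k n where n: "n \<ge> 1" "q = rat_of_nat m / rat_of_nat n"
    using common_denominator[of q q] assms by metis
  then have "rat_of_nat m \<le> rat_of_nat n" using assms by simp
  then show ?thesis using n that of_nat_le_iff by blast
qed

section \<open>Unique exact n-th parts and the laws of the division operators\<close>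

context dmv_algebra
begin

abbreviation \<delta> where "\<delta> \<equiv> dmv_delta A"

lemmas delta_closed' [simp, intro] = delta_closed
lemmas nsum_delta' [simp] = nsum_delta

lemma exact_delta: "\<lbrakk>n \<ge> 1; x \<in> carrier A\<rbrakk> \<Longrightarrow> exact n (\<delta> n x)"
  using delta_times_nsum_delta[of n x] unfolding exact_def orth_def le_def mv_times_def
  by (metis neg_closed neg_neg nsum_closed delta_closed plus_closed)

text \<open>Exact \<open>n\<close>-th parts are unique by \<open>nsum_eq_cancel\<close>. Identities
  for \<open>\<delta>\<close> are therefore proved by showing that a candidate is exact and has the
  right \<open>n\<close>-fold sum.\<close>

lemma delta_unique:
  "\<lbrakk>n \<ge> 1; y \<in> carrier A; exact n y\<rbrakk> \<Longrightarrow> \<delta> n (mv_nsum A n y) = y"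
  using nsum_eq_cancel[of "\<delta> n (mv_nsum A n y)" y n] exact_delta by simp

lemma delta_le_iff:
  assumes "n \<ge> 1" "x \<in> carrier A" "y \<in> carrier A"
  shows "\<delta> n x \<unlhd> \<delta> n y \<longleftrightarrow> x \<unlhd> y"
  using nsum_le_cancel[of "\<delta> n x" "\<delta> n y" n] nsum_mono[of "\<delta> n x" "\<delta> n y" n] exact_delta assms
  by auto

text \<open>The sum of the two parts is itself an exact \<open>n\<close>-th part of
  \<open>x \<boxplus> y\<close>, by \<open>exact_plus\<close>; here orthogonality of
  \<open>x\<close> and \<open>y\<close> enters.\<close>

lemma delta_plus:
  assumes "n \<ge> 1" "x \<in> carrier A" "y \<in> carrier A" "x \<bottom> y"
  shows "\<delta> n (x \<boxplus> y) = \<delta> n x \<boxplus> \<delta> n y" "\<delta> n x \<bottom> \<delta> n y"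
proof -
  have "exact n (\<delta> n x \<boxplus> \<delta> n y)"
    using assms by (intro exact_plus) (simp_all add: exact_delta)
  moreover have "mv_nsum A n (\<delta> n x \<boxplus> \<delta> n y) = x \<boxplus> y"
    using assms by (simp add: nsum_plus)
  ultimately show "\<delta> n (x \<boxplus> y) = \<delta> n x \<boxplus> \<delta> n y"
    using delta_unique[of n "\<delta> n x \<boxplus> \<delta> n y"] assms by simp
  have "\<delta> n x \<unlhd> x" "\<delta> n y \<unlhd> y"
    using nsum_mono_index[of "\<delta> n x" 1 n] nsum_mono_index[of "\<delta> n y" 1 n] assms by simp_all
  then show "\<delta> n x \<bottom> \<delta> n y" using orth_mono[of "\<delta> n x" "\<delta> n y" x y] assms by simp
qed

text \<open>The \<open>m\<close>-fold sum of \<open>\<delta> (m * n) x\<close> is an exact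
  \<open>n\<close>-th part of \<open>x\<close>, so uniqueness identifies it; a second use of
  uniqueness reads the same equation as division by \<open>m\<close>.\<close>

lemma delta_mult:
  assumes "m \<ge> 1" "n \<ge> 1" "x \<in> carrier A"
  shows "mv_nsum A m (\<delta> (m * n) x) = \<delta> n x" "\<delta> m (\<delta> n x) = \<delta> (m * n) x"
proof -
  let ?y = "\<delta> (m * n) x"
  have mn: "m * n \<ge> 1" using assms by simp
  have y: "?y \<in> carrier A" "exact (m * n) ?y" "mv_nsum A (m * n) ?y = x"
    using mn assms exact_delta by simp_all
  have "exact n (mv_nsum A m ?y)" "mv_nsum A n (mv_nsum A m ?y) = x"
    using y exact_nsum[of ?y n m] by (simp_all add: nsum_nsum mult.commute)
  then show 1: "mv_nsum A m ?y = \<delta> n x"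
    using delta_unique[of n "mv_nsum A m ?y"] assms y by simp
  have "exact m ?y" using exact_mono[of ?y ?y "m * n" m] y assms by simp
  then show "\<delta> m (\<delta> n x) = ?y" using delta_unique[of m ?y] 1 assms y by simp
qed

lemma delta_nsum:
  assumes "n \<ge> 1" "x \<in> carrier A" "exact k x"
  shows "\<delta> n (mv_nsum A k x) = mv_nsum A k (\<delta> n x)"
proof -
  have "\<delta> n (mv_nsum A j x) = mv_nsum A j (\<delta> n x)" if "j \<le> k" for j
    using that
  proof (induction j)
    case 0
    have "exact n \<zero>\<^sub>A" by (simp add: exact_def)
    then show ?case using delta_unique[of n "\<zero>\<^sub>A"] assms by simp
  next
    case (Suc j)
    have "mv_nsum A j x \<bottom> x" using orth_nsum[of x k j 1] assms Suc by simp
    then show ?case using Suc assms delta_plus by (simp add: nsum_Suc)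
  qed
  then show ?thesis by simp
qed

subsection \<open>Multiplication by rational numbers in the unit interval\<close>

text \<open>\<open>smul q x\<close> is only meaningful for \<open>0 \<le> q \<le> 1\<close>.\<close>

definition smul :: "rat \<Rightarrow> 'a \<Rightarrow> 'a" where
  "smul q x = mv_nsum A (nat (fst (quotient_of q))) (\<delta> (nat (snd (quotient_of q))) x)"

text \<open>Both sides become multiples of \<open>\<delta> (n * n') x\<close>, with equal
  multiplicities. Hence the value depends on the rational number alone, not on the fraction.\<close>

lemma nsum_delta_cong:
  assumes "n \<ge> 1" "n' \<ge> 1" "m * n' = m' * n" "x \<in> carrier A"
  shows "mv_nsum A m (\<delta> n x) = mv_nsum A m' (\<delta> n' x)"
  using delta_mult(1)[of n' n x] delta_mult(1)[of n n' x] assms nsum_nsum[of "\<delta> (n * n') x"]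
  by (metis mult.commute delta_closed le_numeral_extra(4) mult_le_mono nat_mult_1 nsum_nsum)

lemma smul_frac:
  assumes "n \<ge> 1" "x \<in> carrier A"
  shows "smul (rat_of_nat m / rat_of_nat n) x = mv_nsum A m (\<delta> n x)"
proof -
  obtain a b where ab: "quotient_of (rat_of_nat m / rat_of_nat n) = (a, b)" by fastforce
  then have b: "b > 0" "rat_of_nat m / rat_of_nat n = of_int a / of_int b"
    using quotient_of_denom_pos quotient_of_div by blast+
  moreover have "a \<ge> 0"
  proof -
    have "rat_of_int a / rat_of_int b \<ge> 0" using b(2)[symmetric] by simp
    then show ?thesis using b(1) by (simp add: zero_le_divide_iff)
  qed
  moreover have "rat_of_nat m * of_int b = of_int a * rat_of_nat n"
    using b assms by (simp add: field_simps)
  then have "int m * b = a * int n"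
    by (metis of_int_eq_iff of_int_mult of_int_of_nat_eq)
  then have "m * nat b = nat a * n"
    using b(1) \<open>a \<ge> 0\<close> by (metis int_nat_eq less_imp_le nat_int nat_mult_distrib of_nat_0_le_iff)
  ultimately show ?thesis
    using nsum_delta_cong[of n "nat b" m "nat a" x] assms b(1) unfolding smul_def ab by simp
qed

lemma smul_closed [simp, intro]:
  assumes "x \<in> carrier A" shows "smul q x \<in> carrier A"
proof -
  have "snd (quotient_of q) > 0" by (rule quotient_of_denom_pos')
  then show ?thesis using assms by (simp add: smul_def Suc_leI)
qed

lemma exact_delta_le: "\<lbrakk>n \<ge> 1; x \<in> carrier A; m \<le> n\<rbrakk> \<Longrightarrow> exact m (\<delta> n x)"
  using exact_mono[of "\<delta> n x" "\<delta> n x" n m] exact_delta by simp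

lemma smul_0 [simp]: "x \<in> carrier A \<Longrightarrow> smul 0 x = \<zero>\<^sub>A"
  using smul_frac[of 1 x 0] by simp

lemma smul_delta: "\<lbrakk>n \<ge> 1; x \<in> carrier A\<rbrakk> \<Longrightarrow> smul (1 / rat_of_nat n) x = \<delta> n x"
  using smul_frac[of n x 1] by simp

lemma smul_1 [simp]: "x \<in> carrier A \<Longrightarrow> smul 1 x = x"
  using smul_frac[of 1 x 1] nsum_delta[of 1 x] by simp

lemma smul_zero [simp]: assumes "q \<ge> 0" shows "smul q \<zero>\<^sub>A = \<zero>\<^sub>A"
proof -
  obtain m k n where "n \<ge> 1" "q = rat_of_nat m / rat_of_nat n"
    using common_denominator[of q q] assms by metis
  then show ?thesis using delta_nsum[of n "\<zero>\<^sub>A" 0] by (simp add: smul_frac exact_def)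
qed

lemma smul_add:
  assumes "q \<ge> 0" "r \<ge> 0" "q + r \<le> 1" "x \<in> carrier A"
  shows "smul (q + r) x = smul q x \<boxplus> smul r x" "smul q x \<bottom> smul r x"
proof -
  obtain m k n where n: "n \<ge> 1" "q = rat_of_nat m / rat_of_nat n" "r = rat_of_nat k / rat_of_nat n"
    using common_denominator assms by metis
  have qr: "q + r = rat_of_nat (m + k) / rat_of_nat n" using n by (simp add: add_divide_distrib)
  then have "rat_of_nat (m + k) \<le> rat_of_nat n" using assms n by simp
  then have "m + k \<le> n" using of_nat_le_iff by blast
  then show "smul q x \<bottom> smul r x"
    using n assms orth_nsum[of "\<delta> n x" n m k] exact_delta by (simp add: smul_frac)
  show "smul (q + r) x = smul q x \<boxplus> smul r x"
    unfolding qr unfolding n(2,3) using n assms by (simp add: smul_frac nsum_add del: of_nat_add)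
qed

lemma smul_plus:
  assumes q: "q \<ge> 0" "q \<le> 1" and xy: "x \<in> carrier A" "y \<in> carrier A" "x \<bottom> y"
  shows "smul q (x \<boxplus> y) = smul q x \<boxplus> smul q y"
proof -
  obtain m n where "n \<ge> 1" "m \<le> n" "q = rat_of_nat m / rat_of_nat n"
    using rat_le_1_fraction q by metis
  then show ?thesis using xy delta_plus by (simp add: smul_frac nsum_plus)
qed

lemma smul_smul:
  assumes q: "q \<ge> 0" "q \<le> 1" "r \<ge> 0" "r \<le> 1" and x: "x \<in> carrier A"
  shows "smul q (smul r x) = smul (q * r) x"
proof -
  obtain m n where n: "n \<ge> 1" "m \<le> n" "q = rat_of_nat m / rat_of_nat n"
    using rat_le_1_fraction q by metis
  obtain m' n' where n': "n' \<ge> 1" "m' \<le> n'" "r = rat_of_nat m' / rat_of_nat n'"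
    using rat_le_1_fraction q by metis
  have qr: "q * r = rat_of_nat (m * m') / rat_of_nat (n * n')" using n n' by simp
  show ?thesis unfolding qr unfolding n(3) n'(3)
    using n n' x delta_nsum[of n "\<delta> n' x" m'] exact_delta_le[of n' x m']
    by (simp add: smul_frac nsum_nsum delta_mult del: of_nat_mult)
qed

text \<open>For \<open>q = m/n\<close> this composes \<open>\<delta> n\<close>, which preserves and
  reflects the order, with an \<open>m\<close>-fold sum that is exact because
  \<open>m \<le> n\<close>. Positivity of \<open>q\<close> makes \<open>m\<close> nonzero, so that
  \<open>nsum_le_cancel\<close> applies.\<close>

lemma smul_le_iff:
  assumes q: "q > 0" "q \<le> 1" and xy: "x \<in> carrier A" "y \<in> carrier A"
  shows "smul q x \<unlhd> smul q y \<longleftrightarrow> x \<unlhd> y"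
proof -
  obtain m n where n: "n \<ge> 1" "m \<le> n" "q = rat_of_nat m / rat_of_nat n"
    using rat_le_1_fraction q by (metis less_imp_le)
  then have "m \<ge> 1" using q by (cases m) simp_all
  then show ?thesis
    using n xy exact_delta_le nsum_mono[of "\<delta> n x" "\<delta> n y" m] delta_le_iff
      nsum_le_cancel[of "\<delta> n x" "\<delta> n y" m] by (auto simp: smul_frac)
qed

text \<open>For \<open>q = m/n > 0\<close> scaling by \<open>q\<close> has an upper adjoint: the
  greatest \<open>z\<close> with \<open>smul q z \<unlhd> t\<close> is the \<open>n\<close>-fold sum
  of the smaller of \<open>t/m\<close> and \<open>\<one>\<^sub>A/n\<close>. Both \<open>x\<close>
  and \<open>y\<close> lie below it, hence so does their join.\<close>

lemma smul_join_le:
  assumes q: "q \<ge> 0" "q \<le> 1" and xyt: "x \<in> carrier A" "y \<in> carrier A" "t \<in> carrier A"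
    and le: "smul q x \<unlhd> t" "smul q y \<unlhd> t"
  shows "smul q (join x y) \<unlhd> t"
proof (cases "q = 0")
  case True
  then show ?thesis using xyt by simp
next
  case False
  obtain m n where n: "n \<ge> 1" "m \<le> n" "q = rat_of_nat m / rat_of_nat n"
    using rat_le_1_fraction q by metis
  then have m: "m \<ge> 1" using False by (cases m) simp_all
  \<comment> \<open>The bound \<open>\<delta> n \<one>\<^sub>A\<close> keeps the
    \<open>n\<close>-fold sum exact, so that \<open>\<delta> n\<close> recovers \<open>?r\<close>
    from \<open>?w\<close>.\<close>
  let ?r = "meet (\<delta> m t) (\<delta> n \<one>\<^sub>A)"
  let ?w = "mv_nsum A n ?r"
  have r: "?r \<in> carrier A" using m n xyt by simp
  have "exact n ?r"
    using exact_mono[of ?r "\<delta> n \<one>\<^sub>A" n n] exact_delta n r meet_le m xyt by simp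
  then have rw: "\<delta> n ?w = ?r" using delta_unique n r by simp
  have bound: "z \<unlhd> ?w" if z: "z \<in> carrier A" "smul q z \<unlhd> t" for z
  proof -
    have "mv_nsum A m (\<delta> n z) \<unlhd> mv_nsum A m (\<delta> m t)" using z n m xyt by (simp add: smul_frac)
    then have "\<delta> n z \<unlhd> \<delta> m t"
      using nsum_le_cancel[of "\<delta> n z" "\<delta> m t" m] exact_delta exact_delta_le z n m xyt by simp
    moreover have "\<delta> n z \<unlhd> \<delta> n \<one>\<^sub>A" using delta_le_iff n z by simp
    ultimately have "\<delta> n z \<unlhd> \<delta> n ?w" unfolding rw using meet_greatest z n m xyt by simp
    then show ?thesis using delta_le_iff n z r by simp
  qed
  have "join x y \<unlhd> ?w" using join_least bound xyt le r by simp
  then have "\<delta> n (join x y) \<unlhd> ?r" using delta_le_iff[of n "join x y" ?w] rw n xyt r by simp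
  then have "\<delta> n (join x y) \<unlhd> \<delta> m t"
    using le_trans[of "\<delta> n (join x y)" ?r "\<delta> m t"] meet_le n m xyt r by simp
  then show ?thesis
    using nsum_mono[of "\<delta> n (join x y)" "\<delta> m t" m] n m xyt by (simp add: smul_frac)
qed

end

section \<open>The vector lattice of a DMV-algebra\<close>

context dmv_algebra
begin

lemma le_delta_unit:
  assumes "n \<ge> 1" "t \<in> carrier A" "t \<unlhd> \<delta> n \<one>\<^sub>A"
  shows "\<delta> n (mv_nsum A n t) = t"
  using exact_mono[of t "\<delta> n \<one>\<^sub>A" n n] exact_delta assms delta_unique by simp

subsection \<open>Evaluation of subconvex combinations\<close>

text \<open>The index set is explicit so that two combinations can be evaluated over a common
  support. The product of the additive monoid is the finite sum.\<close>

definition ev_on :: "'a set \<Rightarrow> ('a \<Rightarrow> rat) \<Rightarrow> 'a" where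
  "ev_on S \<alpha> = finprod (mv_monoid A) (\<lambda>x. smul (\<alpha> x) x) S"

lemma ev_on_empty [simp]: "ev_on {} \<alpha> = \<zero>\<^sub>A"
  using comm_monoid.finprod_empty[OF plus_comm_monoid] by (simp add: ev_on_def mv_monoid_def)

lemma ev_on_insert:
  assumes "finite S" "x \<notin> S" "insert x S \<subseteq> carrier A"
  shows "ev_on (insert x S) \<alpha> = smul (\<alpha> x) x \<boxplus> ev_on S \<alpha>"
proof -
  have "(\<lambda>x. smul (\<alpha> x) x) \<in> S \<rightarrow> carrier A" "smul (\<alpha> x) x \<in> carrier A" using assms by auto
  then show ?thesis
    using comm_monoid.finprod_insert[OF plus_comm_monoid, of S x "\<lambda>x. smul (\<alpha> x) x"] assms
    by (simp add: ev_on_def mv_monoid_def)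
qed

lemma ev_on_closed:
  assumes "finite S" "S \<subseteq> carrier A" shows "ev_on S \<alpha> \<in> carrier A"
  using assms by (induction S) (simp_all add: ev_on_insert)

lemma ev_on_mono_neutral:
  assumes "finite T" "T \<subseteq> carrier A" "S \<subseteq> T" "\<And>x. x \<in> T - S \<Longrightarrow> \<alpha> x = 0"
  shows "ev_on T \<alpha> = ev_on S \<alpha>"
proof -
  have S: "finite S" "S \<subseteq> carrier A" using assms finite_subset by auto
  have "ev_on (S \<union> U) \<alpha> = ev_on S \<alpha>"
    if "finite U" "U \<subseteq> carrier A" "S \<inter> U = {}" "\<And>x. x \<in> U \<Longrightarrow> \<alpha> x = 0" for U
    using that
  proof (induction U)
    case (insert x U)
    then have "ev_on (insert x (S \<union> U)) \<alpha> = smul (\<alpha> x) x \<boxplus> ev_on (S \<union> U) \<alpha>"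
      using S by (intro ev_on_insert) auto
    then show ?case using insert S by (simp add: ev_on_closed)
  qed simp
  from this[of "T - S"] assms show ?thesis
    by (metis Diff_disjoint Diff_partition finite_Diff Diff_subset subset_trans)
qed

text \<open>Each term is at most the same multiple of \<open>\<one>\<^sub>A\<close>, and these
  multiples add exactly. Bounding values by weights lets \<open>ev_on_orth\<close> read
  orthogonality off the weights alone.\<close>

lemma ev_on_le:
  assumes "finite S" "S \<subseteq> carrier A" "\<And>x. 0 \<le> \<alpha> x" "sum \<alpha> S \<le> 1"
  shows "ev_on S \<alpha> \<unlhd> smul (sum \<alpha> S) \<one>\<^sub>A"
  using assms
proof (induction S)
  case (insert x S)
  have nn: "0 \<le> sum \<alpha> S" "0 \<le> \<alpha> x" using insert by (simp_all add: sum_nonneg)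
  have sum: "\<alpha> x + sum \<alpha> S \<le> 1" using insert by simp
  have cl: "ev_on S \<alpha> \<in> carrier A" using insert ev_on_closed by simp
  have IH: "ev_on S \<alpha> \<unlhd> smul (sum \<alpha> S) \<one>\<^sub>A" using insert nn sum by simp
  have "smul (\<alpha> x) x \<unlhd> smul (\<alpha> x) \<one>\<^sub>A"
    using insert nn sum smul_le_iff[of "\<alpha> x" x "\<one>\<^sub>A"] by (cases "\<alpha> x = 0") (simp_all add: order_less_le)
  then have "smul (\<alpha> x) x \<boxplus> ev_on S \<alpha> \<unlhd> smul (\<alpha> x) \<one>\<^sub>A \<boxplus> smul (sum \<alpha> S) \<one>\<^sub>A"
    using insert cl IH by (intro plus_mono) simp_all
  then show ?case using insert nn sum by (simp add: ev_on_insert smul_add(1))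
qed simp

lemma ev_on_orth:
  assumes "finite S" "S \<subseteq> carrier A" "finite T" "T \<subseteq> carrier A"
    "\<And>x. 0 \<le> \<alpha> x" "\<And>x. 0 \<le> \<beta> x" "sum \<alpha> S + sum \<beta> T \<le> 1"
  shows "ev_on S \<alpha> \<bottom> ev_on T \<beta>"
proof -
  have nn: "sum \<alpha> S \<ge> 0" "sum \<beta> T \<ge> 0" using assms by (simp_all add: sum_nonneg)
  then have "ev_on S \<alpha> \<unlhd> smul (sum \<alpha> S) \<one>\<^sub>A" "ev_on T \<beta> \<unlhd> smul (sum \<beta> T) \<one>\<^sub>A"
    using assms by (intro ev_on_le; simp)+
  moreover have "smul (sum \<alpha> S) \<one>\<^sub>A \<bottom> smul (sum \<beta> T) \<one>\<^sub>A"
    using nn assms by (intro smul_add(2)) simp_all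
  ultimately show ?thesis
    using orth_mono[of "ev_on S \<alpha>" "ev_on T \<beta>" "smul (sum \<alpha> S) \<one>\<^sub>A" "smul (sum \<beta> T) \<one>\<^sub>A"]
      assms ev_on_closed by simp
qed

lemma ev_on_add:
  assumes "finite S" "S \<subseteq> carrier A"
    "\<And>x. 0 \<le> \<alpha> x" "\<And>x. 0 \<le> \<beta> x" "sum \<alpha> S + sum \<beta> S \<le> 1"
  shows "ev_on S (\<lambda>x. \<alpha> x + \<beta> x) = ev_on S \<alpha> \<boxplus> ev_on S \<beta>"
  using assms
proof (induction S)
  case (insert x S)
  have nn: "sum \<alpha> S \<ge> 0" "sum \<beta> S \<ge> 0" "\<alpha> x \<ge> 0" "\<beta> x \<ge> 0" using insert by (simp_all add: sum_nonneg)
  have "(\<alpha> x + sum \<alpha> S) + (\<beta> x + sum \<beta> S) \<le> 1" using insert by simp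
  then have le: "sum \<alpha> S + sum \<beta> S \<le> 1" "\<alpha> x + \<beta> x \<le> 1" using nn by linarith+
  have IH: "ev_on S (\<lambda>x. \<alpha> x + \<beta> x) = ev_on S \<alpha> \<boxplus> ev_on S \<beta>" using insert le by simp
  have "smul (\<alpha> x + \<beta> x) x = smul (\<alpha> x) x \<boxplus> smul (\<beta> x) x"
    using nn le insert smul_add(1) by simp
  then show ?case
    using insert IH by (simp add: ev_on_insert ev_on_closed plus_interchange)
qed simp

text \<open>\<open>smul_plus\<close> distributes only over exact sums; the weight bound supplies the
  needed orthogonality through \<open>ev_on_orth\<close>.\<close>

lemma ev_on_scale:
  assumes "finite S" "S \<subseteq> carrier A" "\<And>x. 0 \<le> \<alpha> x" "sum \<alpha> S \<le> 1" "0 \<le> q" "q \<le> 1"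
  shows "ev_on S (\<lambda>x. q * \<alpha> x) = smul q (ev_on S \<alpha>)"
  using assms
proof (induction S)
  case (insert x S)
  have nn: "sum \<alpha> S \<ge> 0" "\<alpha> x \<ge> 0" using insert by (simp_all add: sum_nonneg)
  have "\<alpha> x + sum \<alpha> S \<le> 1" using insert by simp
  then have le: "sum \<alpha> S \<le> 1" "\<alpha> x \<le> 1" using nn by linarith+
  have "smul (\<alpha> x) x \<bottom> ev_on S \<alpha>"
    using ev_on_orth[of "{x}" S \<alpha> \<alpha>] ev_on_insert[of "{}" x \<alpha>] insert by simp
  then have "smul q (smul (\<alpha> x) x \<boxplus> ev_on S \<alpha>) = smul q (smul (\<alpha> x) x) \<boxplus> smul q (ev_on S \<alpha>)"
    using insert ev_on_closed by (intro smul_plus) simp_all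
  then show ?case using insert nn le by (simp add: ev_on_insert smul_smul)
qed simp

definition supp :: "('a \<Rightarrow> rat) \<Rightarrow> 'a set" where "supp \<phi> = {x. \<phi> x \<noteq> 0}"

definition Fin :: "('a \<Rightarrow> rat) set" where
  "Fin = {\<phi>. finite (supp \<phi>) \<and> supp \<phi> \<subseteq> carrier A}"

definition weight :: "('a \<Rightarrow> rat) \<Rightarrow> rat" where "weight \<phi> = sum \<phi> (supp \<phi>)"

definition subconvex :: "('a \<Rightarrow> rat) \<Rightarrow> bool" where
  "subconvex \<alpha> \<longleftrightarrow> \<alpha> \<in> Fin \<and> (\<forall>x. 0 \<le> \<alpha> x) \<and> weight \<alpha> \<le> 1"

definition ev :: "('a \<Rightarrow> rat) \<Rightarrow> 'a" where "ev \<alpha> = ev_on (supp \<alpha>) \<alpha>"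

lemma Fin_add: "\<phi> \<in> Fin \<Longrightarrow> \<psi> \<in> Fin \<Longrightarrow> (\<lambda>x. \<phi> x + \<psi> x) \<in> Fin"
  unfolding Fin_def
  using finite_subset[of "supp (\<lambda>x. \<phi> x + \<psi> x)" "supp \<phi> \<union> supp \<psi>"]
  by (force simp: supp_def)

lemma Fin_scale: "\<phi> \<in> Fin \<Longrightarrow> (\<lambda>x. q * \<phi> x) \<in> Fin"
  unfolding Fin_def
  using finite_subset[of "supp (\<lambda>x. q * \<phi> x)" "supp \<phi>"] by (auto simp: supp_def)

lemma Fin_0: "(\<lambda>x. 0) \<in> Fin"
  by (simp add: Fin_def supp_def)

lemma Fin_diff: "\<phi> \<in> Fin \<Longrightarrow> \<psi> \<in> Fin \<Longrightarrow> (\<lambda>x. \<phi> x - \<psi> x) \<in> Fin"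
  using Fin_add[of \<phi> "\<lambda>x. (-1) * \<psi> x"] Fin_scale[of \<psi> "-1"] by simp

lemma weight_eq: "finite S \<Longrightarrow> supp \<phi> \<subseteq> S \<Longrightarrow> weight \<phi> = sum \<phi> S"
  unfolding weight_def by (rule sum.mono_neutral_left) (auto simp: supp_def)

lemma ev_eq: "finite S \<Longrightarrow> S \<subseteq> carrier A \<Longrightarrow> supp \<alpha> \<subseteq> S \<Longrightarrow> ev \<alpha> = ev_on S \<alpha>"
  unfolding ev_def by (rule ev_on_mono_neutral[symmetric]) (auto simp: supp_def)

lemma ev_closed [simp, intro]: "subconvex \<alpha> \<Longrightarrow> ev \<alpha> \<in> carrier A"
  by (simp add: ev_def subconvex_def Fin_def ev_on_closed)

text \<open>Evaluation respects subconvex mixtures, and \<open>s + t \<le> 1\<close> keeps the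
  result exact. Both combinations are extended to the union of their supports, where
  \<open>ev_on_add\<close> and \<open>ev_on_scale\<close> apply.\<close>

lemma ev_comb:
  assumes \<alpha>: "subconvex \<alpha>" and \<beta>: "subconvex \<beta>" and st: "s \<ge> 0" "t \<ge> 0" "s + t \<le> 1"
  shows "subconvex (\<lambda>x. s * \<alpha> x + t * \<beta> x)"
    and "ev (\<lambda>x. s * \<alpha> x + t * \<beta> x) = smul s (ev \<alpha>) \<boxplus> smul t (ev \<beta>)"
    and "smul s (ev \<alpha>) \<bottom> smul t (ev \<beta>)"
proof -
  let ?S = "supp \<alpha> \<union> supp \<beta>"
  have S: "finite ?S" "?S \<subseteq> carrier A" using \<alpha> \<beta> by (simp_all add: subconvex_def Fin_def)
  have nn: "\<And>x. 0 \<le> \<alpha> x" "\<And>x. 0 \<le> \<beta> x" using \<alpha> \<beta> by (simp_all add: subconvex_def)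
  have wt: "sum \<alpha> ?S \<le> 1" "sum \<beta> ?S \<le> 1"
    using \<alpha> \<beta> weight_eq[of ?S \<alpha>] weight_eq[of ?S \<beta>] S by (simp_all add: subconvex_def)
  have supp: "supp (\<lambda>x. s * \<alpha> x + t * \<beta> x) \<subseteq> ?S" by (auto simp: supp_def)
  have sum: "sum (\<lambda>x. s * \<alpha> x) ?S + sum (\<lambda>x. t * \<beta> x) ?S \<le> 1"
  proof -
    have "s * sum \<alpha> ?S + t * sum \<beta> ?S \<le> s * 1 + t * 1"
      using st wt by (intro add_mono mult_left_mono) simp_all
    then show ?thesis using st by (simp add: sum_distrib_left)
  qed
  have "(\<lambda>x. s * \<alpha> x + t * \<beta> x) \<in> Fin"
    using \<alpha> \<beta> by (intro Fin_add Fin_scale) (simp_all add: subconvex_def)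
  moreover have "weight (\<lambda>x. s * \<alpha> x + t * \<beta> x) \<le> 1"
    using weight_eq[OF S(1) supp] sum by (simp add: sum.distrib)
  ultimately show "subconvex (\<lambda>x. s * \<alpha> x + t * \<beta> x)"
    using st nn by (simp add: subconvex_def)
  have ev: "ev \<alpha> = ev_on ?S \<alpha>" "ev \<beta> = ev_on ?S \<beta>" using ev_eq[of ?S] S by simp_all
  have sc: "ev_on ?S (\<lambda>x. s * \<alpha> x) = smul s (ev \<alpha>)" "ev_on ?S (\<lambda>x. t * \<beta> x) = smul t (ev \<beta>)"
    unfolding ev using S nn wt st by (intro ev_on_scale; simp)+
  show "ev (\<lambda>x. s * \<alpha> x + t * \<beta> x) = smul s (ev \<alpha>) \<boxplus> smul t (ev \<beta>)"
    using ev_eq[OF S supp] ev_on_add[OF S, of "\<lambda>x. s * \<alpha> x" "\<lambda>x. t * \<beta> x"] nn st sum sc by simp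
  show "smul s (ev \<alpha>) \<bottom> smul t (ev \<beta>)"
    unfolding sc[symmetric] using S nn st sum by (intro ev_on_orth) simp_all
qed

definition single :: "'a \<Rightarrow> 'a \<Rightarrow> rat" where "single a = (\<lambda>x. if x = a then 1 else 0)"

lemma supp_single: "supp (single a) = {a}"
  by (auto simp: supp_def single_def)

lemma subconvex_single [simp]: "a \<in> carrier A \<Longrightarrow> subconvex (single a)"
  by (simp add: subconvex_def Fin_def weight_def supp_single) (simp add: single_def)

lemma single_Fin [simp]: "a \<in> carrier A \<Longrightarrow> single a \<in> Fin"
  by (simp add: Fin_def supp_single)

lemma ev_single [simp]: "a \<in> carrier A \<Longrightarrow> ev (single a) = a"
  using ev_on_insert[of "{}" a "single a"] by (simp add: ev_def supp_single) (simp add: single_def)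

lemma subconvex_0 [simp]: "subconvex (\<lambda>x. 0)"
  by (simp add: subconvex_def Fin_0 weight_def)

lemma ev_0 [simp]: "ev (\<lambda>x. 0) = \<zero>\<^sub>A"
  by (simp add: ev_def supp_def)

subsection \<open>The positive cone\<close>

definition pos :: "('a \<Rightarrow> rat) \<Rightarrow> bool" where
  "pos \<phi> \<longleftrightarrow> (\<exists>N>0. \<exists>\<alpha> \<beta>. subconvex \<alpha> \<and> subconvex \<beta> \<and> (\<forall>x. \<phi> x = N * (\<alpha> x - \<beta> x)) \<and> ev \<beta> \<unlhd> ev \<alpha>)"

lemma posI:
  "\<lbrakk>N > 0; subconvex \<alpha>; subconvex \<beta>; \<And>x. \<phi> x = N * (\<alpha> x - \<beta> x); ev \<beta> \<unlhd> ev \<alpha>\<rbrakk> \<Longrightarrow> pos \<phi>"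
  unfolding pos_def by blast

text \<open>Independence of the representation: clear denominators and cancel in \<open>A\<close>.\<close>

lemma posD:
  assumes "pos \<phi>" and M: "M > 0" and c: "subconvex \<alpha>'" "subconvex \<beta>'" "\<And>x. \<phi> x = M * (\<alpha>' x - \<beta>' x)"
  shows "ev \<beta>' \<unlhd> ev \<alpha>'"
proof -
  obtain N \<alpha> \<beta> where N: "N > 0" "subconvex \<alpha>" "subconvex \<beta>" "\<And>x. \<phi> x = N * (\<alpha> x - \<beta> x)" "ev \<beta> \<unlhd> ev \<alpha>"
    using assms(1) unfolding pos_def by blast
  define s t where "s = N / (N + M)" and "t = M / (N + M)"
  have st: "s > 0" "t > 0" "s + t = 1"
    using N(1) M by (simp_all add: s_def t_def add_divide_distrib[symmetric])
  have eq: "(\<lambda>x. s * \<alpha> x + t * \<beta>' x) = (\<lambda>x. s * \<beta> x + t * \<alpha>' x)"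
  proof
    fix x
    have "N * \<alpha> x + M * \<beta>' x = N * \<beta> x + M * \<alpha>' x"
      using N(4)[of x] c(3)[of x] by (simp add: algebra_simps)
    then show "s * \<alpha> x + t * \<beta>' x = s * \<beta> x + t * \<alpha>' x"
      by (simp add: s_def t_def add_divide_distrib[symmetric])
  qed
  have "smul t (ev \<beta>') \<unlhd> smul t (ev \<alpha>')"
  proof (rule plus_eq_imp_le[of "smul s (ev \<alpha>)" _ "smul s (ev \<beta>)"])
    show "smul s (ev \<alpha>) \<bottom> smul t (ev \<beta>')" "smul s (ev \<beta>) \<bottom> smul t (ev \<alpha>')"
      using st N c by (intro ev_comb(3); simp)+
    show "smul s (ev \<alpha>) \<boxplus> smul t (ev \<beta>') = smul s (ev \<beta>) \<boxplus> smul t (ev \<alpha>')"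
      using ev_comb(2)[of \<alpha> \<beta>' s t] ev_comb(2)[of \<beta> \<alpha>' s t] eq N c st by simp
    show "smul s (ev \<beta>) \<unlhd> smul s (ev \<alpha>)" using smul_le_iff N st by simp
  qed (use N c in simp_all)
  then show ?thesis using smul_le_iff st c by simp
qed

lemma pos_iff:
  "\<lbrakk>M > 0; subconvex \<alpha>; subconvex \<beta>; \<And>x. \<phi> x = M * (\<alpha> x - \<beta> x)\<rbrakk> \<Longrightarrow> pos \<phi> \<longleftrightarrow> ev \<beta> \<unlhd> ev \<alpha>"
  using posI posD by blast

text \<open>The factors \<open>N\<close> and \<open>M\<close> merge into \<open>N + M\<close>; the
  weights \<open>s\<close> and \<open>t\<close> keep both mixed combinations subconvex, and the
  inequality of values is preserved by scaling and adding.\<close>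

lemma pos_add:
  assumes "pos \<phi>" "pos \<psi>" "\<And>x. \<chi> x = \<phi> x + \<psi> x"
  shows "pos \<chi>"
proof -
  obtain N \<alpha> \<beta> where N: "N > 0" "subconvex \<alpha>" "subconvex \<beta>" "\<And>x. \<phi> x = N * (\<alpha> x - \<beta> x)" "ev \<beta> \<unlhd> ev \<alpha>"
    using assms(1) unfolding pos_def by blast
  obtain M \<alpha>' \<beta>' where M: "M > 0" "subconvex \<alpha>'" "subconvex \<beta>'" "\<And>x. \<psi> x = M * (\<alpha>' x - \<beta>' x)" "ev \<beta>' \<unlhd> ev \<alpha>'"
    using assms(2) unfolding pos_def by blast
  define s t where "s = N / (N + M)" and "t = M / (N + M)"
  have st: "s > 0" "t > 0" "s + t = 1"
    using N(1) M(1) by (simp_all add: s_def t_def add_divide_distrib[symmetric])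
  have NM: "N = (N + M) * s" "M = (N + M) * t" using N(1) M(1) by (simp_all add: s_def t_def)
  show ?thesis
  proof (rule posI[of "N + M" "\<lambda>x. s * \<alpha> x + t * \<alpha>' x" "\<lambda>x. s * \<beta> x + t * \<beta>' x"])
    fix x
    have "\<chi> x = N * (\<alpha> x - \<beta> x) + M * (\<alpha>' x - \<beta>' x)" using assms N M by simp
    also have "\<dots> = ((N + M) * s) * (\<alpha> x - \<beta> x) + ((N + M) * t) * (\<alpha>' x - \<beta>' x)" using NM by simp
    finally show "\<chi> x = (N + M) * (s * \<alpha> x + t * \<alpha>' x - (s * \<beta> x + t * \<beta>' x))"
      by (simp add: algebra_simps)
  next
    show "ev (\<lambda>x. s * \<beta> x + t * \<beta>' x) \<unlhd> ev (\<lambda>x. s * \<alpha> x + t * \<alpha>' x)"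
      using N M st ev_comb(2) smul_le_iff by (simp add: plus_mono)
  qed (use N M st ev_comb(1) in simp_all)
qed

lemma pos_scale:
  assumes "pos \<phi>" "q \<ge> 0" "\<And>x. \<psi> x = q * \<phi> x"
  shows "pos \<psi>"
proof (cases "q = 0")
  case True
  show ?thesis by (rule posI[of 1 "\<lambda>x. 0" "\<lambda>x. 0"]) (use assms True in simp_all)
next
  case False
  obtain N \<alpha> \<beta> where N: "N > 0" "subconvex \<alpha>" "subconvex \<beta>" "\<And>x. \<phi> x = N * (\<alpha> x - \<beta> x)" "ev \<beta> \<unlhd> ev \<alpha>"
    using assms(1) unfolding pos_def by blast
  then show ?thesis using assms False by (intro posI[of "q * N" \<alpha> \<beta>]) simp_all
qed

definition eqv :: "('a \<Rightarrow> rat) \<Rightarrow> ('a \<Rightarrow> rat) \<Rightarrow> bool" where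
  "eqv \<phi> \<psi> \<longleftrightarrow> pos (\<lambda>x. \<phi> x - \<psi> x) \<and> pos (\<lambda>x. \<psi> x - \<phi> x)"

lemma pos_0: "(\<And>x. \<phi> x = 0) \<Longrightarrow> pos \<phi>"
  by (rule posI[of 1 "\<lambda>x. 0" "\<lambda>x. 0"]) simp_all

lemma eqv_refl [simp]: "eqv \<phi> \<phi>"
  by (simp add: eqv_def pos_0)

lemma eqv_sym: "eqv \<phi> \<psi> \<Longrightarrow> eqv \<psi> \<phi>"
  by (simp add: eqv_def)

lemma eqv_trans: "eqv \<phi> \<psi> \<Longrightarrow> eqv \<psi> \<chi> \<Longrightarrow> eqv \<phi> \<chi>"
  unfolding eqv_def
  by (auto elim: pos_add[of "\<lambda>x. \<phi> x - \<psi> x" "\<lambda>x. \<psi> x - \<chi> x"]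
      pos_add[of "\<lambda>x. \<psi> x - \<phi> x" "\<lambda>x. \<chi> x - \<psi> x"])

lemma eqv_add: "eqv \<phi> \<phi>' \<Longrightarrow> eqv \<psi> \<psi>' \<Longrightarrow> eqv (\<lambda>x. \<phi> x + \<psi> x) (\<lambda>x. \<phi>' x + \<psi>' x)"
  unfolding eqv_def
  by (auto elim: pos_add[of "\<lambda>x. \<phi> x - \<phi>' x" "\<lambda>x. \<psi> x - \<psi>' x"]
      pos_add[of "\<lambda>x. \<phi>' x - \<phi> x" "\<lambda>x. \<psi>' x - \<psi> x"])

lemma eqv_scale: 
  assumes "eqv \<phi> \<psi>" shows "eqv (\<lambda>x. q * \<phi> x) (\<lambda>x. q * \<psi> x)"
proof (cases "q \<ge> 0")
  case True
  show ?thesis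
    unfolding eqv_def
    using pos_scale[of "\<lambda>x. \<phi> x - \<psi> x" q "\<lambda>x. q * \<phi> x - q * \<psi> x"]
      pos_scale[of "\<lambda>x. \<psi> x - \<phi> x" q "\<lambda>x. q * \<psi> x - q * \<phi> x"] True assms
    by (simp add: eqv_def right_diff_distrib)
next
  case False
  then have "- q \<ge> 0" by simp
  then show ?thesis
    unfolding eqv_def
    using pos_scale[of "\<lambda>x. \<phi> x - \<psi> x" "- q" "\<lambda>x. q * \<psi> x - q * \<phi> x"]
      pos_scale[of "\<lambda>x. \<psi> x - \<phi> x" "- q" "\<lambda>x. q * \<phi> x - q * \<psi> x"] assms
    by (simp add: eqv_def right_diff_distrib)
qed

text \<open>\<open>pos_iff\<close> with factor 1 turns the two inequalities into comparisons of
  values. In particular a subconvex combination is equivalent to the single generator given by its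
  value.\<close>

lemma eqv_subconvex:
  "\<lbrakk>subconvex \<alpha>; subconvex \<beta>\<rbrakk> \<Longrightarrow> eqv \<alpha> \<beta> \<longleftrightarrow> ev \<alpha> = ev \<beta>"
  unfolding eqv_def using pos_iff[of 1 \<alpha> \<beta> "\<lambda>x. \<alpha> x - \<beta> x"] pos_iff[of 1 \<beta> \<alpha> "\<lambda>x. \<beta> x - \<alpha> x"]
    le_antisym[of "ev \<alpha>" "ev \<beta>"] by auto

text \<open>A common subtrahend is available for several \<open>\<phi>\<close> because all of them can be shifted by the
  same \<open>\<gamma> = \<Sum> \<bar>\<phi>\<bar>\<close>.\<close>

lemma common_form:
  assumes "finite I" "\<And>i. i \<in> I \<Longrightarrow> \<phi> i \<in> Fin"
  shows "\<exists>(N :: nat) b a. N > 0 \<and> b \<in> carrier A \<and> (\<forall>i \<in> I. a i \<in> carrier A \<and>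
    eqv (\<phi> i) (\<lambda>x. of_nat N * (single (a i) x - single b x)))"
proof -
  define \<gamma> where "\<gamma> = (\<lambda>x. \<Sum>i\<in>I. \<bar>\<phi> i x\<bar>)"
  define S where "S = (\<Union>i\<in>I. supp (\<phi> i))"
  have S: "finite S" "S \<subseteq> carrier A" using assms by (auto simp: S_def Fin_def)
  have \<gamma>0: "\<gamma> x \<ge> 0" for x by (simp add: \<gamma>_def sum_nonneg)
  have supp: "supp \<gamma> \<subseteq> S" "\<And>i. i \<in> I \<Longrightarrow> supp (\<phi> i) \<subseteq> S"
  proof -
    show "supp \<gamma> \<subseteq> S"
    proof
      fix x assume "x \<in> supp \<gamma>"
      then obtain i where "i \<in> I" "\<phi> i x \<noteq> 0"
        unfolding supp_def \<gamma>_def by (metis (mono_tags, lifting) abs_zero mem_Collect_eq sum.neutral)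
      then show "x \<in> S" by (auto simp: S_def supp_def)
    qed
  qed (auto simp: S_def)
  have le: "\<bar>\<phi> i x\<bar> \<le> \<gamma> x" if "i \<in> I" for i x
    unfolding \<gamma>_def using assms(1) that by (intro member_le_sum) simp_all
  \<comment> \<open>After the shift, \<open>\<phi> i + \<gamma>\<close> is at most
    \<open>2 * \<gamma>\<close>; dividing by this \<open>N\<close> brings the total weight below
    1.\<close>
  obtain N :: nat where N: "rat_of_nat N > 2 * sum \<gamma> S"
    using reals_Archimedean2 by blast
  have N0: "N > 0"
  proof (rule ccontr)
    assume "\<not> N > 0"
    then have "N = 0" by simp
    then show False using N sum_nonneg[of S \<gamma>] \<gamma>0 by simp
  qed
  have sub: "subconvex (\<lambda>x. (1 / of_nat N) * \<psi> x)"
    if \<psi>: "supp \<psi> \<subseteq> S" "\<And>x. 0 \<le> \<psi> x" "\<And>x. \<psi> x \<le> 2 * \<gamma> x" for \<psi>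
  proof -
    have "sum \<psi> S \<le> 2 * sum \<gamma> S" using \<psi> by (simp add: sum_distrib_left sum_mono)
    then have "(1 / of_nat N) * sum \<psi> S \<le> 1" using N N0 by (simp add: divide_le_eq)
    moreover have "supp (\<lambda>x. (1 / of_nat N) * \<psi> x) \<subseteq> S" using \<psi>(1) by (auto simp: supp_def)
    then have "weight (\<lambda>x. (1 / of_nat N) * \<psi> x) = (1 / of_nat N) * sum \<psi> S"
      using weight_eq S(1) by (metis sum_distrib_left)
    moreover have "\<psi> \<in> Fin" using \<psi> S finite_subset by (auto simp: Fin_def)
    moreover have "(\<lambda>x. (1 / of_nat N) * \<psi> x) \<in> Fin" using \<open>\<psi> \<in> Fin\<close> by (rule Fin_scale)
    ultimately show ?thesis using \<psi> by (simp add: subconvex_def)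
  qed
  define \<alpha> where "\<alpha> i = (\<lambda>x. (1 / of_nat N) * (\<phi> i x + \<gamma> x))" for i
  define \<beta> where "\<beta> = (\<lambda>x. (1 / of_nat N) * \<gamma> x)"
  have \<beta>: "subconvex \<beta>" unfolding \<beta>_def using supp \<gamma>0 by (intro sub) simp_all
  have \<alpha>: "subconvex (\<alpha> i)" if "i \<in> I" for i
    unfolding \<alpha>_def
  proof (rule sub)
    show "supp (\<lambda>x. \<phi> i x + \<gamma> x) \<subseteq> S" using supp(1) supp(2)[OF that] by (force simp: supp_def)
    show "0 \<le> \<phi> i x + \<gamma> x" "\<phi> i x + \<gamma> x \<le> 2 * \<gamma> x" for x using le[OF that, of x] by linarith+
  qed
  have eqv: "eqv (\<phi> i) (\<lambda>x. of_nat N * (single (ev (\<alpha> i)) x - single (ev \<beta>) x))" if "i \<in> I" for i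
  proof -
    have \<phi>: "\<phi> i = (\<lambda>x. of_nat N * (\<alpha> i x + (-1) * \<beta> x))"
      using N0 by (simp add: \<alpha>_def \<beta>_def fun_eq_iff field_simps)
    \<comment> \<open>Each combination is replaced by the generator of its value, so that only
      elements of \<open>A\<close> remain in the normal form.\<close>
    have "eqv (\<alpha> i) (single (ev (\<alpha> i)))" "eqv \<beta> (single (ev \<beta>))"
      using \<alpha>[OF that] \<beta> by (simp_all add: eqv_subconvex)
    then have "eqv (\<phi> i) (\<lambda>x. of_nat N * (single (ev (\<alpha> i)) x + (-1) * single (ev \<beta>) x))"
      unfolding \<phi> by (intro eqv_scale eqv_add)
    then show ?thesis by simp
  qed
  show ?thesis
    using N0 eqv \<alpha> \<beta> by (intro exI[of _ N] exI[of _ "ev \<beta>"] exI[of _ "\<lambda>i. ev (\<alpha> i)"]) auto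
qed

end

section \<open>Rational vector lattices\<close>

lemma rat_ring_simps [simp]:
  "carrier rat_ring = UNIV" "a \<otimes>\<^bsub>rat_ring\<^esub> b = a * b" "\<one>\<^bsub>rat_ring\<^esub> = 1"
  "\<zero>\<^bsub>rat_ring\<^esub> = 0" "a \<oplus>\<^bsub>rat_ring\<^esub> b = a + b"
  by (simp_all add: rat_ring_def)

lemma cring_rat_ring: "cring rat_ring"
proof (rule cringI)
  show "abelian_group rat_ring"
    by (rule abelian_groupI) (auto simp: algebra_simps intro: exI[of _ "- _"])
  show "comm_monoid rat_ring"
    by (rule comm_monoidI) (simp_all add: algebra_simps)
qed (simp add: algebra_simps)

lemma rat_ring_uminus [simp]: "\<ominus>\<^bsub>rat_ring\<^esub> a = - a"
proof -
  interpret cring rat_ring by (rule cring_rat_ring)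
  show ?thesis using minus_equality[of "- a" a] by simp
qed

context q_vector_lattice
begin

sublocale module rat_ring V by (rule linear_space)

lemma smult_closed' [simp, intro]: "x \<in> carrier V \<Longrightarrow> q \<odot> x \<in> carrier V"
  by simp

lemma smult_plus: "x \<in> carrier V \<Longrightarrow> (p + q) \<odot> x = p \<odot> x \<oplus> q \<odot> x"
  using smult_l_distr[of p q x] by simp

lemma smult_smult: "x \<in> carrier V \<Longrightarrow> p \<odot> (q \<odot> x) = (p * q) \<odot> x"
  using smult_assoc1[of p q x] by simp

lemma smult_1 [simp]: "x \<in> carrier V \<Longrightarrow> 1 \<odot> x = x"
  using smult_one[of x] by simp

lemma smult_0 [simp]: "x \<in> carrier V \<Longrightarrow> 0 \<odot> x = \<zero>"
  using smult_l_null[of x] by simp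

lemma smult_zero [simp]: "q \<odot> \<zero> = \<zero>"
  using smult_r_null[of q] by simp

lemma smult_add: "x \<in> carrier V \<Longrightarrow> y \<in> carrier V \<Longrightarrow> q \<odot> (x \<oplus> y) = q \<odot> x \<oplus> q \<odot> y"
  using smult_r_distr[of q x y] by simp

lemma uminus_smult: "x \<in> carrier V \<Longrightarrow> \<ominus> x = (- 1) \<odot> x"
  using smult_l_minus[of 1 x] by simp

lemma minus_zero [simp]: "x \<in> carrier V \<Longrightarrow> x \<ominus> \<zero> = x"
  by (simp add: a_minus_def uminus_smult)

text \<open>Rewriting with a parametrization reduces linear identities in \<open>V\<close> to rational arithmetic on
  coefficients.\<close>

definition parametrization ::
  "(rat \<Rightarrow> rat \<Rightarrow> rat \<Rightarrow> rat \<Rightarrow> 'a) \<Rightarrow> 'a \<Rightarrow> 'a \<Rightarrow> 'a \<Rightarrow> 'a \<Rightarrow> bool" where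
  "parametrization L x y z w \<longleftrightarrow>
    x = L 1 0 0 0 \<and> y = L 0 1 0 0 \<and> z = L 0 0 1 0 \<and> w = L 0 0 0 1 \<and> \<zero> = L 0 0 0 0 \<and>
    (\<forall>a b c d. L a b c d \<in> carrier V) \<and>
    (\<forall>a b c d a' b' c' d'. L a b c d \<oplus> L a' b' c' d' = L (a + a') (b + b') (c + c') (d + d')) \<and>
    (\<forall>a b c d a' b' c' d'. L a b c d \<ominus> L a' b' c' d' = L (a - a') (b - b') (c - c') (d - d')) \<and>
    (\<forall>q a b c d. q \<odot> L a b c d = L (q * a) (q * b) (q * c) (q * d)) \<and>
    (\<forall>a b c d. \<ominus> L a b c d = L (- a) (- b) (- c) (- d))"

text \<open>\<open>L a b c d\<close> is the combination with coefficients \<open>a\<close>,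
  \<open>b\<close>, \<open>c\<close>, \<open>d\<close>. For identities in fewer vectors one of the
  vectors is repeated.\<close>

lemma ex_parametrization:
  assumes "x \<in> carrier V" "y \<in> carrier V" "z \<in> carrier V" "w \<in> carrier V"
  obtains L where "parametrization L x y z w"
proof -
  define L where "L a b c d = a \<odot> x \<oplus> (b \<odot> y \<oplus> (c \<odot> z \<oplus> d \<odot> w))" for a b c d
  have cl: "L a b c d \<in> carrier V" for a b c d using assms by (simp add: L_def)
  have add: "L a b c d \<oplus> L a' b' c' d' = L (a + a') (b + b') (c + c') (d + d')" for a b c d a' b' c' d'
    using assms by (simp add: L_def smult_plus M.a_ac)
  have sc: "q \<odot> L a b c d = L (q * a) (q * b) (q * c) (q * d)" for q a b c d
    using assms by (simp add: L_def smult_add smult_smult)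
  have neg: "\<ominus> L a b c d = L (- a) (- b) (- c) (- d)" for a b c d
    using cl by (simp add: uminus_smult sc)
  have "L a b c d \<ominus> L a' b' c' d' = L (a - a') (b - b') (c - c') (d - d')" for a b c d a' b' c' d'
    by (simp add: a_minus_def neg add)
  moreover have "x = L 1 0 0 0" "y = L 0 1 0 0" "z = L 0 0 1 0" "w = L 0 0 0 1" "\<zero> = L 0 0 0 0"
    using assms by (simp_all add: L_def)
  ultimately show ?thesis using that[of L] cl add sc neg unfolding parametrization_def by blast
qed

subsection \<open>Order\<close>

lemma vorder_simps [simp]: "carrier (vorder V) = carrier V" "le (vorder V) = vle V" "eq (vorder V) = (=)"
  by (simp_all add: vorder_def)

sublocale order: lattice "vorder V"
  by (rule lattice_order)

lemma vle_refl [simp]: "x \<in> carrier V \<Longrightarrow> x \<preceq> x"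
  using order.le_refl[of x] by simp

lemma vle_antisym: "\<lbrakk>x \<preceq> y; y \<preceq> x; x \<in> carrier V; y \<in> carrier V\<rbrakk> \<Longrightarrow> x = y"
  using order.le_antisym[of x y] by simp

lemma vle_trans: "\<lbrakk>x \<preceq> y; y \<preceq> z; x \<in> carrier V; y \<in> carrier V; z \<in> carrier V\<rbrakk> \<Longrightarrow> x \<preceq> z"
  using order.le_trans[of x y z] by simp

lemma vle_iff_diff: 
  assumes "x \<in> carrier V" "y \<in> carrier V" shows "x \<preceq> y \<longleftrightarrow> \<zero> \<preceq> y \<ominus> x"
proof -
  obtain L where L: "parametrization L x y y y" using ex_parametrization assms by metis
  have "x \<oplus> \<ominus> x = \<zero>" "y \<oplus> \<ominus> x = y \<ominus> x" "\<zero> \<oplus> x = x" "(y \<ominus> x) \<oplus> x = y"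
    by (simp_all add: L[unfolded parametrization_def])
  then show ?thesis
    using add_mono[of x y "\<ominus> x"] add_mono[of \<zero> "y \<ominus> x" x] assms by auto
qed

text \<open>With \<open>vle_linear\<close> and \<open>vle_linear2\<close> this acts as linear
  arithmetic in \<open>V\<close>: the certificate is an identity between differences of sides, which
  a parametrization verifies.\<close>

lemma eq_linear:
  assumes "p = q" "a \<ominus> b = c \<odot> (p \<ominus> q)" "a \<in> carrier V" "b \<in> carrier V" "p \<in> carrier V"
  shows "a = b"
proof -
  have "a \<ominus> b = \<zero>" using assms by (simp add: M.minus_eq M.r_neg)
  moreover obtain L where L: "parametrization L a b b b" using ex_parametrization assms by metis
  have "a = (a \<ominus> b) \<oplus> b" by (simp add: L[unfolded parametrization_def])
  ultimately show ?thesis using assms(4) by simp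
qed

lemma vle_linear:
  assumes "a \<preceq> b" "b \<ominus> a = d \<ominus> c" "a \<in> carrier V" "b \<in> carrier V" "c \<in> carrier V" "d \<in> carrier V"
  shows "c \<preceq> d"
  using assms vle_iff_diff by metis

lemma nonneg_add: "\<lbrakk>\<zero> \<preceq> x; \<zero> \<preceq> y; x \<in> carrier V; y \<in> carrier V\<rbrakk> \<Longrightarrow> \<zero> \<preceq> x \<oplus> y"
  using add_mono[of \<zero> x y] vle_trans[of \<zero> y "x \<oplus> y"] by simp

lemma vle_linear2:
  assumes "a \<preceq> b" "a' \<preceq> b'" "(b \<ominus> a) \<oplus> (b' \<ominus> a') = d \<ominus> c"
    "a \<in> carrier V" "b \<in> carrier V" "a' \<in> carrier V" "b' \<in> carrier V" "c \<in> carrier V" "d \<in> carrier V"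
  shows "c \<preceq> d"
  using assms vle_iff_diff[of a b] vle_iff_diff[of a' b'] vle_iff_diff[of c d]
    nonneg_add[of "b \<ominus> a" "b' \<ominus> a'"] by simp

lemma vle_add_iff:
  assumes "x \<in> carrier V" "y \<in> carrier V" "z \<in> carrier V"
  shows "x \<oplus> z \<preceq> y \<oplus> z \<longleftrightarrow> x \<preceq> y"
proof -
  obtain L where L: "parametrization L x y z z" using ex_parametrization assms by metis
  have "(y \<oplus> z) \<ominus> (x \<oplus> z) = y \<ominus> x" by (simp add: L[unfolded parametrization_def])
  then show ?thesis using assms vle_iff_diff[of x y] vle_iff_diff[of "x \<oplus> z" "y \<oplus> z"] by simp
qed

lemma vle_add_mono:
  "\<lbrakk>a \<preceq> b; c \<preceq> d; a \<in> carrier V; b \<in> carrier V; c \<in> carrier V; d \<in> carrier V\<rbrakk> \<Longrightarrow> a \<oplus> c \<preceq> b \<oplus> d"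
  using add_mono[of a b c] add_mono[of c d b] M.a_comm vle_trans[of "a \<oplus> c" "b \<oplus> c" "b \<oplus> d"] by simp

lemma smult_mono:
  assumes "x \<preceq> y" "q \<ge> 0" "x \<in> carrier V" "y \<in> carrier V" shows "q \<odot> x \<preceq> q \<odot> y"
proof -
  obtain L where L: "parametrization L x y y y" using ex_parametrization assms by metis
  have "q \<odot> (y \<ominus> x) = q \<odot> y \<ominus> q \<odot> x" by (simp add: L[unfolded parametrization_def] algebra_simps)
  then show ?thesis using assms vle_iff_diff[of x y] vle_iff_diff[of "q \<odot> x" "q \<odot> y"]
      smult_nonneg[of "y \<ominus> x" q] by simp
qed

lemma smult_le_iff:
  assumes "q > 0" "x \<in> carrier V" "y \<in> carrier V" shows "q \<odot> x \<preceq> q \<odot> y \<longleftrightarrow> x \<preceq> y"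
  using smult_mono[of x y q] smult_mono[of "q \<odot> x" "q \<odot> y" "1 / q"] assms
  by (auto simp: smult_smult)

subsection \<open>Joins and meets\<close>

lemma vjoin_closed [simp, intro]: "\<lbrakk>x \<in> carrier V; y \<in> carrier V\<rbrakk> \<Longrightarrow> vjoin V x y \<in> carrier V"
  using order.join_closed[of x y] by (simp add: vjoin_def)

lemma vmeet_closed [simp, intro]: "\<lbrakk>x \<in> carrier V; y \<in> carrier V\<rbrakk> \<Longrightarrow> vmeet V x y \<in> carrier V"
  using order.meet_closed[of x y] by (simp add: vmeet_def)

lemma vjoin_ge: "\<lbrakk>x \<in> carrier V; y \<in> carrier V\<rbrakk> \<Longrightarrow> x \<preceq> vjoin V x y"
  "\<lbrakk>x \<in> carrier V; y \<in> carrier V\<rbrakk> \<Longrightarrow> y \<preceq> vjoin V x y"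
  using order.join_left[of x y] order.join_right[of x y] by (simp_all add: vjoin_def)

lemma vmeet_le: "\<lbrakk>x \<in> carrier V; y \<in> carrier V\<rbrakk> \<Longrightarrow> vmeet V x y \<preceq> x"
  "\<lbrakk>x \<in> carrier V; y \<in> carrier V\<rbrakk> \<Longrightarrow> vmeet V x y \<preceq> y"
  using order.meet_left[of x y] order.meet_right[of x y] by (simp_all add: vmeet_def)

lemma vjoin_least: "\<lbrakk>x \<preceq> z; y \<preceq> z; x \<in> carrier V; y \<in> carrier V; z \<in> carrier V\<rbrakk> \<Longrightarrow> vjoin V x y \<preceq> z"
  using order.join_le[of x z y] by (simp add: vjoin_def)

lemma vmeet_greatest: "\<lbrakk>z \<preceq> x; z \<preceq> y; x \<in> carrier V; y \<in> carrier V; z \<in> carrier V\<rbrakk> \<Longrightarrow> z \<preceq> vmeet V x y"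
  using order.meet_le[of z x y] by (simp add: vmeet_def)

lemma vmeet_eqI:
  assumes "x \<in> carrier V" "y \<in> carrier V" "z \<in> carrier V" "z \<preceq> x" "z \<preceq> y"
    "\<And>w. \<lbrakk>w \<in> carrier V; w \<preceq> x; w \<preceq> y\<rbrakk> \<Longrightarrow> w \<preceq> z"
  shows "vmeet V x y = z"
  using assms vmeet_le vmeet_greatest by (intro vle_antisym) auto

lemma vjoin_eqI:
  assumes "x \<in> carrier V" "y \<in> carrier V" "z \<in> carrier V" "x \<preceq> z" "y \<preceq> z"
    "\<And>w. \<lbrakk>w \<in> carrier V; x \<preceq> w; y \<preceq> w\<rbrakk> \<Longrightarrow> z \<preceq> w"
  shows "vjoin V x y = z"
  using assms vjoin_ge vjoin_least by (intro vle_antisym) auto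

lemma vjoin_commute: "\<lbrakk>x \<in> carrier V; y \<in> carrier V\<rbrakk> \<Longrightarrow> vjoin V x y = vjoin V y x"
  by (rule vjoin_eqI) (auto simp: vjoin_ge intro: vjoin_least)

lemma vmeet_left: "\<lbrakk>x \<preceq> y; x \<in> carrier V; y \<in> carrier V\<rbrakk> \<Longrightarrow> vmeet V x y = x"
  by (rule vmeet_eqI) auto

lemma vmeet_right: "\<lbrakk>y \<preceq> x; x \<in> carrier V; y \<in> carrier V\<rbrakk> \<Longrightarrow> vmeet V x y = y"
  by (rule vmeet_eqI) auto

text \<open>Translation by \<open>z\<close> is an order automorphism with inverse translation by the
  negative of \<open>z\<close>; \<open>vjoin_smult\<close> uses positive scaling in the same
  way.\<close>

lemma vjoin_add:
  assumes "x \<in> carrier V" "y \<in> carrier V" "z \<in> carrier V"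
  shows "vjoin V (x \<oplus> z) (y \<oplus> z) = vjoin V x y \<oplus> z"
proof (rule vjoin_eqI)
  fix w assume w: "w \<in> carrier V" "x \<oplus> z \<preceq> w" "y \<oplus> z \<preceq> w"
  have w': "w = (w \<ominus> z) \<oplus> z"
  proof -
    obtain L where L: "parametrization L w z z z" using ex_parametrization assms w by metis
    show ?thesis by (simp add: L[unfolded parametrization_def])
  qed
  have cl: "w \<ominus> z \<in> carrier V" using w assms by simp
  have "x \<oplus> z \<preceq> (w \<ominus> z) \<oplus> z" "y \<oplus> z \<preceq> (w \<ominus> z) \<oplus> z" using w(2,3) w' by simp_all
  then have "x \<preceq> w \<ominus> z" "y \<preceq> w \<ominus> z" using vle_add_iff cl assms by blast+
  then have "vjoin V x y \<oplus> z \<preceq> (w \<ominus> z) \<oplus> z"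
    using assms cl vjoin_least by (simp add: vle_add_iff)
  then show "vjoin V x y \<oplus> z \<preceq> w" using w' by simp
qed (use assms vjoin_ge vle_add_iff in simp_all)

lemma vjoin_smult:
  assumes "x \<in> carrier V" "y \<in> carrier V" "q > 0"
  shows "vjoin V (q \<odot> x) (q \<odot> y) = q \<odot> vjoin V x y"
proof (rule vjoin_eqI)
  fix w assume w: "w \<in> carrier V" "q \<odot> x \<preceq> w" "q \<odot> y \<preceq> w"
  have w': "w = q \<odot> ((1 / q) \<odot> w)" using assms w by (simp add: smult_smult)
  then have "q \<odot> x \<preceq> q \<odot> ((1 / q) \<odot> w)" "q \<odot> y \<preceq> q \<odot> ((1 / q) \<odot> w)" using w(2,3) by simp_all
  then have "x \<preceq> (1 / q) \<odot> w" "y \<preceq> (1 / q) \<odot> w" using assms w smult_le_iff by blast+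
  then have "q \<odot> vjoin V x y \<preceq> q \<odot> ((1 / q) \<odot> w)"
    using assms w vjoin_least smult_mono by simp
  then show "q \<odot> vjoin V x y \<preceq> w" using w' by simp
qed (use assms vjoin_ge smult_mono in simp_all)

text \<open>The reflection sending \<open>w\<close> to \<open>x + y - w\<close> reverses the order
  and exchanges \<open>x\<close> and \<open>y\<close>, so it maps their least upper bound to their
  greatest lower bound. Preservation of meets thereby reduces to joins and linearity.\<close>

lemma vmeet_eq_vjoin:
  assumes xy: "x \<in> carrier V" "y \<in> carrier V"
  shows "vmeet V x y = x \<oplus> y \<ominus> vjoin V x y"
proof (rule vmeet_eqI)
  show "x \<oplus> y \<ominus> vjoin V x y \<in> carrier V" using xy by simp
  define j where "j = vjoin V x y"
  have j: "j \<in> carrier V" "x \<preceq> j" "y \<preceq> j" using xy vjoin_ge by (simp_all add: j_def)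
  obtain L where L: "parametrization L x y j j" using ex_parametrization[OF xy j(1) j(1)] .
  have eqs: "j \<ominus> y = x \<ominus> (x \<oplus> y \<ominus> j)" "j \<ominus> x = y \<ominus> (x \<oplus> y \<ominus> j)"
    by (simp_all add: L[unfolded parametrization_def])
  show "x \<oplus> y \<ominus> vjoin V x y \<preceq> x" unfolding j_def[symmetric] by (rule vle_linear[OF _ eqs(1)]) (use xy j in simp_all)
  show "x \<oplus> y \<ominus> vjoin V x y \<preceq> y" unfolding j_def[symmetric] by (rule vle_linear[OF _ eqs(2)]) (use xy j in simp_all)
  fix w assume w: "w \<in> carrier V" "w \<preceq> x" "w \<preceq> y"
  obtain L where L: "parametrization L x y w j" using ex_parametrization[OF xy w(1) j(1)] .
  have eqs: "y \<ominus> w = x \<oplus> y \<ominus> w \<ominus> x" "x \<ominus> w = x \<oplus> y \<ominus> w \<ominus> y"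
    "x \<oplus> y \<ominus> w \<ominus> j = x \<oplus> y \<ominus> j \<ominus> w"
    by (simp_all add: L[unfolded parametrization_def])
  have "x \<preceq> x \<oplus> y \<ominus> w" by (rule vle_linear[OF _ eqs(1)]) (use xy w j in simp_all)
  moreover have "y \<preceq> x \<oplus> y \<ominus> w" by (rule vle_linear[OF _ eqs(2)]) (use xy w j in simp_all)
  ultimately have "j \<preceq> x \<oplus> y \<ominus> w" using xy w unfolding j_def by (intro vjoin_least) simp_all
  then show "w \<preceq> x \<oplus> y \<ominus> vjoin V x y" unfolding j_def[symmetric] by (rule vle_linear[OF _ eqs(3)]) (use xy w j in simp_all)
qed (use assms in simp_all)

lemma vabs_bounds:
  assumes "x \<in> carrier V" "vabs V x \<preceq> y" "y \<in> carrier V"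
  shows "x \<preceq> y" "\<ominus> x \<preceq> y"
  using assms vjoin_ge[of x "\<ominus> x"] vle_trans[of x "vabs V x" y] vle_trans[of "\<ominus> x" "vabs V x" y]
  by (simp_all add: vabs_def)

end

section \<open>The unit interval functor\<close>

context
  fixes V :: "'a u_q_vec_lat" (structure)
  assumes V: "unital_q_vector_lattice V"
begin

interpretation unital_q_vector_lattice V by (rule V)

private abbreviation (input) "u \<equiv> vunit V"
private abbreviation (input) "I \<equiv> unit_interval V"

lemma unit_interval_simps [simp]:
  "carrier I = {x \<in> carrier V. \<zero> \<preceq> x \<and> x \<preceq> u}" "mv_plus I x y = vmeet V u (x \<oplus> y)"
  "mv_neg I x = u \<ominus> x" "mv_zero I = \<zero>" "dmv_delta I n x = (1 / rat_of_nat n) \<odot> x"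
  by (simp_all add: unit_interval_def)

lemmas unit_facts [simp] = unit_closed unit_nonneg

text \<open>If \<open>R\<close> is the right side, then \<open>R - y\<close> lies below
  \<open>a\<close>, and below \<open>u\<close> because \<open>y\<close> is nonnegative. So the inner
  truncation loses nothing; this is associativity of the truncated sum.\<close>

lemma vmeet_unit_absorb:
  assumes "a \<in> carrier V" "y \<in> carrier V" "\<zero> \<preceq> y"
  shows "vmeet V u (vmeet V u a \<oplus> y) = vmeet V u (a \<oplus> y)"
proof (rule vmeet_eqI)
  define R where "R = vmeet V u (a \<oplus> y)"
  have R: "R \<in> carrier V" "R \<preceq> u" "R \<preceq> a \<oplus> y" using assms vmeet_le by (simp_all add: R_def)
  obtain L where L: "parametrization L R y a u" using ex_parametrization[OF R(1) assms(2,1)] unit_closed .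
  have eqs: "(u \<ominus> R) \<oplus> (y \<ominus> \<zero>) = u \<ominus> (R \<ominus> y)" "(a \<oplus> y) \<ominus> R = a \<ominus> (R \<ominus> y)" "(R \<ominus> y) \<oplus> y = R"
    by (simp_all add: L[unfolded parametrization_def])
  have "R \<ominus> y \<preceq> u" by (rule vle_linear2[OF R(2) assms(3) eqs(1)]) (use assms R in simp_all)
  moreover have "R \<ominus> y \<preceq> a" by (rule vle_linear[OF R(3) eqs(2)]) (use assms R in simp_all)
  ultimately have "R \<ominus> y \<preceq> vmeet V u a" using assms R by (intro vmeet_greatest) simp_all
  then have "(R \<ominus> y) \<oplus> y \<preceq> vmeet V u a \<oplus> y" using assms R by (intro add_mono) simp_all
  then show "vmeet V u (a \<oplus> y) \<preceq> vmeet V u a \<oplus> y" using eqs(3) by (simp add: R_def)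
  fix w assume w: "w \<in> carrier V" "w \<preceq> u" "w \<preceq> vmeet V u a \<oplus> y"
  have "vmeet V u a \<oplus> y \<preceq> a \<oplus> y" using assms vmeet_le by (intro add_mono) simp_all
  then have "w \<preceq> a \<oplus> y" using vle_trans[OF w(3)] w assms by simp
  then show "w \<preceq> vmeet V u (a \<oplus> y)" using w assms by (intro vmeet_greatest) simp_all
qed (use assms vmeet_le in simp_all)

lemma vle_add_nonneg:
  assumes "x \<in> carrier V" "y \<in> carrier V" "\<zero> \<preceq> y" shows "x \<preceq> x \<oplus> y"
  using add_mono[of \<zero> y x] assms by (simp add: M.a_comm)

lemma unit_minus_mem:
  assumes "x \<in> carrier I" shows "u \<ominus> x \<in> carrier I"
proof -
  have x: "x \<in> carrier V" "\<zero> \<preceq> x" "x \<preceq> u" using assms by simp_all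
  obtain L where L: "parametrization L x u u u" using ex_parametrization[OF x(1)] unit_closed by blast
  have eqs: "u \<ominus> x = (u \<ominus> x) \<ominus> \<zero>" "x \<ominus> \<zero> = u \<ominus> (u \<ominus> x)"
    by (simp_all add: L[unfolded parametrization_def])
  have "\<zero> \<preceq> u \<ominus> x" by (rule vle_linear[OF x(3) eqs(1)]) (use x in simp_all)
  moreover have "u \<ominus> x \<preceq> u" by (rule vle_linear[OF x(2) eqs(2)]) (use x in simp_all)
  ultimately show ?thesis using x by simp
qed

lemma oplus_mem: "x \<in> carrier I \<Longrightarrow> y \<in> carrier I \<Longrightarrow> vmeet V u (x \<oplus> y) \<in> carrier I"
  using nonneg_add[of x y] vmeet_le[of u "x \<oplus> y"] by (auto intro: vmeet_greatest)

text \<open>Identifies the MV-term for the join with the lattice join of \<open>V\<close>. It yields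
  the \<open>lukasiewicz\<close> axiom as commutativity of joins, and later the preservation of
  joins by homomorphisms of DMV-algebras.\<close>

lemma vjoin_eq_mv_term:
  assumes "x \<in> carrier I" "y \<in> carrier I"
  shows "mv_plus I (mv_neg I (mv_plus I (mv_neg I x) y)) y = vjoin V x y"
proof -
  have x: "x \<in> carrier V" "\<zero> \<preceq> x" "x \<preceq> u" and y: "y \<in> carrier V" "\<zero> \<preceq> y" "y \<preceq> u"
    using assms by simp_all
  define M where "M = vmeet V u ((u \<ominus> x) \<oplus> y)"
  have M: "M \<in> carrier V" "M \<preceq> u" "M \<preceq> (u \<ominus> x) \<oplus> y" using x y vmeet_le by (simp_all add: M_def)
  obtain L where L: "parametrization L x y M u" using ex_parametrization[OF x(1) y(1) M(1)] unit_closed .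
  have eqs: "(u \<ominus> x) \<oplus> y \<ominus> M = (u \<ominus> M) \<oplus> y \<ominus> x" "u \<ominus> M = (u \<ominus> M) \<oplus> y \<ominus> y"
    by (simp_all add: L[unfolded parametrization_def])
  have join: "vjoin V x y = (u \<ominus> M) \<oplus> y"
  proof (rule vjoin_eqI)
    show "x \<preceq> (u \<ominus> M) \<oplus> y" by (rule vle_linear[OF M(3) eqs(1)]) (use x y M in simp_all)
    show "y \<preceq> (u \<ominus> M) \<oplus> y" by (rule vle_linear[OF M(2) eqs(2)]) (use x y M in simp_all)
    fix w assume w: "w \<in> carrier V" "x \<preceq> w" "y \<preceq> w"
    \<comment> \<open>Reflection of the upper bound \<open>w\<close>: \<open>y \<le> w\<close> gives
      \<open>t \<le> u\<close> and \<open>x \<le> w\<close> gives \<open>t \<le> u - x + y\<close>,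
      so \<open>t\<close> is below the meet \<open>M\<close>.\<close>
    define t where "t = u \<oplus> y \<ominus> w"
    have t: "t \<in> carrier V" using w x y by (simp add: t_def)
    obtain L where L: "parametrization L x y w u" using ex_parametrization[OF x(1) y(1) w(1)] unit_closed .
    have eqs1: "w \<ominus> y = u \<ominus> t" "w \<ominus> x = (u \<ominus> x) \<oplus> y \<ominus> t"
      unfolding t_def by (simp_all add: L[unfolded parametrization_def])
    have "t \<preceq> u" by (rule vle_linear[OF w(3) eqs1(1)]) (use x y w t in simp_all)
    moreover have "t \<preceq> (u \<ominus> x) \<oplus> y" by (rule vle_linear[OF w(2) eqs1(2)]) (use x y w t in simp_all)
    ultimately have tM: "t \<preceq> M" unfolding M_def using x y t by (intro vmeet_greatest) simp_all
    obtain L where L: "parametrization L M y w u" using ex_parametrization[OF M(1) y(1) w(1)] unit_closed .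
    have eq: "M \<ominus> t = w \<ominus> ((u \<ominus> M) \<oplus> y)"
      unfolding t_def by (simp add: L[unfolded parametrization_def])
    show "(u \<ominus> M) \<oplus> y \<preceq> w" by (rule vle_linear[OF tM eq]) (use x y w t M in simp_all)
  qed (use x y M in simp_all)
  have "vjoin V x y \<preceq> u" using x y by (intro vjoin_least) simp_all
  then have "vmeet V u (vjoin V x y) = vjoin V x y" using x y by (intro vmeet_right) simp_all
  then show ?thesis using join by (simp add: M_def)
qed

lemma mv_algebra_unit_interval: "mv_algebra I"
proof (rule mv_algebra.intro)
  show "comm_monoid (mv_monoid I)"
  proof (rule comm_monoidI)
    fix x y z
    assume xyz: "x \<in> carrier (mv_monoid I)" "y \<in> carrier (mv_monoid I)" "z \<in> carrier (mv_monoid I)"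
    then have "vmeet V u (vmeet V u (x \<oplus> y) \<oplus> z) = vmeet V u (x \<oplus> y \<oplus> z)"
      by (intro vmeet_unit_absorb) (simp_all add: mv_monoid_def)
    moreover have "vmeet V u (vmeet V u (y \<oplus> z) \<oplus> x) = vmeet V u (y \<oplus> z \<oplus> x)"
      using xyz by (intro vmeet_unit_absorb) (simp_all add: mv_monoid_def)
    ultimately show "(x \<otimes>\<^bsub>mv_monoid I\<^esub> y) \<otimes>\<^bsub>mv_monoid I\<^esub> z = x \<otimes>\<^bsub>mv_monoid I\<^esub> (y \<otimes>\<^bsub>mv_monoid I\<^esub> z)"
      using xyz by (simp add: mv_monoid_def M.a_ac)
  next
    fix x y assume "x \<in> carrier (mv_monoid I)" "y \<in> carrier (mv_monoid I)"
    then show "x \<otimes>\<^bsub>mv_monoid I\<^esub> y \<in> carrier (mv_monoid I)"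
      using oplus_mem[of x y] by (simp add: mv_monoid_def)
  qed (simp_all add: mv_monoid_def M.a_comm vmeet_right)
next
  fix x y assume "x \<in> carrier I" "y \<in> carrier I"
  then show "mv_plus I (mv_neg I (mv_plus I (mv_neg I x) y)) y = mv_plus I (mv_neg I (mv_plus I (mv_neg I y) x)) x"
    using vjoin_eq_mv_term[of x y] vjoin_eq_mv_term[of y x] vjoin_commute by simp
next
  fix x assume x: "x \<in> carrier I"
  then show "mv_neg I x \<in> carrier I" using unit_minus_mem by simp
  have x': "x \<in> carrier V" using x by simp
  obtain L where L: "parametrization L x u u u" using ex_parametrization[OF x'] unit_closed by blast
  have "u \<ominus> (u \<ominus> x) = x" "u \<ominus> \<zero> = u" by (simp_all add: L[unfolded parametrization_def])
  then show "mv_neg I (mv_neg I x) = x" "mv_plus I (mv_neg I (mv_zero I)) x = mv_neg I (mv_zero I)"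
    using x vle_add_nonneg[of u x] by (simp_all add: vmeet_left)
qed

text \<open>\<open>vmeet_unit_absorb\<close> collapses the truncations after the individual summands
  into a single one at the end.\<close>

lemma nsum_unit_interval:
  assumes "x \<in> carrier I"
  shows "mv_nsum I m x = vmeet V u (rat_of_nat m \<odot> x)"
proof (induction m)
  case 0
  then show ?case using assms mv_algebra.nsum_0[OF mv_algebra_unit_interval] by (simp add: vmeet_right)
next
  case (Suc m)
  have "vmeet V u (vmeet V u (rat_of_nat m \<odot> x) \<oplus> x) = vmeet V u (rat_of_nat m \<odot> x \<oplus> x)"
    using assms by (intro vmeet_unit_absorb) simp_all
  moreover have "rat_of_nat m \<odot> x \<oplus> x = rat_of_nat (Suc m) \<odot> x"
    using assms smult_plus[of x "rat_of_nat m" 1] by (simp add: add.commute)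
  ultimately show ?case
    using Suc mv_algebra.nsum_Suc[OF mv_algebra_unit_interval, of m x] by simp
qed

lemma smult_mem: 
  assumes "x \<in> carrier I" "0 \<le> q" "q \<le> 1" shows "q \<odot> x \<in> carrier I"
proof -
  have x: "x \<in> carrier V" "\<zero> \<preceq> x" "x \<preceq> u" using assms by simp_all
  have "\<zero> \<preceq> (1 - q) \<odot> x" using x assms smult_nonneg by simp
  then have "q \<odot> x \<preceq> q \<odot> x \<oplus> (1 - q) \<odot> x" using x vle_add_nonneg by simp
  then have "q \<odot> x \<preceq> x" using x smult_plus[of x q "1 - q"] by simp
  then have "q \<odot> x \<preceq> u" using vle_trans[of "q \<odot> x" x u] x by simp
  then show ?thesis using x assms smult_nonneg by simp
qed

lemma dmv_algebra_unit_interval: "dmv_algebra I"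
proof (intro dmv_algebra.intro mv_algebra_unit_interval dmv_algebra_axioms.intro)
  fix n :: nat and x assume n: "n \<ge> 1" and xI: "x \<in> carrier I"
  have x: "x \<in> carrier V" "\<zero> \<preceq> x" "x \<preceq> u" using xI by simp_all
  let ?d = "(1 / rat_of_nat n) \<odot> x"
  show *: "dmv_delta I n x \<in> carrier I" using xI n smult_mem[of x "1 / rat_of_nat n"] by simp
  have d: "?d \<in> carrier I" using * by simp
  show "mv_nsum I n (dmv_delta I n x) = x"
    using nsum_unit_interval[OF d, of n] n x by (simp add: smult_smult vmeet_right)
  have "rat_of_nat (n - 1) \<odot> ?d = ((rat_of_nat n - 1) / rat_of_nat n) \<odot> x"
    using n x by (simp add: smult_smult of_nat_diff)
  moreover have "((rat_of_nat n - 1) / rat_of_nat n) \<odot> x \<in> carrier I"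
    using n by (intro smult_mem xI) (simp_all add: field_simps)
  ultimately have s: "mv_nsum I (n - 1) ?d = ((rat_of_nat n - 1) / rat_of_nat n) \<odot> x"
    using nsum_unit_interval[OF d, of "n - 1"] by (simp add: vmeet_right)
  obtain L where L: "parametrization L x u u u" using ex_parametrization[OF x(1)] unit_closed by blast
  \<comment> \<open>The complements of the two factors add up to \<open>u + (u - x)\<close>, hence
    to at least \<open>u\<close>. Their truncated sum is \<open>u\<close>, whose complement is
    zero.\<close>
  have "u \<ominus> x = (u \<ominus> ?d) \<oplus> (u \<ominus> ((rat_of_nat n - 1) / rat_of_nat n) \<odot> x) \<ominus> u"
    using n by (simp add: L[unfolded parametrization_def] field_simps)
  then have "u \<preceq> (u \<ominus> ?d) \<oplus> (u \<ominus> ((rat_of_nat n - 1) / rat_of_nat n) \<odot> x)"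
    by (rule vle_linear[OF x(3)]) (use x in simp_all)
  then have "vmeet V u ((u \<ominus> ?d) \<oplus> (u \<ominus> ((rat_of_nat n - 1) / rat_of_nat n) \<odot> x)) = u"
    using x by (intro vmeet_left) simp_all
  then show "dmv_delta I n x \<boxdot>\<^bsub>I\<^esub> mv_nsum I (n - 1) (dmv_delta I n x) = mv_zero I"
    using s by (simp add: mv_times_def M.minus_eq M.r_neg)
qed

text \<open>If the absolute value of \<open>v\<close> is at most \<open>k u\<close> and
  \<open>n \<ge> 2k\<close>, then \<open>v/n\<close> deviates from zero by at most
  \<open>u/2\<close>, so shifting by \<open>u/2\<close> lands in the interval. All large
  \<open>n\<close> are allowed so that several vectors can share one denominator.\<close>

lemma unit_interval_form:
  assumes "v \<in> carrier V"
  obtains k :: nat where "\<And>n x. \<lbrakk>n \<ge> k; n > 0; x = (1 / rat_of_nat n) \<odot> v \<oplus> (1 / 2) \<odot> u\<rbrakk>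
    \<Longrightarrow> x \<in> carrier I \<and> v = rat_of_nat n \<odot> (x \<ominus> (1 / 2) \<odot> u)"
proof -
  obtain k where k: "vabs V v \<preceq> rat_of_nat k \<odot> u" using unit_strong assms by blast
  have b: "v \<preceq> rat_of_nat k \<odot> u" "\<ominus> v \<preceq> rat_of_nat k \<odot> u"
    using vabs_bounds[OF assms k] by simp_all
  obtain L where L: "parametrization L v u u u" using ex_parametrization[OF assms] unit_closed by blast
  have "x \<in> carrier I \<and> v = rat_of_nat n \<odot> (x \<ominus> (1 / 2) \<odot> u)"
    if n: "n \<ge> 2 * k" "n > 0" and x: "x = (1 / rat_of_nat n) \<odot> v \<oplus> (1 / 2) \<odot> u" for n x
  proof -
    have xV: "x \<in> carrier V" using x assms by simp
    have eq: "v = rat_of_nat n \<odot> (x \<ominus> (1 / 2) \<odot> u)"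
      unfolding x using n by (simp add: L[unfolded parametrization_def])
    have "rat_of_nat (2 * k) \<le> rat_of_nat n" using n(1) of_nat_le_iff by blast
    then have c: "1 / 2 - rat_of_nat k / rat_of_nat n \<ge> 0" (is "?c \<ge> 0")
      using n(2) by (simp add: field_simps)
    have cu: "\<zero> \<preceq> ?c \<odot> u" using c smult_nonneg by simp
    have m: "(1 / rat_of_nat n) \<odot> v \<preceq> (1 / rat_of_nat n) \<odot> (rat_of_nat k \<odot> u)"
      "(1 / rat_of_nat n) \<odot> \<ominus> v \<preceq> (1 / rat_of_nat n) \<odot> (rat_of_nat k \<odot> u)"
      using b assms by (auto intro!: smult_mono)
    have eqs: "((1 / rat_of_nat n) \<odot> (rat_of_nat k \<odot> u) \<ominus> (1 / rat_of_nat n) \<odot> v) \<oplus> (?c \<odot> u \<ominus> \<zero>) = u \<ominus> x"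
      "((1 / rat_of_nat n) \<odot> (rat_of_nat k \<odot> u) \<ominus> (1 / rat_of_nat n) \<odot> \<ominus> v) \<oplus> (?c \<odot> u \<ominus> \<zero>) = x \<ominus> \<zero>"
      unfolding x using n by (simp_all add: L[unfolded parametrization_def] field_simps)
    have "x \<preceq> u" by (rule vle_linear2[OF m(1) cu eqs(1)]) (use assms xV in simp_all)
    moreover have "\<zero> \<preceq> x" by (rule vle_linear2[OF m(2) cu eqs(2)]) (use assms xV in simp_all)
    ultimately show ?thesis using eq xV by simp
  qed
  then show ?thesis using that by blast
qed

text \<open>The common subtrahend is \<open>u/2\<close>; the common factor is the sum of both
  thresholds, plus one to make it positive. With \<open>w = v\<close> this also represents a single
  vector.\<close>

lemma common_unit_interval_form:
  assumes "v \<in> carrier V" "w \<in> carrier V"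
  obtains N x y z where "N > 0" "x \<in> carrier I" "y \<in> carrier I" "z \<in> carrier I"
    "v = N \<odot> (x \<ominus> z)" "w = N \<odot> (y \<ominus> z)"
proof -
  obtain k where k: "\<And>n x. \<lbrakk>n \<ge> k; n > 0; x = (1 / rat_of_nat n) \<odot> v \<oplus> (1 / 2) \<odot> u\<rbrakk>
    \<Longrightarrow> x \<in> carrier I \<and> v = rat_of_nat n \<odot> (x \<ominus> (1 / 2) \<odot> u)"
    using unit_interval_form[OF assms(1)] by blast
  obtain l where l: "\<And>n x. \<lbrakk>n \<ge> l; n > 0; x = (1 / rat_of_nat n) \<odot> w \<oplus> (1 / 2) \<odot> u\<rbrakk>
    \<Longrightarrow> x \<in> carrier I \<and> w = rat_of_nat n \<odot> (x \<ominus> (1 / 2) \<odot> u)"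
    using unit_interval_form[OF assms(2)] by blast
  have "u \<in> carrier I" by simp
  then have "(1 / 2) \<odot> u \<in> carrier I" by (intro smult_mem) simp_all
  then show ?thesis
    using that[of "rat_of_nat (k + l + 1)" "(1 / rat_of_nat (k + l + 1)) \<odot> v \<oplus> (1 / 2) \<odot> u"
        "(1 / rat_of_nat (k + l + 1)) \<odot> w \<oplus> (1 / 2) \<odot> u" "(1 / 2) \<odot> u"]
      k[of "k + l + 1"] l[of "k + l + 1"] by auto
qed

end

section \<open>Category axioms for \<open>uQVL\<close> and \<open>DMV\<close>\<close>

lemma category_uQVL: "category (uQVL :: ('a u_q_vec_lat, 'a \<Rightarrow> 'a) category)"
proof
  fix V :: "'a u_q_vec_lat" assume "V \<in> Ob uQVL"
  then interpret V: unital_q_vector_lattice V by (simp add: uQVL_def)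
  show "Ident uQVL V \<in> Hom uQVL V V"
    using V.unit_closed by (auto simp: uQVL_def uqvl_hom_def)
next
  fix U V W :: "'a u_q_vec_lat" and f g assume "U \<in> Ob uQVL" "V \<in> Ob uQVL" "W \<in> Ob uQVL"
    and fg: "f \<in> Hom uQVL U V" "g \<in> Hom uQVL V W"
  then interpret U: unital_q_vector_lattice U by (simp add: uQVL_def)
  have f: "f x \<in> carrier V" if "x \<in> carrier U" for x
    using fg(1) that by (auto simp: uQVL_def uqvl_hom_def)
  show "Comp uQVL U V W g f \<in> Hom uQVL U W"
    using fg f U.unit_closed by (auto simp: uQVL_def uqvl_hom_def compose_def)
next
  fix V W :: "'a u_q_vec_lat" and f assume f: "f \<in> Hom uQVL V W"
  show "Comp uQVL V V W f (Ident uQVL V) = f" "Comp uQVL V W W (Ident uQVL W) f = f"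
    using f by (auto simp: uQVL_def uqvl_hom_def compose_def restrict_def PiE_def extensional_def fun_eq_iff)
next
  fix T U V W :: "'a u_q_vec_lat" and f g h assume f: "f \<in> Hom uQVL T U"
  show "Comp uQVL T U W (Comp uQVL U V W h g) f = Comp uQVL T V W h (Comp uQVL T U V g f)"
    using f by (auto simp: uQVL_def uqvl_hom_def compose_def restrict_def fun_eq_iff)
qed

lemma category_DMV: "category (DMV :: ('a dmv_alg, 'a \<Rightarrow> 'a) category)"
proof
  fix A :: "'a dmv_alg" assume "A \<in> Ob DMV"
  then interpret A: dmv_algebra A by (simp add: DMV_def)
  show "Ident DMV A \<in> Hom DMV A A"
    by (auto simp: DMV_def dmv_hom_def)
next
  fix A B C :: "'a dmv_alg" and f g assume "A \<in> Ob DMV" "B \<in> Ob DMV" "C \<in> Ob DMV"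
    and fg: "f \<in> Hom DMV A B" "g \<in> Hom DMV B C"
  then interpret A: dmv_algebra A by (simp add: DMV_def)
  have f: "f x \<in> carrier B" if "x \<in> carrier A" for x
    using fg(1) that by (auto simp: DMV_def dmv_hom_def)
  show "Comp DMV A B C g f \<in> Hom DMV A C"
    using fg f by (auto simp: DMV_def dmv_hom_def compose_def)
next
  fix A B :: "'a dmv_alg" and f assume f: "f \<in> Hom DMV A B"
  show "Comp DMV A A B f (Ident DMV A) = f" "Comp DMV A B B (Ident DMV B) f = f"
    using f by (auto simp: DMV_def dmv_hom_def compose_def restrict_def PiE_def extensional_def fun_eq_iff)
next
  fix A B C D :: "'a dmv_alg" and f g h assume f: "f \<in> Hom DMV A B"
  show "Comp DMV A B D (Comp DMV B C D h g) f = Comp DMV A C D h (Comp DMV A B C g f)"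
    using f by (auto simp: DMV_def dmv_hom_def compose_def restrict_def fun_eq_iff)
qed

section \<open>Full faithfulness of the unit interval functor\<close>

context
  fixes V W :: "'a u_q_vec_lat"
  assumes V: "unital_q_vector_lattice V" and W: "unital_q_vector_lattice W"
begin

interpretation V: unital_q_vector_lattice V by (rule V)
interpretation W: unital_q_vector_lattice W by (rule W)

private abbreviation (input) "I\<^sub>V \<equiv> unit_interval V"
private abbreviation (input) "I\<^sub>W \<equiv> unit_interval W"
private abbreviation (input) "u\<^sub>V \<equiv> vunit V"
private abbreviation (input) "u\<^sub>W \<equiv> vunit W"

lemmas I_simps [simp] = unit_interval_simps[OF V]
lemmas J_simps [simp] = unit_interval_simps[OF W]

lemma uqvl_homD:
  assumes "f \<in> uqvl_hom V W"
  shows "x \<in> carrier V \<Longrightarrow> f x \<in> carrier W"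
    "\<lbrakk>x \<in> carrier V; y \<in> carrier V\<rbrakk> \<Longrightarrow> f (x \<oplus>\<^bsub>V\<^esub> y) = f x \<oplus>\<^bsub>W\<^esub> f y"
    "x \<in> carrier V \<Longrightarrow> f (q \<odot>\<^bsub>V\<^esub> x) = q \<odot>\<^bsub>W\<^esub> f x"
    "\<lbrakk>x \<in> carrier V; y \<in> carrier V\<rbrakk> \<Longrightarrow> f (vjoin V x y) = vjoin W (f x) (f y)"
    "\<lbrakk>x \<in> carrier V; y \<in> carrier V\<rbrakk> \<Longrightarrow> f (vmeet V x y) = vmeet W (f x) (f y)"
    "f u\<^sub>V = u\<^sub>W" "f \<zero>\<^bsub>V\<^esub> = \<zero>\<^bsub>W\<^esub>"
    "\<lbrakk>x \<in> carrier V; y \<in> carrier V\<rbrakk> \<Longrightarrow> f (x \<ominus>\<^bsub>V\<^esub> y) = f x \<ominus>\<^bsub>W\<^esub> f y"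
proof -
  show cl: "x \<in> carrier V \<Longrightarrow> f x \<in> carrier W" for x using assms by (auto simp: uqvl_hom_def)
  show add: "\<lbrakk>x \<in> carrier V; y \<in> carrier V\<rbrakk> \<Longrightarrow> f (x \<oplus>\<^bsub>V\<^esub> y) = f x \<oplus>\<^bsub>W\<^esub> f y" for x y
    using assms by (simp add: uqvl_hom_def)
  show sc: "x \<in> carrier V \<Longrightarrow> f (q \<odot>\<^bsub>V\<^esub> x) = q \<odot>\<^bsub>W\<^esub> f x" for q x
    using assms by (simp add: uqvl_hom_def)
  show "f \<zero>\<^bsub>V\<^esub> = \<zero>\<^bsub>W\<^esub>" using sc[of "\<zero>\<^bsub>V\<^esub>" 0] cl by simp
  show "\<lbrakk>x \<in> carrier V; y \<in> carrier V\<rbrakk> \<Longrightarrow> f (x \<ominus>\<^bsub>V\<^esub> y) = f x \<ominus>\<^bsub>W\<^esub> f y"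
    using add[of x "\<ominus>\<^bsub>V\<^esub> y"] sc[of y "-1"] cl
    by (simp add: a_minus_def V.uminus_smult W.uminus_smult)
qed (use assms in \<open>simp_all add: uqvl_hom_def\<close>)

lemma uqvl_hom_mono:
  assumes f: "f \<in> uqvl_hom V W" and "x \<in> carrier V" "y \<in> carrier V" "x \<preceq>\<^bsub>V\<^esub> y"
  shows "f x \<preceq>\<^bsub>W\<^esub> f y"
  using uqvl_homD(5)[OF f, of x y] assms uqvl_homD(1)[OF f] W.vmeet_le(2)[of "f x" "f y"]
  by (simp add: V.vmeet_left)

lemma uqvl_hom_restrict:
  assumes f: "f \<in> uqvl_hom V W"
  shows "restrict f (carrier I\<^sub>V) \<in> dmv_hom I\<^sub>V I\<^sub>W"
proof -
  note D = uqvl_homD[OF f]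
  have mem: "f x \<in> carrier I\<^sub>W" if "x \<in> carrier I\<^sub>V" for x
    using that uqvl_hom_mono[OF f, of "\<zero>\<^bsub>V\<^esub>" x] uqvl_hom_mono[OF f, of x u\<^sub>V] D V.unit_closed by simp
  interpret I: dmv_algebra I\<^sub>V by (rule dmv_algebra_unit_interval[OF V])
  show ?thesis
    unfolding dmv_hom_def
  proof (intro CollectI conjI ballI allI impI)
    show "restrict f (carrier I\<^sub>V) \<in> carrier I\<^sub>V \<rightarrow>\<^sub>E carrier I\<^sub>W" using mem by auto
    fix x assume x: "x \<in> carrier I\<^sub>V"
    show "restrict f (carrier I\<^sub>V) (mv_neg I\<^sub>V x) = mv_neg I\<^sub>W (restrict f (carrier I\<^sub>V) x)"
      using x I.neg_closed[of x] D V.unit_closed by simp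
    show "restrict f (carrier I\<^sub>V) (dmv_delta I\<^sub>V n x) = dmv_delta I\<^sub>W n (restrict f (carrier I\<^sub>V) x)"
      if "n \<ge> 1" for n using x I.delta_closed[of n x] D that by simp
    fix y assume y: "y \<in> carrier I\<^sub>V"
    show "restrict f (carrier I\<^sub>V) (mv_plus I\<^sub>V x y)
        = mv_plus I\<^sub>W (restrict f (carrier I\<^sub>V) x) (restrict f (carrier I\<^sub>V) y)"
      using x y I.plus_closed[of x y] D V.unit_closed by simp
  qed (use D V.unit_nonneg in simp)
qed

lemma uqvl_hom_eqI:
  assumes f: "f \<in> uqvl_hom V W" and g: "g \<in> uqvl_hom V W"
    and eq: "restrict f (carrier I\<^sub>V) = restrict g (carrier I\<^sub>V)"
  shows "f = g"
proof (rule ext)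
  fix v
  show "f v = g v"
  proof (cases "v \<in> carrier V")
    case True
    obtain N x y z where *: "N > 0" "x \<in> carrier I\<^sub>V" "y \<in> carrier I\<^sub>V" "z \<in> carrier I\<^sub>V"
      "v = N \<odot>\<^bsub>V\<^esub> (x \<ominus>\<^bsub>V\<^esub> z)" "v = N \<odot>\<^bsub>V\<^esub> (y \<ominus>\<^bsub>V\<^esub> z)"
      using common_unit_interval_form[OF V True True] .
    have xz: "f x = g x" "f z = g z" using fun_cong[OF eq, of x] fun_cong[OF eq, of z] *(2,4) by simp_all
    then show ?thesis
      using * xz uqvl_homD[OF f] uqvl_homD[OF g] by simp
  next
    case False
    then show ?thesis using f g by (auto simp: uqvl_hom_def PiE_def extensional_def)
  qed
qed

context
  fixes g assumes g: "g \<in> dmv_hom I\<^sub>V I\<^sub>W"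
begin

lemma g_closed: "x \<in> carrier I\<^sub>V \<Longrightarrow> g x \<in> carrier I\<^sub>W"
  using g unfolding dmv_hom_def by blast

lemma g_closed' [simp]: "x \<in> carrier I\<^sub>V \<Longrightarrow> g x \<in> carrier W"
  using g_closed by simp

lemma g_oplus: "\<lbrakk>x \<in> carrier I\<^sub>V; y \<in> carrier I\<^sub>V\<rbrakk> \<Longrightarrow> g (mv_plus I\<^sub>V x y) = mv_plus I\<^sub>W (g x) (g y)"
  using g unfolding dmv_hom_def by blast

lemma g_neg: "x \<in> carrier I\<^sub>V \<Longrightarrow> g (mv_neg I\<^sub>V x) = mv_neg I\<^sub>W (g x)"
  using g unfolding dmv_hom_def by blast

lemma g_zero: "g \<zero>\<^bsub>V\<^esub> = \<zero>\<^bsub>W\<^esub>"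
  using g unfolding dmv_hom_def by simp

lemma g_delta: "\<lbrakk>n \<ge> 1; x \<in> carrier I\<^sub>V\<rbrakk> \<Longrightarrow> g (dmv_delta I\<^sub>V n x) = dmv_delta I\<^sub>W n (g x)"
  using g unfolding dmv_hom_def by blast

text \<open>The difference \<open>y - x\<close> lies in the interval and its truncated sum with
  \<open>x\<close> is \<open>y\<close>. Hence \<open>g y\<close> is the truncation of
  \<open>g x + g (y - x)\<close>, which is at least \<open>g x\<close>.\<close>

lemma g_mono:
  assumes "x \<in> carrier I\<^sub>V" "y \<in> carrier I\<^sub>V" "x \<preceq>\<^bsub>V\<^esub> y"
  shows "g x \<preceq>\<^bsub>W\<^esub> g y"
proof -
  have x: "x \<in> carrier V" "\<zero>\<^bsub>V\<^esub> \<preceq>\<^bsub>V\<^esub> x" and y: "y \<in> carrier V" "y \<preceq>\<^bsub>V\<^esub> u\<^sub>V" using assms by simp_all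
  obtain L where L: "V.parametrization L x y u\<^sub>V u\<^sub>V"
    using V.ex_parametrization[OF x(1) y(1)] V.unit_closed by blast
  note L = L[unfolded V.parametrization_def]
  have eqs: "y \<ominus>\<^bsub>V\<^esub> x = y \<ominus>\<^bsub>V\<^esub> x \<ominus>\<^bsub>V\<^esub> \<zero>\<^bsub>V\<^esub>" "x \<oplus>\<^bsub>V\<^esub> (y \<ominus>\<^bsub>V\<^esub> x) = y"
    "(u\<^sub>V \<ominus>\<^bsub>V\<^esub> y) \<oplus>\<^bsub>V\<^esub> (x \<ominus>\<^bsub>V\<^esub> \<zero>\<^bsub>V\<^esub>) = u\<^sub>V \<ominus>\<^bsub>V\<^esub> (y \<ominus>\<^bsub>V\<^esub> x)"
    by (simp_all add: L)
  have "\<zero>\<^bsub>V\<^esub> \<preceq>\<^bsub>V\<^esub> y \<ominus>\<^bsub>V\<^esub> x" by (rule V.vle_linear[OF assms(3) eqs(1)]) (use x y in simp_all)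
  moreover have "y \<ominus>\<^bsub>V\<^esub> x \<preceq>\<^bsub>V\<^esub> u\<^sub>V"
    by (rule V.vle_linear2[OF y(2) x(2) eqs(3)]) (use x y V.unit_closed in simp_all)
  ultimately have d: "y \<ominus>\<^bsub>V\<^esub> x \<in> carrier I\<^sub>V" using x y by simp
  have "mv_plus I\<^sub>V x (y \<ominus>\<^bsub>V\<^esub> x) = y"
    using eqs(2) y V.unit_closed by (simp add: V.vmeet_right)
  then have gy: "g y = vmeet W u\<^sub>W (g x \<oplus>\<^bsub>W\<^esub> g (y \<ominus>\<^bsub>V\<^esub> x))"
    using g_oplus[OF assms(1) d] by simp
  have gx: "g x \<in> carrier W" "g x \<preceq>\<^bsub>W\<^esub> u\<^sub>W" "g (y \<ominus>\<^bsub>V\<^esub> x) \<in> carrier W" "\<zero>\<^bsub>W\<^esub> \<preceq>\<^bsub>W\<^esub> g (y \<ominus>\<^bsub>V\<^esub> x)"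
    using g_closed[OF assms(1)] g_closed[OF d] by simp_all
  show ?thesis
    unfolding gy using gx vle_add_nonneg[OF W] W.unit_closed by (intro W.vmeet_greatest) simp_all
qed

text \<open>That no truncation occurs can be said by MV-operations: it means that \<open>y\<close>
  is at most the complement of \<open>x\<close>. As \<open>g\<close> preserves order and
  complements, the sum of the images is not truncated either.\<close>

lemma g_add:
  assumes "x \<in> carrier I\<^sub>V" "y \<in> carrier I\<^sub>V" "x \<oplus>\<^bsub>V\<^esub> y \<preceq>\<^bsub>V\<^esub> u\<^sub>V"
  shows "g (x \<oplus>\<^bsub>V\<^esub> y) = g x \<oplus>\<^bsub>W\<^esub> g y"
proof -
  have x: "x \<in> carrier V" and y: "y \<in> carrier V" using assms by simp_all
  obtain L where L: "V.parametrization L x y u\<^sub>V u\<^sub>V"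
    using V.ex_parametrization[OF x(1) y(1)] V.unit_closed by blast
  note L = L[unfolded V.parametrization_def]
  have eq: "u\<^sub>V \<ominus>\<^bsub>V\<^esub> (x \<oplus>\<^bsub>V\<^esub> y) = (u\<^sub>V \<ominus>\<^bsub>V\<^esub> x) \<ominus>\<^bsub>V\<^esub> y" by (simp add: L)
  have "y \<preceq>\<^bsub>V\<^esub> u\<^sub>V \<ominus>\<^bsub>V\<^esub> x"
    by (rule V.vle_linear[OF assms(3) eq]) (use x y V.unit_closed in simp_all)
  then have "g y \<preceq>\<^bsub>W\<^esub> g (u\<^sub>V \<ominus>\<^bsub>V\<^esub> x)"
    using g_mono[OF assms(2) unit_minus_mem[OF V assms(1)]] by simp
  then have le: "g y \<preceq>\<^bsub>W\<^esub> u\<^sub>W \<ominus>\<^bsub>W\<^esub> g x" using g_neg[OF assms(1)] by simp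
  have gxy: "g x \<in> carrier W" "g y \<in> carrier W" using assms(1,2) g_closed' by blast+
  obtain L where L: "W.parametrization L (g x) (g y) u\<^sub>W u\<^sub>W"
    using W.ex_parametrization[OF gxy] W.unit_closed by blast
  have eq: "(u\<^sub>W \<ominus>\<^bsub>W\<^esub> g x) \<ominus>\<^bsub>W\<^esub> g y = u\<^sub>W \<ominus>\<^bsub>W\<^esub> (g x \<oplus>\<^bsub>W\<^esub> g y)"
    by (simp add: L[unfolded W.parametrization_def])
  have "g x \<oplus>\<^bsub>W\<^esub> g y \<preceq>\<^bsub>W\<^esub> u\<^sub>W"
    by (rule W.vle_linear[OF le eq]) (use gxy W.unit_closed in simp_all)
  moreover have "mv_plus I\<^sub>V x y = x \<oplus>\<^bsub>V\<^esub> y" using assms V.unit_closed by (simp add: V.vmeet_right)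
  ultimately show ?thesis
    using g_oplus[OF assms(1,2)] gxy W.unit_closed by (simp add: W.vmeet_right)
qed

text \<open>Preservation of \<open>\<delta>\<close> gives the scalar \<open>1/n\<close>; the scalar
  \<open>m/n\<close> follows by adding \<open>1/n\<close> repeatedly, with all partial sums inside
  the interval.\<close>

lemma g_smult:
  assumes x: "x \<in> carrier I\<^sub>V" and q: "0 \<le> q" "q \<le> 1"
  shows "g (q \<odot>\<^bsub>V\<^esub> x) = q \<odot>\<^bsub>W\<^esub> g x"
proof -
  obtain m n where n: "n \<ge> 1" "m \<le> n" "q = rat_of_nat m / rat_of_nat n"
    using rat_le_1_fraction[OF q] .
  have xV: "x \<in> carrier V" using x by simp
  have gx: "g x \<in> carrier W" using x by (rule g_closed')
  have frac: "0 \<le> rat_of_nat k / rat_of_nat n" "rat_of_nat k / rat_of_nat n \<le> 1" if "k \<le> n" for k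
    using that n(1) by simp_all
  have "g ((rat_of_nat k / rat_of_nat n) \<odot>\<^bsub>V\<^esub> x) = (rat_of_nat k / rat_of_nat n) \<odot>\<^bsub>W\<^esub> g x" if "k \<le> n" for k
    using that
  proof (induction k)
    case 0
    then show ?case using xV gx g_zero by simp
  next
    case (Suc k)
    have s: "rat_of_nat (Suc k) / rat_of_nat n = rat_of_nat k / rat_of_nat n + 1 / rat_of_nat n"
      by (simp add: add_divide_distrib)
    have mem: "(rat_of_nat k / rat_of_nat n) \<odot>\<^bsub>V\<^esub> x \<in> carrier I\<^sub>V" "(1 / rat_of_nat n) \<odot>\<^bsub>V\<^esub> x \<in> carrier I\<^sub>V"
      "(rat_of_nat (Suc k) / rat_of_nat n) \<odot>\<^bsub>V\<^esub> x \<in> carrier I\<^sub>V"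
      using smult_mem[OF V x frac[of k]] smult_mem[OF V x frac[of 1]] smult_mem[OF V x frac[of "Suc k"]]
        Suc n(1) by simp_all
    have "g ((1 / rat_of_nat n) \<odot>\<^bsub>V\<^esub> x) = (1 / rat_of_nat n) \<odot>\<^bsub>W\<^esub> g x"
      using g_delta[OF n(1) x] by simp
    then show ?case
      using g_add[OF mem(1,2)] mem(3) Suc xV gx unfolding s by (simp add: V.smult_plus W.smult_plus)
  qed
  then show ?thesis using n by simp
qed

lemma convex_comb_mem:
  assumes "x \<in> carrier I\<^sub>V" "y \<in> carrier I\<^sub>V" "0 \<le> s" "0 \<le> t" "s + t \<le> 1"
  shows "s \<odot>\<^bsub>V\<^esub> x \<oplus>\<^bsub>V\<^esub> t \<odot>\<^bsub>V\<^esub> y \<in> carrier I\<^sub>V"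
proof -
  have x: "x \<in> carrier V" "\<zero>\<^bsub>V\<^esub> \<preceq>\<^bsub>V\<^esub> x" "x \<preceq>\<^bsub>V\<^esub> u\<^sub>V" "y \<in> carrier V" "\<zero>\<^bsub>V\<^esub> \<preceq>\<^bsub>V\<^esub> y" "y \<preceq>\<^bsub>V\<^esub> u\<^sub>V"
    using assms by simp_all
  have "s \<odot>\<^bsub>V\<^esub> x \<oplus>\<^bsub>V\<^esub> t \<odot>\<^bsub>V\<^esub> y \<preceq>\<^bsub>V\<^esub> s \<odot>\<^bsub>V\<^esub> u\<^sub>V \<oplus>\<^bsub>V\<^esub> t \<odot>\<^bsub>V\<^esub> u\<^sub>V"
    using x assms V.smult_mono V.unit_closed by (intro V.vle_add_mono) simp_all
  also have "s \<odot>\<^bsub>V\<^esub> u\<^sub>V \<oplus>\<^bsub>V\<^esub> t \<odot>\<^bsub>V\<^esub> u\<^sub>V = (s + t) \<odot>\<^bsub>V\<^esub> u\<^sub>V" using V.smult_plus V.unit_closed by simp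
  finally have "s \<odot>\<^bsub>V\<^esub> x \<oplus>\<^bsub>V\<^esub> t \<odot>\<^bsub>V\<^esub> y \<preceq>\<^bsub>V\<^esub> (s + t) \<odot>\<^bsub>V\<^esub> u\<^sub>V" .
  moreover have "(s + t) \<odot>\<^bsub>V\<^esub> u\<^sub>V \<preceq>\<^bsub>V\<^esub> u\<^sub>V"
    using smult_mem[OF V, of u\<^sub>V "s + t"] assms V.unit_closed V.unit_nonneg by simp
  ultimately have "s \<odot>\<^bsub>V\<^esub> x \<oplus>\<^bsub>V\<^esub> t \<odot>\<^bsub>V\<^esub> y \<preceq>\<^bsub>V\<^esub> u\<^sub>V"
    using V.vle_trans[of "s \<odot>\<^bsub>V\<^esub> x \<oplus>\<^bsub>V\<^esub> t \<odot>\<^bsub>V\<^esub> y" "(s + t) \<odot>\<^bsub>V\<^esub> u\<^sub>V" u\<^sub>V] x V.unit_closed by simp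
  then show ?thesis
    using x assms V.smult_nonneg V.nonneg_add[of "s \<odot>\<^bsub>V\<^esub> x" "t \<odot>\<^bsub>V\<^esub> y"] by simp
qed

lemma g_comb:
  assumes x: "x \<in> carrier I\<^sub>V" "y \<in> carrier I\<^sub>V" and st: "0 \<le> s" "0 \<le> t" "s + t \<le> 1"
  shows "g (s \<odot>\<^bsub>V\<^esub> x \<oplus>\<^bsub>V\<^esub> t \<odot>\<^bsub>V\<^esub> y) = s \<odot>\<^bsub>W\<^esub> g x \<oplus>\<^bsub>W\<^esub> t \<odot>\<^bsub>W\<^esub> g y"
proof -
  have "s \<le> 1" "t \<le> 1" using st by linarith+
  then have "g (s \<odot>\<^bsub>V\<^esub> x) = s \<odot>\<^bsub>W\<^esub> g x" "g (t \<odot>\<^bsub>V\<^esub> y) = t \<odot>\<^bsub>W\<^esub> g y"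
    "s \<odot>\<^bsub>V\<^esub> x \<in> carrier I\<^sub>V" "t \<odot>\<^bsub>V\<^esub> y \<in> carrier I\<^sub>V"
    using g_smult smult_mem[OF V] x st by blast+
  then show ?thesis
    using g_add[of "s \<odot>\<^bsub>V\<^esub> x" "t \<odot>\<^bsub>V\<^esub> y"] convex_comb_mem[OF x st] by simp
qed

text \<open>On the interval the join is an MV-term, so it is preserved and stays inside.\<close>

lemma g_join:
  assumes "x \<in> carrier I\<^sub>V" "y \<in> carrier I\<^sub>V"
  shows "g (vjoin V x y) = vjoin W (g x) (g y)" "vjoin V x y \<in> carrier I\<^sub>V"
proof -
  interpret I: dmv_algebra I\<^sub>V by (rule dmv_algebra_unit_interval[OF V])
  have "g (mv_plus I\<^sub>V (mv_neg I\<^sub>V (mv_plus I\<^sub>V (mv_neg I\<^sub>V x) y)) y)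
    = mv_plus I\<^sub>W (mv_neg I\<^sub>W (mv_plus I\<^sub>W (mv_neg I\<^sub>W (g x)) (g y))) (g y)"
    using assms g_oplus g_neg I.neg_closed I.plus_closed by metis
  then show "g (vjoin V x y) = vjoin W (g x) (g y)"
    unfolding vjoin_eq_mv_term[OF V assms] vjoin_eq_mv_term[OF W g_closed[OF assms(1)] g_closed[OF assms(2)]] .
  show "vjoin V x y \<in> carrier I\<^sub>V"
    unfolding vjoin_eq_mv_term[OF V assms, symmetric]
    using assms by (intro I.plus_closed I.neg_closed)
qed

definition extension :: "'a \<Rightarrow> 'a" where
  "extension = (\<lambda>v \<in> carrier V. SOME v'. \<exists>N>0. \<exists>x \<in> carrier I\<^sub>V. \<exists>y \<in> carrier I\<^sub>V.
    v = N \<odot>\<^bsub>V\<^esub> (x \<ominus>\<^bsub>V\<^esub> y) \<and> v' = N \<odot>\<^bsub>W\<^esub> (g x \<ominus>\<^bsub>W\<^esub> g y))"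

text \<open>Moving the subtracted terms across and dividing by \<open>N + M\<close> turns the
  hypothesis into an equation between two mixtures in the interval. \<open>g\<close> preserves these
  by \<open>g_comb\<close>, and the steps are then reversed in \<open>W\<close>.\<close>

lemma extension_welldefined:
  assumes N: "N > 0" "M > 0" and x: "x \<in> carrier I\<^sub>V" "y \<in> carrier I\<^sub>V" "x' \<in> carrier I\<^sub>V" "y' \<in> carrier I\<^sub>V"
    and eq: "N \<odot>\<^bsub>V\<^esub> (x \<ominus>\<^bsub>V\<^esub> y) = M \<odot>\<^bsub>V\<^esub> (x' \<ominus>\<^bsub>V\<^esub> y')"
  shows "N \<odot>\<^bsub>W\<^esub> (g x \<ominus>\<^bsub>W\<^esub> g y) = M \<odot>\<^bsub>W\<^esub> (g x' \<ominus>\<^bsub>W\<^esub> g y')"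
proof -
  define s t where "s = N / (N + M)" and "t = M / (N + M)"
  have st: "s \<ge> 0" "t \<ge> 0" "s + t \<le> 1" "t + s \<le> 1" "N = (N + M) * s" "M = (N + M) * t"
    using N by (simp_all add: s_def t_def add_divide_distrib[symmetric])
  have s1: "s = 1 / (N + M) * N" "t = 1 / (N + M) * M" by (simp_all add: s_def t_def)
  have xV: "x \<in> carrier V" "y \<in> carrier V" "x' \<in> carrier V" "y' \<in> carrier V" using x by simp_all
  obtain L where L: "V.parametrization L x y x' y'" using V.ex_parametrization[OF xV] .
  have "(s \<odot>\<^bsub>V\<^esub> x \<oplus>\<^bsub>V\<^esub> t \<odot>\<^bsub>V\<^esub> y') \<ominus>\<^bsub>V\<^esub> (t \<odot>\<^bsub>V\<^esub> x' \<oplus>\<^bsub>V\<^esub> s \<odot>\<^bsub>V\<^esub> y)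
    = (1 / (N + M)) \<odot>\<^bsub>V\<^esub> (N \<odot>\<^bsub>V\<^esub> (x \<ominus>\<^bsub>V\<^esub> y) \<ominus>\<^bsub>V\<^esub> M \<odot>\<^bsub>V\<^esub> (x' \<ominus>\<^bsub>V\<^esub> y'))"
    unfolding s1 by (simp add: L[unfolded V.parametrization_def])
  then have "s \<odot>\<^bsub>V\<^esub> x \<oplus>\<^bsub>V\<^esub> t \<odot>\<^bsub>V\<^esub> y' = t \<odot>\<^bsub>V\<^esub> x' \<oplus>\<^bsub>V\<^esub> s \<odot>\<^bsub>V\<^esub> y"
    by (rule V.eq_linear[OF eq]) (use xV in simp_all)
  then have *: "s \<odot>\<^bsub>W\<^esub> g x \<oplus>\<^bsub>W\<^esub> t \<odot>\<^bsub>W\<^esub> g y' = t \<odot>\<^bsub>W\<^esub> g x' \<oplus>\<^bsub>W\<^esub> s \<odot>\<^bsub>W\<^esub> g y"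
    using g_comb[OF x(1,4) st(1,2,3)] g_comb[OF x(3,2) st(2,1,4)] by simp
  have gW: "g x \<in> carrier W" "g y \<in> carrier W" "g x' \<in> carrier W" "g y' \<in> carrier W"
    using x g_closed' by blast+
  obtain L where L: "W.parametrization L (g x) (g y) (g x') (g y')" using W.ex_parametrization[OF gW] .
  have "N \<odot>\<^bsub>W\<^esub> (g x \<ominus>\<^bsub>W\<^esub> g y) \<ominus>\<^bsub>W\<^esub> M \<odot>\<^bsub>W\<^esub> (g x' \<ominus>\<^bsub>W\<^esub> g y')
    = (N + M) \<odot>\<^bsub>W\<^esub> ((s \<odot>\<^bsub>W\<^esub> g x \<oplus>\<^bsub>W\<^esub> t \<odot>\<^bsub>W\<^esub> g y') \<ominus>\<^bsub>W\<^esub> (t \<odot>\<^bsub>W\<^esub> g x' \<oplus>\<^bsub>W\<^esub> s \<odot>\<^bsub>W\<^esub> g y))"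
    using st(5,6)[symmetric] by (simp add: L[unfolded W.parametrization_def])
  then show ?thesis by (rule W.eq_linear[OF *]) (use gW in simp_all)
qed

lemma extension_eq:
  assumes N: "N > 0" and x: "x \<in> carrier I\<^sub>V" "y \<in> carrier I\<^sub>V"
  shows "extension (N \<odot>\<^bsub>V\<^esub> (x \<ominus>\<^bsub>V\<^esub> y)) = N \<odot>\<^bsub>W\<^esub> (g x \<ominus>\<^bsub>W\<^esub> g y)"
proof -
  have v: "N \<odot>\<^bsub>V\<^esub> (x \<ominus>\<^bsub>V\<^esub> y) \<in> carrier V" using x by simp
  show ?thesis
    unfolding extension_def restrict_apply'[OF v]
  proof (rule some_equality, goal_cases)
    case 1
    show ?case using N x by blast
  next
    case (2 v')
    then show ?case using extension_welldefined[OF N] x by metis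
  qed
qed

lemma extension_hom: "extension \<in> uqvl_hom V W"
proof -
  have sub: "extension (a \<ominus>\<^bsub>V\<^esub> b) = g a \<ominus>\<^bsub>W\<^esub> g b" if "a \<in> carrier I\<^sub>V" "b \<in> carrier I\<^sub>V" for a b
    using extension_eq[of 1 a b] that g_closed' by simp
  have cl: "extension v \<in> carrier W" if v: "v \<in> carrier V" for v
  proof -
    obtain N x y z where *: "N > 0" "x \<in> carrier I\<^sub>V" "y \<in> carrier I\<^sub>V" "z \<in> carrier I\<^sub>V"
      "v = N \<odot>\<^bsub>V\<^esub> (x \<ominus>\<^bsub>V\<^esub> z)" "v = N \<odot>\<^bsub>V\<^esub> (y \<ominus>\<^bsub>V\<^esub> z)"
      using common_unit_interval_form[OF V v v] .
    show ?thesis unfolding *(5) extension_eq[OF *(1,2,4)] using g_closed' *(2,4) by simp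
  qed
  have smult: "extension (q \<odot>\<^bsub>V\<^esub> v) = q \<odot>\<^bsub>W\<^esub> extension v" if v: "v \<in> carrier V" for q v
  proof -
    obtain N x y z where *: "N > 0" "x \<in> carrier I\<^sub>V" "y \<in> carrier I\<^sub>V" "z \<in> carrier I\<^sub>V"
      "v = N \<odot>\<^bsub>V\<^esub> (x \<ominus>\<^bsub>V\<^esub> z)" "v = N \<odot>\<^bsub>V\<^esub> (y \<ominus>\<^bsub>V\<^esub> z)"
      using common_unit_interval_form[OF V v v] .
    have xV: "x \<in> carrier V" "z \<in> carrier V" using * by simp_all
    have gW: "g x \<in> carrier W" "g z \<in> carrier W" using *(2,4) g_closed' by blast+
    obtain K where K: "V.parametrization K x z z z" using V.ex_parametrization xV by metis
    obtain L where L: "W.parametrization L (g x) (g z) (g z) (g z)" using W.ex_parametrization gW by metis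
    note K = K[unfolded V.parametrization_def] and L = L[unfolded W.parametrization_def]
    consider "q > 0" | "q = 0" | "q < 0" by linarith
    then show ?thesis
    proof cases
      case 1
      then have "q * N > 0" using *(1) by simp
      moreover have "q \<odot>\<^bsub>V\<^esub> v = (q * N) \<odot>\<^bsub>V\<^esub> (x \<ominus>\<^bsub>V\<^esub> z)" using * xV by (simp add: V.smult_smult)
      ultimately show ?thesis
        using extension_eq[of "q * N" x z] extension_eq[OF *(1,2,4)] *(2,4,5) gW by (simp add: W.smult_smult)
    next
      case 2
      \<comment> \<open>Representations require a positive factor, so the zero vector is written as
        a difference of equal elements.\<close>
      have "q \<odot>\<^bsub>V\<^esub> v = z \<ominus>\<^bsub>V\<^esub> z" using 2 v xV by (simp add: V.M.minus_eq V.M.r_neg)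
      then show ?thesis using 2 sub[OF *(4,4)] gW cl[OF v] by (simp add: W.M.minus_eq W.M.r_neg)
    next
      case 3
      then have q: "- q * N > 0" using *(1) by (simp add: mult_neg_pos)
      \<comment> \<open>A negative sign is absorbed by exchanging minuend and subtrahend.\<close>
      have "q \<odot>\<^bsub>V\<^esub> v = (- q * N) \<odot>\<^bsub>V\<^esub> (z \<ominus>\<^bsub>V\<^esub> x)" unfolding *(5) by (simp add: K)
      then have "extension (q \<odot>\<^bsub>V\<^esub> v) = (- q * N) \<odot>\<^bsub>W\<^esub> (g z \<ominus>\<^bsub>W\<^esub> g x)"
        using extension_eq[OF q *(4,2)] by simp
      also have "\<dots> = q \<odot>\<^bsub>W\<^esub> (N \<odot>\<^bsub>W\<^esub> (g x \<ominus>\<^bsub>W\<^esub> g z))" by (simp add: L)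
      finally show ?thesis using extension_eq[OF *(1,2,4)] *(5) by simp
    qed
  qed
  have add_join: "extension (v \<oplus>\<^bsub>V\<^esub> v') = extension v \<oplus>\<^bsub>W\<^esub> extension v'"
    "extension (vjoin V v v') = vjoin W (extension v) (extension v')"
    if v: "v \<in> carrier V" "v' \<in> carrier V" for v v'
  proof -
    obtain N x y z where *: "N > 0" "x \<in> carrier I\<^sub>V" "y \<in> carrier I\<^sub>V" "z \<in> carrier I\<^sub>V"
      "v = N \<odot>\<^bsub>V\<^esub> (x \<ominus>\<^bsub>V\<^esub> z)" "v' = N \<odot>\<^bsub>V\<^esub> (y \<ominus>\<^bsub>V\<^esub> z)"
      using common_unit_interval_form[OF V v] .
    have xV: "x \<in> carrier V" "y \<in> carrier V" "z \<in> carrier V" using * by simp_all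
    have gW: "g x \<in> carrier W" "g y \<in> carrier W" "g z \<in> carrier W" using *(2-4) g_closed' by blast+
    obtain K where K: "V.parametrization K x y z z" using V.ex_parametrization xV by metis
    obtain L where L: "W.parametrization L (g x) (g y) (g z) (g z)" using W.ex_parametrization gW by metis
    note K = K[unfolded V.parametrization_def] and L = L[unfolded W.parametrization_def]
    have ext: "extension v = N \<odot>\<^bsub>W\<^esub> (g x \<ominus>\<^bsub>W\<^esub> g z)" "extension v' = N \<odot>\<^bsub>W\<^esub> (g y \<ominus>\<^bsub>W\<^esub> g z)"
      unfolding *(5,6) using extension_eq * by blast+
    have mem: "(1 / 2) \<odot>\<^bsub>V\<^esub> x \<oplus>\<^bsub>V\<^esub> (1 / 2) \<odot>\<^bsub>V\<^esub> y \<in> carrier I\<^sub>V"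
      using convex_comb_mem[OF *(2,3), of "1 / 2" "1 / 2"] by simp
    have N2: "2 * N > 0" using *(1) by simp
    \<comment> \<open>\<open>x + y\<close> may leave the interval but the midpoint does not, hence
      the factor \<open>2 * N\<close>.\<close>
    have "v \<oplus>\<^bsub>V\<^esub> v' = (2 * N) \<odot>\<^bsub>V\<^esub> (((1 / 2) \<odot>\<^bsub>V\<^esub> x \<oplus>\<^bsub>V\<^esub> (1 / 2) \<odot>\<^bsub>V\<^esub> y) \<ominus>\<^bsub>V\<^esub> z)"
      unfolding *(5,6) by (simp add: K)
    then have "extension (v \<oplus>\<^bsub>V\<^esub> v')
      = (2 * N) \<odot>\<^bsub>W\<^esub> (((1 / 2) \<odot>\<^bsub>W\<^esub> g x \<oplus>\<^bsub>W\<^esub> (1 / 2) \<odot>\<^bsub>W\<^esub> g y) \<ominus>\<^bsub>W\<^esub> g z)"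
      using extension_eq[OF N2 mem *(4)] g_comb[OF *(2,3), of "1 / 2" "1 / 2"] by simp
    also have "\<dots> = N \<odot>\<^bsub>W\<^esub> (g x \<ominus>\<^bsub>W\<^esub> g z) \<oplus>\<^bsub>W\<^esub> N \<odot>\<^bsub>W\<^esub> (g y \<ominus>\<^bsub>W\<^esub> g z)" by (simp add: L)
    finally show "extension (v \<oplus>\<^bsub>V\<^esub> v') = extension v \<oplus>\<^bsub>W\<^esub> extension v'" using ext by simp
    \<comment> \<open>Over a common factor and subtrahend the join acts on the minuends only, by
      invariance under translation and positive scaling.\<close>
    have "vjoin V v v' = N \<odot>\<^bsub>V\<^esub> (vjoin V x y \<ominus>\<^bsub>V\<^esub> z)"
      unfolding *(5,6) using xV *(1) by (simp add: V.vjoin_smult V.M.minus_eq V.vjoin_add)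
    then have "extension (vjoin V v v') = N \<odot>\<^bsub>W\<^esub> (vjoin W (g x) (g y) \<ominus>\<^bsub>W\<^esub> g z)"
      using extension_eq[OF *(1) g_join(2)[OF *(2,3)] *(4)] g_join(1)[OF *(2,3)] by simp
    then show "extension (vjoin V v v') = vjoin W (extension v) (extension v')"
      unfolding ext using gW *(1) by (simp add: W.vjoin_smult W.M.minus_eq W.vjoin_add)
  qed
  have minus: "extension (v \<ominus>\<^bsub>V\<^esub> v') = extension v \<ominus>\<^bsub>W\<^esub> extension v'"
    if "v \<in> carrier V" "v' \<in> carrier V" for v v'
    using that add_join(1)[of v "\<ominus>\<^bsub>V\<^esub> v'"] smult[of v' "-1"] cl
    by (simp add: a_minus_def V.uminus_smult W.uminus_smult)
  have meet: "extension (vmeet V v v') = vmeet W (extension v) (extension v')"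
    if v: "v \<in> carrier V" "v' \<in> carrier V" for v v'
    using v cl add_join minus by (simp add: V.vmeet_eq_vjoin W.vmeet_eq_vjoin)
  have "mv_neg I\<^sub>V \<zero>\<^bsub>V\<^esub> = u\<^sub>V" "mv_neg I\<^sub>W \<zero>\<^bsub>W\<^esub> = u\<^sub>W"
    using V.unit_closed W.unit_closed by simp_all
  then have gu: "g u\<^sub>V = u\<^sub>W" using g_neg[of "\<zero>\<^bsub>V\<^esub>"] g_zero V.unit_nonneg by simp
  have "extension u\<^sub>V = u\<^sub>W"
    using sub[of u\<^sub>V "\<zero>\<^bsub>V\<^esub>"] gu g_zero V.unit_nonneg V.unit_closed W.unit_closed by simp
  then show ?thesis
    unfolding uqvl_hom_def using cl smult add_join meet by (auto simp: extension_def)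
qed

lemma extension_restrict: "restrict extension (carrier I\<^sub>V) = g"
proof
  fix x
  show "restrict extension (carrier I\<^sub>V) x = g x"
  proof (cases "x \<in> carrier I\<^sub>V")
    case True
    have "\<zero>\<^bsub>V\<^esub> \<in> carrier I\<^sub>V" using V.unit_nonneg by simp
    then have "extension (1 \<odot>\<^bsub>V\<^esub> (x \<ominus>\<^bsub>V\<^esub> \<zero>\<^bsub>V\<^esub>)) = 1 \<odot>\<^bsub>W\<^esub> (g x \<ominus>\<^bsub>W\<^esub> g \<zero>\<^bsub>V\<^esub>)"
      using extension_eq[OF _ True] by simp
    moreover have "x \<in> carrier V" "g x \<in> carrier W" using True g_closed' by (simp, blast)
    ultimately have "extension x = g x" by (simp add: g_zero)
    then show ?thesis using True by simp
  next
    case False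
    then have "restrict extension (carrier I\<^sub>V) x = undefined" unfolding restrict_def by (rule if_not_P)
    moreover have "g x = undefined" using g False unfolding dmv_hom_def PiE_def extensional_def by blast
    ultimately show ?thesis by simp
  qed
qed

end

end

lemma is_functor_Gamma_Q: "is_functor uQVL DMV (Gamma_Q :: ('a u_q_vec_lat, 'a \<Rightarrow> 'a, _, _) cat_functor)"
proof (intro is_functor.intro category_uQVL category_DMV is_functor_axioms.intro)
  fix X Y Z :: "'a u_q_vec_lat" and f g :: "'a \<Rightarrow> 'a"
  assume "X \<in> Ob uQVL"
  then have X: "unital_q_vector_lattice X" by (simp add: uQVL_def)
  then show "fobj Gamma_Q X \<in> Ob DMV"
    by (simp add: Gamma_Q_def DMV_def dmv_algebra_unit_interval)
  show "farr Gamma_Q X X (Ident uQVL X) = Ident DMV (fobj Gamma_Q X)"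
    using X by (auto simp: Gamma_Q_def DMV_def uQVL_def unit_interval_simps)
  assume "Y \<in> Ob uQVL" and f: "f \<in> Hom uQVL X Y"
  then have Y: "unital_q_vector_lattice Y" by (simp add: uQVL_def)
  have f': "restrict f (carrier (unit_interval X)) \<in> dmv_hom (unit_interval X) (unit_interval Y)"
    using uqvl_hom_restrict[OF X Y] f by (simp add: uQVL_def)
  then show "farr Gamma_Q X Y f \<in> Hom DMV (fobj Gamma_Q X) (fobj Gamma_Q Y)"
    by (simp add: Gamma_Q_def DMV_def)
  have "f x \<in> carrier (unit_interval Y)" if "x \<in> carrier (unit_interval X)" for x
    using f' that PiE_mem[of "restrict f (carrier (unit_interval X))" "carrier (unit_interval X)"
        "\<lambda>_. carrier (unit_interval Y)" x] by (simp add: dmv_hom_def)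
  moreover have "carrier (unit_interval X) \<subseteq> carrier X" using X by (auto simp: unit_interval_simps)
  ultimately show "farr Gamma_Q X Z (Comp uQVL X Y Z g f) = Comp DMV (fobj Gamma_Q X) (fobj Gamma_Q Y)
      (fobj Gamma_Q Z) (farr Gamma_Q Y Z g) (farr Gamma_Q X Y f)"
    by (auto simp: Gamma_Q_def DMV_def uQVL_def compose_def restrict_def fun_eq_iff)
qed

section \<open>Every DMV-algebra is a unit interval\<close>

context dmv_algebra
begin

text \<open>The parts \<open>\<delta> n \<one>\<^sub>A\<close> are pairwise distinct. If those for
  \<open>m < n\<close> agreed, the \<open>m\<close>-fold sum of
  \<open>\<delta> n \<one>\<^sub>A\<close> would be \<open>\<one>\<^sub>A\<close> and still
  orthogonal to \<open>\<delta> n \<one>\<^sub>A\<close>, forcing this part and then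
  \<open>\<one>\<^sub>A\<close> to vanish.\<close>

lemma infinite_carrier:
  assumes "\<one>\<^sub>A \<noteq> \<zero>\<^sub>A" shows "infinite (carrier A)"
proof -
  have ne: "\<delta> m \<one>\<^sub>A \<noteq> \<delta> n \<one>\<^sub>A" if "m \<ge> 1" "m < n" for m n
  proof
    assume eq: "\<delta> m \<one>\<^sub>A = \<delta> n \<one>\<^sub>A"
    have n: "n \<ge> 1" using that by simp
    have "mv_nsum A m (\<delta> n \<one>\<^sub>A) \<bottom> mv_nsum A 1 (\<delta> n \<one>\<^sub>A)"
      using that n exact_delta[of n] by (intro orth_nsum[of _ n]) simp_all
    moreover have "mv_nsum A m (\<delta> n \<one>\<^sub>A) = \<one>\<^sub>A" using that nsum_delta[of m "\<one>\<^sub>A"] by (simp add: eq)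
    ultimately have "\<delta> n \<one>\<^sub>A \<unlhd> \<zero>\<^sub>A" using n orth_sym[of "\<one>\<^sub>A" "\<delta> n \<one>\<^sub>A"] by (simp add: orth_def)
    then have "\<delta> n \<one>\<^sub>A = \<zero>\<^sub>A" using n by (simp add: le_zero_iff)
    then show False using nsum_delta[of n "\<one>\<^sub>A"] n assms by simp
  qed
  have "inj_on (\<lambda>n. \<delta> (Suc n) \<one>\<^sub>A) UNIV"
  proof (rule inj_onI)
    fix m n assume "\<delta> (Suc m) \<one>\<^sub>A = \<delta> (Suc n) \<one>\<^sub>A"
    then show "m = n" using ne[of "Suc m" "Suc n"] ne[of "Suc n" "Suc m"] 
      by (cases m n rule: linorder_cases) simp_all
  qed
  moreover have "range (\<lambda>n. \<delta> (Suc n) \<one>\<^sub>A) \<subseteq> carrier A" by auto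
  ultimately show ?thesis using infinite_iff_countable_subset by blast
qed

text \<open>Classes of formal combinations are represented by elements of the carrier type: a class is
  determined by a triple \<open>(N, a, b)\<close> with value \<open>N (a - b)\<close>, and the infinite carrier has as many
  elements as there are such triples.\<close>

lemma ex_encoding:
  "\<exists>c :: ('a \<Rightarrow> rat) \<Rightarrow> 'a. \<forall>\<phi> \<in> Fin. \<forall>\<psi> \<in> Fin. c \<phi> = c \<psi> \<longleftrightarrow> eqv \<phi> \<psi>"
proof (cases "\<one>\<^sub>A = \<zero>\<^sub>A")
  \<comment> \<open>The trivial algebra: all normal forms coincide, so there is only one class and a
    constant code suffices.\<close>
  case True
  have "x = \<zero>\<^sub>A" if "x \<in> carrier A" for x
    using le_unit[OF that] le_zero_iff[OF that] True by simp
  then have zero: "x = y" if "x \<in> carrier A" "y \<in> carrier A" for x y using that by metis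
  have "eqv \<phi> \<psi>" if \<phi>: "\<phi> \<in> Fin" "\<psi> \<in> Fin" for \<phi> \<psi>
  proof -
    have "\<exists>(N :: nat) b a. N > 0 \<and> b \<in> carrier A \<and> (\<forall>i \<in> {\<phi>, \<psi>}. a i \<in> carrier A \<and>
        eqv i (\<lambda>x. of_nat N * (single (a i) x - single b x)))"
      using \<phi> by (intro common_form) auto
    then obtain N :: nat and b a where N: "\<forall>i \<in> {\<phi>, \<psi>}. a i \<in> carrier A \<and>
        eqv i (\<lambda>x. of_nat N * (single (a i) x - single b x))"
      by blast
    then have "a \<phi> = a \<psi>" using zero by simp
    then have "eqv \<phi> (\<lambda>x. of_nat N * (single (a \<phi>) x - single b x))"
      "eqv \<psi> (\<lambda>x. of_nat N * (single (a \<phi>) x - single b x))" using N by simp_all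
    then show ?thesis using eqv_sym[of \<psi>] eqv_trans[of \<phi>] by simp
  qed
  then show ?thesis by (intro exI[of _ "\<lambda>_. undefined"]) simp
next
  case False
  then have inf: "infinite (carrier A)" by (rule infinite_carrier)
  then obtain k :: "nat \<Rightarrow> 'a" where k: "inj k" "range k \<subseteq> carrier A"
    unfolding infinite_iff_countable_subset by (elim exE conjE)
  have "\<exists>f. inj_on f (carrier A \<times> carrier A) \<and> f ` (carrier A \<times> carrier A) \<subseteq> carrier A"
    unfolding card_of_ordLeq
    using card_of_Times_same_infinite[OF inf] unfolding ordIso_iff_ordLeq by (rule conjunct1)
  then obtain f where f: "inj_on f (carrier A \<times> carrier A)" "f ` (carrier A \<times> carrier A) \<subseteq> carrier A"
    by (elim exE conjE)
  define rep where "rep \<phi> = (\<lambda>(N :: nat, a, b). a \<in> carrier A \<and> b \<in> carrier A \<and>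
    eqv \<phi> (\<lambda>x. of_nat N * (single a x - single b x)))" for \<phi>
  define t where "t \<phi> = (SOME p. rep \<phi> p)" for \<phi>
  have t: "rep \<phi> (t \<phi>)" if "\<phi> \<in> Fin" for \<phi>
  proof -
    have "\<exists>(N :: nat) b a. N > 0 \<and> b \<in> carrier A \<and> (\<forall>i \<in> {\<phi>}. a i \<in> carrier A \<and>
        eqv i (\<lambda>x. of_nat N * (single (a i) x - single b x)))"
      using that by (intro common_form) auto
    then obtain N :: nat and b a where "b \<in> carrier A" "\<forall>i \<in> {\<phi>}. a i \<in> carrier A \<and>
        eqv i (\<lambda>x. of_nat N * (single (a i) x - single b x))"
      by blast
    then have "rep \<phi> (N, a \<phi>, b)" by (simp add: rep_def)
    then show ?thesis unfolding t_def by (rule someI)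
  qed
  define c where "c \<phi> = (case t \<phi> of (N, a, b) \<Rightarrow> f (k N, f (a, b)))" for \<phi>
  have "c \<phi> = c \<psi> \<longleftrightarrow> eqv \<phi> \<psi>" if \<phi>: "\<phi> \<in> Fin" "\<psi> \<in> Fin" for \<phi> \<psi>
  proof
    assume "eqv \<phi> \<psi>"
    then have "eqv \<phi> \<chi> \<longleftrightarrow> eqv \<psi> \<chi>" for \<chi> using eqv_sym eqv_trans by blast
    \<comment> \<open>Equivalent combinations admit exactly the same triples, so the choice operator
      selects the same triple for both.\<close>
    then have "rep \<phi> = rep \<psi>" by (simp add: rep_def)
    then show "c \<phi> = c \<psi>" by (simp add: c_def t_def)
  next
    assume eq: "c \<phi> = c \<psi>"
    obtain N a b where 1: "t \<phi> = (N, a, b)" by (cases "t \<phi>")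
    obtain M a' b' where 2: "t \<psi> = (M, a', b')" by (cases "t \<psi>")
    have mem: "a \<in> carrier A" "b \<in> carrier A" "a' \<in> carrier A" "b' \<in> carrier A"
      and eqv: "eqv \<phi> (\<lambda>x. of_nat N * (single a x - single b x))"
        "eqv \<psi> (\<lambda>x. of_nat M * (single a' x - single b' x))"
      using t[OF \<phi>(1)] t[OF \<phi>(2)] by (simp_all add: 1 2 rep_def)
    have "f (k N, f (a, b)) = f (k M, f (a', b'))" using eq by (simp add: c_def 1 2)
    moreover have "f (a, b) \<in> carrier A" "f (a', b') \<in> carrier A" using f(2) mem by auto
    ultimately have "k N = k M \<and> f (a, b) = f (a', b')"
      using inj_onD[OF f(1), of "(k N, f (a, b))" "(k M, f (a', b'))"] k(2) by (simp add: image_subset_iff)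
    then have "N = M \<and> (a, b) = (a', b')"
      using inj_onD[OF f(1), of "(a, b)" "(a', b')"] k(1) mem by (simp add: inj_eq)
    then have "eqv \<psi> (\<lambda>x. of_nat N * (single a x - single b x))" using eqv(2) by simp
    then show "eqv \<phi> \<psi>" using eqv_trans[OF eqv(1)] eqv_sym by simp
  qed
  then show ?thesis by (intro exI[of _ c] ballI)
qed

section \<open>The vector lattice on the classes\<close>

definition cls :: "('a \<Rightarrow> rat) \<Rightarrow> 'a" where
  "cls = (SOME c. \<forall>\<phi> \<in> Fin. \<forall>\<psi> \<in> Fin. c \<phi> = c \<psi> \<longleftrightarrow> eqv \<phi> \<psi>)"

lemma cls_eq_iff: "\<lbrakk>\<phi> \<in> Fin; \<psi> \<in> Fin\<rbrakk> \<Longrightarrow> cls \<phi> = cls \<psi> \<longleftrightarrow> eqv \<phi> \<psi>"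
  using someI_ex[OF ex_encoding, folded cls_def] by simp

definition rep :: "'a \<Rightarrow> 'a \<Rightarrow> rat" where "rep v = inv_into Fin cls v"

lemma rep: "\<phi> \<in> Fin \<Longrightarrow> rep (cls \<phi>) \<in> Fin" "\<phi> \<in> Fin \<Longrightarrow> eqv (rep (cls \<phi>)) \<phi>"
proof -
  show *: "\<phi> \<in> Fin \<Longrightarrow> rep (cls \<phi>) \<in> Fin" by (simp add: rep_def inv_into_into)
  assume \<phi>: "\<phi> \<in> Fin"
  then have "cls (rep (cls \<phi>)) = cls \<phi>" by (simp add: rep_def f_inv_into_f)
  then show "eqv (rep (cls \<phi>)) \<phi>" using cls_eq_iff * \<phi> by blast
qed

text \<open>All operations and the order are computed on the representatives picked by
  \<open>rep\<close>; \<open>vlat_add\<close>, \<open>vlat_smult\<close> and \<open>vlat_le\<close>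
  show that any other representative may be used instead.\<close>

definition vlat :: "'a u_q_vec_lat" where
  "vlat = \<lparr>carrier = cls ` Fin, monoid.mult = (\<lambda>_ _. undefined), one = undefined,
    ring.zero = cls (\<lambda>x. 0), add = (\<lambda>v w. cls (\<lambda>x. rep v x + rep w x)),
    smult = (\<lambda>q v. cls (\<lambda>x. q * rep v x)), vle = (\<lambda>v w. pos (\<lambda>x. rep w x - rep v x)),
    vunit = cls (single \<one>\<^sub>A)\<rparr>"

lemma vlat_carrier: "carrier vlat = cls ` Fin"
  and vlat_zero: "\<zero>\<^bsub>vlat\<^esub> = cls (\<lambda>x. 0)"
  and vlat_unit: "vunit vlat = cls (single \<one>\<^sub>A)"
  by (simp_all add: vlat_def)

lemma vlat_add:
  assumes "\<phi> \<in> Fin" "\<psi> \<in> Fin"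
  shows "cls \<phi> \<oplus>\<^bsub>vlat\<^esub> cls \<psi> = cls (\<lambda>x. \<phi> x + \<psi> x)"
proof -
  have "eqv (\<lambda>x. rep (cls \<phi>) x + rep (cls \<psi>) x) (\<lambda>x. \<phi> x + \<psi> x)"
    using assms by (intro eqv_add rep)
  then show ?thesis
    using assms cls_eq_iff[OF Fin_add Fin_add] rep(1) by (simp add: vlat_def)
qed

lemma vlat_smult:
  assumes "\<phi> \<in> Fin" shows "q \<odot>\<^bsub>vlat\<^esub> cls \<phi> = cls (\<lambda>x. q * \<phi> x)"
proof -
  have "eqv (\<lambda>x. q * rep (cls \<phi>) x) (\<lambda>x. q * \<phi> x)" using assms by (intro eqv_scale rep)
  then show ?thesis
    using assms cls_eq_iff[OF Fin_scale Fin_scale] rep(1) by (simp add: vlat_def)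
qed

lemma pos_cong:
  assumes "eqv \<phi> \<phi>'" "eqv \<psi> \<psi>'" "pos (\<lambda>x. \<phi> x - \<psi> x)" shows "pos (\<lambda>x. \<phi>' x - \<psi>' x)"
proof -
  have "pos (\<lambda>x. \<phi>' x - \<phi> x)" "pos (\<lambda>x. \<psi> x - \<psi>' x)" using assms by (simp_all add: eqv_def)
  from pos_add[OF this] have "pos (\<lambda>x. (\<phi>' x - \<phi> x) + (\<psi> x - \<psi>' x))" by simp
  from pos_add[OF this assms(3)] show ?thesis by simp
qed

lemma vlat_le:
  assumes "\<phi> \<in> Fin" "\<psi> \<in> Fin"
  shows "cls \<phi> \<preceq>\<^bsub>vlat\<^esub> cls \<psi> \<longleftrightarrow> pos (\<lambda>x. \<psi> x - \<phi> x)"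
proof -
  note r = rep(2)[OF assms(1)] rep(2)[OF assms(2)]
  show ?thesis
    using pos_cong[OF r(2,1)] pos_cong[OF r(2,1)[THEN eqv_sym]] by (auto simp: vlat_def)
qed

lemma module_vlat: "module rat_ring vlat"
proof (rule moduleI)
  show "cring rat_ring" by (rule cring_rat_ring)
  show "abelian_group vlat"
  proof (rule abelian_groupI)
    fix v assume "v \<in> carrier vlat"
    then obtain \<phi> where \<phi>: "v = cls \<phi>" "\<phi> \<in> Fin" by (auto simp: vlat_carrier)
    then have "cls (\<lambda>x. (- 1) * \<phi> x) \<oplus>\<^bsub>vlat\<^esub> v = \<zero>\<^bsub>vlat\<^esub>" "cls (\<lambda>x. (- 1) * \<phi> x) \<in> carrier vlat"
      using Fin_scale[of \<phi> "- 1"] by (simp_all add: vlat_add vlat_zero vlat_carrier)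
    then show "\<exists>w \<in> carrier vlat. w \<oplus>\<^bsub>vlat\<^esub> v = \<zero>\<^bsub>vlat\<^esub>" by blast
  qed (auto simp: vlat_carrier vlat_zero vlat_add Fin_add Fin_0 algebra_simps)
qed (auto simp: vlat_carrier vlat_add vlat_smult Fin_add Fin_scale algebra_simps)

lemma Fin_form: "\<lbrakk>a \<in> carrier A; b \<in> carrier A\<rbrakk> \<Longrightarrow> (\<lambda>x. q * (single a x - single b x)) \<in> Fin"
  by (intro Fin_scale Fin_diff) simp_all

lemma common_form_vlat:
  assumes "finite S" "S \<subseteq> carrier vlat"
  shows "\<exists>(N :: nat) b a. N > 0 \<and> b \<in> carrier A \<and>
    (\<forall>v \<in> S. a v \<in> carrier A \<and> v = cls (\<lambda>x. of_nat N * (single (a v) x - single b x)))"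
proof -
  have "\<forall>v \<in> S. \<exists>\<phi>. \<phi> \<in> Fin \<and> cls \<phi> = v" using assms(2) by (auto simp: vlat_carrier)
  then obtain \<phi> where \<phi>: "\<forall>v \<in> S. \<phi> v \<in> Fin \<and> cls (\<phi> v) = v"
    using bchoice[of S "\<lambda>v \<phi>. \<phi> \<in> Fin \<and> cls \<phi> = v"] by blast
  have "\<exists>(N :: nat) b a. N > 0 \<and> b \<in> carrier A \<and> (\<forall>v \<in> S. a v \<in> carrier A \<and>
    eqv (\<phi> v) (\<lambda>x. of_nat N * (single (a v) x - single b x)))"
    using \<phi> by (intro common_form assms) simp
  then obtain N :: nat and b a where N: "N > 0" "b \<in> carrier A" "\<forall>v \<in> S. a v \<in> carrier A \<and>
    eqv (\<phi> v) (\<lambda>x. of_nat N * (single (a v) x - single b x))"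
    by blast
  have "v = cls (\<lambda>x. of_nat N * (single (a v) x - single b x))" if v: "v \<in> S" for v
  proof -
    have "cls (\<phi> v) = cls (\<lambda>x. of_nat N * (single (a v) x - single b x))"
      using N v \<phi> Fin_form by (subst cls_eq_iff) simp_all
    moreover have "cls (\<phi> v) = v" using \<phi> v by blast
    ultimately show ?thesis by (rule trans[OF sym, rotated])
  qed
  then show ?thesis using N by blast
qed

lemma vlat_form:
  assumes "v \<in> carrier vlat"
  obtains N :: nat and a b where "N > 0" "a \<in> carrier A" "b \<in> carrier A"
    "v = cls (\<lambda>x. of_nat N * (single a x - single b x))"
proof -
  have "{v} \<subseteq> carrier vlat" using assms by simp
  then obtain N :: nat and b a where "N > 0" "b \<in> carrier A"
    "\<forall>z \<in> {v}. a z \<in> carrier A \<and> z = cls (\<lambda>x. of_nat N * (single (a z) x - single b x))"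
    using common_form_vlat[of "{v}"] by blast
  then show ?thesis using that[of N "a v" b] by blast
qed

lemma vlat_form2:
  assumes "v \<in> carrier vlat" "w \<in> carrier vlat"
  obtains N :: nat and a b c where "N > 0" "a \<in> carrier A" "b \<in> carrier A" "c \<in> carrier A"
    "v = cls (\<lambda>x. of_nat N * (single a x - single c x))"
    "w = cls (\<lambda>x. of_nat N * (single b x - single c x))"
proof -
  have "{v, w} \<subseteq> carrier vlat" using assms by simp
  then obtain N :: nat and b a where "N > 0" "b \<in> carrier A"
    "\<forall>z \<in> {v, w}. a z \<in> carrier A \<and> z = cls (\<lambda>x. of_nat N * (single (a z) x - single b x))"
    using common_form_vlat[of "{v, w}"] by blast
  then show ?thesis using that[of N "a v" "a w" b] by blast
qed

text \<open>Collecting negative terms on opposite sides and dividing by \<open>N + M\<close>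
  expresses the comparison by two subconvex combinations, and \<open>pos_iff\<close> evaluates it
  inside \<open>A\<close>.\<close>

lemma form_le_iff:
  assumes "a \<in> carrier A" "b \<in> carrier A" "c \<in> carrier A" "d \<in> carrier A" "N > 0" "M > 0"
  shows "cls (\<lambda>x. N * (single a x - single b x)) \<preceq>\<^bsub>vlat\<^esub> cls (\<lambda>x. M * (single c x - single d x)) \<longleftrightarrow>
    smul (N / (N + M)) a \<boxplus> smul (M / (N + M)) d \<unlhd> smul (M / (N + M)) c \<boxplus> smul (N / (N + M)) b"
proof -
  define s t where "s = N / (N + M)" and "t = M / (N + M)"
  have st: "s \<ge> 0" "t \<ge> 0" "s + t \<le> 1" "t + s \<le> 1" "N = (N + M) * s" "M = (N + M) * t"
    using assms(5,6) by (simp_all add: s_def t_def add_divide_distrib[symmetric])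
  have "M * (single c x - single d x) - N * (single a x - single b x)
    = (N + M) * ((t * single c x + s * single b x) - (s * single a x + t * single d x))" for x
  proof -
    have "M * (single c x - single d x) - N * (single a x - single b x)
      = ((N + M) * t) * (single c x - single d x) - ((N + M) * s) * (single a x - single b x)"
      using st(5,6) by simp
    then show ?thesis by (simp add: algebra_simps)
  qed
  moreover have "subconvex (\<lambda>x. t * single c x + s * single b x)"
    "subconvex (\<lambda>x. s * single a x + t * single d x)"
    using assms st by (auto intro!: ev_comb(1))
  ultimately have "pos (\<lambda>x. M * (single c x - single d x) - N * (single a x - single b x)) \<longleftrightarrow>
      ev (\<lambda>x. s * single a x + t * single d x) \<unlhd> ev (\<lambda>x. t * single c x + s * single b x)"
    using assms(5,6) by (intro pos_iff[of "N + M"]) simp_all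
  also have "\<dots> \<longleftrightarrow> smul s a \<boxplus> smul t d \<unlhd> smul t c \<boxplus> smul s b"
    using assms st by (simp add: ev_comb(2))
  finally show ?thesis
    using assms by (simp add: vlat_le Fin_form s_def t_def)
qed

lemma form_le_iff_same:
  assumes "a \<in> carrier A" "b \<in> carrier A" "c \<in> carrier A" "N > 0"
  shows "cls (\<lambda>x. N * (single a x - single b x)) \<preceq>\<^bsub>vlat\<^esub> cls (\<lambda>x. N * (single c x - single b x))
    \<longleftrightarrow> a \<unlhd> c"
proof -
  have "pos (\<lambda>x. N * (single c x - single b x) - N * (single a x - single b x)) \<longleftrightarrow>
    ev (single a) \<unlhd> ev (single c)"
    using assms by (intro pos_iff[of N]) (simp_all add: algebra_simps)
  then show ?thesis using assms by (simp add: vlat_le Fin_form)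
qed

lemma vlat_le_trans:
  assumes "v \<in> carrier vlat" "w \<in> carrier vlat" "z \<in> carrier vlat" "v \<preceq>\<^bsub>vlat\<^esub> w" "w \<preceq>\<^bsub>vlat\<^esub> z"
  shows "v \<preceq>\<^bsub>vlat\<^esub> z"
proof -
  obtain \<phi> \<psi> \<chi> where *: "v = cls \<phi>" "\<phi> \<in> Fin" "w = cls \<psi>" "\<psi> \<in> Fin" "z = cls \<chi>" "\<chi> \<in> Fin"
    using assms(1-3) by (auto simp: vlat_carrier)
  then show ?thesis
    using assms(4,5) pos_add[of "\<lambda>x. \<psi> x - \<phi> x" "\<lambda>x. \<chi> x - \<psi> x" "\<lambda>x. \<chi> x - \<phi> x"] by (simp add: vlat_le)
qed

text \<open>With a common factor and subtrahend the join is formed on the minuends in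
  \<open>A\<close>. For minimality, \<open>form_le_iff\<close> turns upper bounds into inequalities
  in \<open>A\<close>, where \<open>smul_join_le\<close> applies.\<close>

lemma vlat_join_exists:
  assumes v: "v \<in> carrier vlat" "w \<in> carrier vlat"
  shows "\<exists>s \<in> carrier vlat. v \<preceq>\<^bsub>vlat\<^esub> s \<and> w \<preceq>\<^bsub>vlat\<^esub> s \<and>
    (\<forall>z \<in> carrier vlat. v \<preceq>\<^bsub>vlat\<^esub> z \<longrightarrow> w \<preceq>\<^bsub>vlat\<^esub> z \<longrightarrow> s \<preceq>\<^bsub>vlat\<^esub> z)"
proof -
  obtain N :: nat and av aw b where N: "N > 0" and a: "av \<in> carrier A" "aw \<in> carrier A"
    and b: "b \<in> carrier A"
    and vw: "v = cls (\<lambda>x. of_nat N * (single av x - single b x))"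
      "w = cls (\<lambda>x. of_nat N * (single aw x - single b x))"
    using vlat_form2[OF v] .
  have N0: "rat_of_nat N > 0" using N by simp
  define s where "s = cls (\<lambda>x. of_nat N * (single (join av aw) x - single b x))"
  have "v \<preceq>\<^bsub>vlat\<^esub> s" "w \<preceq>\<^bsub>vlat\<^esub> s"
    using form_le_iff_same[of av b "join av aw" "rat_of_nat N"]
      form_le_iff_same[of aw b "join av aw" "rat_of_nat N"]
      vw a b N0 join_ge by (simp_all add: s_def)
  moreover have "s \<in> carrier vlat" using a b Fin_form by (simp add: s_def vlat_carrier)
  moreover have "s \<preceq>\<^bsub>vlat\<^esub> z" if z: "z \<in> carrier vlat" "v \<preceq>\<^bsub>vlat\<^esub> z" "w \<preceq>\<^bsub>vlat\<^esub> z" for z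
  proof -
    obtain M :: nat and c d where M: "M > 0" and c: "c \<in> carrier A" and d: "d \<in> carrier A"
      and zc: "z = cls (\<lambda>x. of_nat M * (single c x - single d x))"
      using vlat_form[OF z(1)] .
    have M0: "rat_of_nat M > 0" using M by simp
    define p q where "p = rat_of_nat N / (rat_of_nat N + rat_of_nat M)"
      and "q = rat_of_nat M / (rat_of_nat N + rat_of_nat M)"
    have pq: "p \<ge> 0" "q \<ge> 0" "p + q \<le> 1" "p \<le> 1" "q \<le> 1"
      using N0 M0 by (simp_all add: p_def q_def add_divide_distrib[symmetric])
    let ?T = "smul q c \<boxplus> smul p b"
    have le: "cls (\<lambda>x. of_nat N * (single e x - single b x)) \<preceq>\<^bsub>vlat\<^esub> z \<longleftrightarrow>
      smul p e \<boxplus> smul q d \<unlhd> ?T" if "e \<in> carrier A" for e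
      using form_le_iff[OF that b c d N0 M0] zc by (simp add: p_def q_def)
    have 1: "smul p av \<boxplus> smul q d \<unlhd> ?T" "smul p aw \<boxplus> smul q d \<unlhd> ?T"
      using le[OF a(1)] le[OF a(2)] z(2,3) vw by simp_all
    have orth: "smul p e \<bottom> smul q d" if "e \<in> carrier A" for e
      using ev_comb(3)[of "single e" "single d" p q] that d pq by simp
    have T: "?T \<in> carrier A" using c b by simp
    have "smul q d \<unlhd> smul p av \<boxplus> smul q d" using a d by simp
    then have qd: "smul q d \<unlhd> ?T" using 1(1) le_trans[of "smul q d" "smul p av \<boxplus> smul q d" ?T] a d T by simp
    \<comment> \<open>\<open>?T\<close> is the exact sum of \<open>T'\<close> and
      \<open>smul q d\<close>. Cancelling \<open>smul q d\<close> isolates the scaled minuend, as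
      \<open>smul_join_le\<close> requires.\<close>
    define T' where "T' = diff ?T (smul q d)"
    have T': "T' \<in> carrier A" "?T = T' \<boxplus> smul q d" "T' \<bottom> smul q d"
      using le_imp_decomp[OF _ T qd] T d orth_diff[of "smul q d" ?T] orth_sym[of T' "smul q d"]
        plus_comm[of "smul q d" T'] by (simp_all add: T'_def)
    have "smul p e \<unlhd> T'" if "e \<in> carrier A" "smul p e \<boxplus> smul q d \<unlhd> ?T" for e
      using that plus_le_cancel[of "smul p e" T' "smul q d"] orth[OF that(1)] T' d by simp
    then have "smul p (join av aw) \<unlhd> T'"
      using 1 a T'(1) pq by (intro smul_join_le) simp_all
    then have "smul p (join av aw) \<boxplus> smul q d \<unlhd> ?T"
      unfolding T'(2) using a d T'(1) by (intro plus_mono_right) simp_all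
    then show ?thesis using le[of "join av aw"] a by (simp add: s_def)
  qed
  ultimately show ?thesis by blast
qed

lemma vlat_neg_le_iff:
  assumes "v \<in> carrier vlat" "w \<in> carrier vlat"
  shows "(- 1) \<odot>\<^bsub>vlat\<^esub> v \<preceq>\<^bsub>vlat\<^esub> w \<longleftrightarrow> (- 1) \<odot>\<^bsub>vlat\<^esub> w \<preceq>\<^bsub>vlat\<^esub> v"
proof -
  obtain \<phi> \<psi> where *: "v = cls \<phi>" "\<phi> \<in> Fin" "w = cls \<psi>" "\<psi> \<in> Fin"
    using assms by (auto simp: vlat_carrier)
  have "(\<lambda>x. - \<phi> x) \<in> Fin" "(\<lambda>x. - \<psi> x) \<in> Fin" using * Fin_scale[of \<phi> "-1"] Fin_scale[of \<psi> "-1"] by simp_all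
  then show ?thesis using * by (simp add: vlat_smult vlat_le add.commute)
qed

lemma vlat_smult_closed: "v \<in> carrier vlat \<Longrightarrow> q \<odot>\<^bsub>vlat\<^esub> v \<in> carrier vlat"
  by (auto simp: vlat_carrier vlat_smult Fin_scale)

lemma vlat_neg_neg: "v \<in> carrier vlat \<Longrightarrow> (- 1) \<odot>\<^bsub>vlat\<^esub> ((- 1) \<odot>\<^bsub>vlat\<^esub> v) = v"
  using Fin_scale[of _ "-1"] by (auto simp: vlat_carrier vlat_smult)

text \<open>Multiplication by -1 reverses the order and is an involution, so the negative of the
  join of the negatives is the meet.\<close>

lemma vlat_meet_exists:
  assumes v: "v \<in> carrier vlat" "w \<in> carrier vlat"
  shows "\<exists>s \<in> carrier vlat. s \<preceq>\<^bsub>vlat\<^esub> v \<and> s \<preceq>\<^bsub>vlat\<^esub> w \<and>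
    (\<forall>z \<in> carrier vlat. z \<preceq>\<^bsub>vlat\<^esub> v \<longrightarrow> z \<preceq>\<^bsub>vlat\<^esub> w \<longrightarrow> z \<preceq>\<^bsub>vlat\<^esub> s)"
proof -
  let ?n = "\<lambda>x. (- 1) \<odot>\<^bsub>vlat\<^esub> x"
  have cl: "?n x \<in> carrier vlat" if "x \<in> carrier vlat" for x using that by (rule vlat_smult_closed)
  obtain s where s: "s \<in> carrier vlat" "?n v \<preceq>\<^bsub>vlat\<^esub> s" "?n w \<preceq>\<^bsub>vlat\<^esub> s"
    "\<And>z. \<lbrakk>z \<in> carrier vlat; ?n v \<preceq>\<^bsub>vlat\<^esub> z; ?n w \<preceq>\<^bsub>vlat\<^esub> z\<rbrakk> \<Longrightarrow> s \<preceq>\<^bsub>vlat\<^esub> z"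
    using vlat_join_exists[OF cl[OF v(1)] cl[OF v(2)]] by blast
  have "?n s \<preceq>\<^bsub>vlat\<^esub> v" "?n s \<preceq>\<^bsub>vlat\<^esub> w" using s v vlat_neg_le_iff by blast+
  moreover have "z \<preceq>\<^bsub>vlat\<^esub> ?n s" if z: "z \<in> carrier vlat" "z \<preceq>\<^bsub>vlat\<^esub> v" "z \<preceq>\<^bsub>vlat\<^esub> w" for z
  proof -
    have "?n v \<preceq>\<^bsub>vlat\<^esub> ?n z" "?n w \<preceq>\<^bsub>vlat\<^esub> ?n z"
      using vlat_neg_le_iff[OF v(1) cl[OF z(1)]] vlat_neg_le_iff[OF v(2) cl[OF z(1)]] vlat_neg_neg z by simp_all
    then have "?n (?n s) \<preceq>\<^bsub>vlat\<^esub> ?n z" using s(1,4) cl z(1) vlat_neg_neg by simp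
    then show ?thesis using vlat_neg_le_iff[OF cl[OF s(1)] cl[OF z(1)]] vlat_neg_neg z(1) by simp
  qed
  ultimately show ?thesis using cl[OF s(1)] by blast
qed

lemma lattice_vlat: "lattice (vorder vlat)"
proof -
  have "partial_order (vorder vlat)"
  proof (unfold_locales)
    fix v w z assume v: "v \<in> carrier (vorder vlat)" "w \<in> carrier (vorder vlat)" "z \<in> carrier (vorder vlat)"
      "v \<sqsubseteq>\<^bsub>vorder vlat\<^esub> w" "w \<sqsubseteq>\<^bsub>vorder vlat\<^esub> z"
    then show "v \<sqsubseteq>\<^bsub>vorder vlat\<^esub> z" using vlat_le_trans[of v w z] by (simp add: vorder_def)
  qed (auto simp: vorder_def vlat_carrier vlat_le cls_eq_iff eqv_def pos_0)
  then show ?thesis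
  proof (intro lattice.intro upper_semilattice.intro lower_semilattice.intro
      upper_semilattice_axioms.intro lower_semilattice_axioms.intro)
    fix v w assume "v \<in> carrier (vorder vlat)" "w \<in> carrier (vorder vlat)"
    then have v: "v \<in> carrier vlat" "w \<in> carrier vlat" by (simp_all add: vorder_def)
    obtain s where "s \<in> carrier vlat" "v \<preceq>\<^bsub>vlat\<^esub> s" "w \<preceq>\<^bsub>vlat\<^esub> s"
      "\<And>z. \<lbrakk>z \<in> carrier vlat; v \<preceq>\<^bsub>vlat\<^esub> z; w \<preceq>\<^bsub>vlat\<^esub> z\<rbrakk> \<Longrightarrow> s \<preceq>\<^bsub>vlat\<^esub> z"
      using vlat_join_exists[OF v] by blast
    then have "least (vorder vlat) s (Upper (vorder vlat) {v, w})"
      using v by (simp add: least_def Upper_def vorder_def)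
    then show "\<exists>s. least (vorder vlat) s (Upper (vorder vlat) {v, w})" ..
    obtain s where "s \<in> carrier vlat" "s \<preceq>\<^bsub>vlat\<^esub> v" "s \<preceq>\<^bsub>vlat\<^esub> w"
      "\<And>z. \<lbrakk>z \<in> carrier vlat; z \<preceq>\<^bsub>vlat\<^esub> v; z \<preceq>\<^bsub>vlat\<^esub> w\<rbrakk> \<Longrightarrow> z \<preceq>\<^bsub>vlat\<^esub> s"
      using vlat_meet_exists[OF v] by blast
    then have "greatest (vorder vlat) s (Lower (vorder vlat) {v, w})"
      using v by (simp add: greatest_def Lower_def vorder_def)
    then show "\<exists>s. greatest (vorder vlat) s (Lower (vorder vlat) {v, w})" ..
  qed
qed

lemma q_vector_lattice_vlat: "q_vector_lattice vlat"
proof (intro q_vector_lattice.intro module_vlat lattice_vlat)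
  show "x \<oplus>\<^bsub>vlat\<^esub> z \<preceq>\<^bsub>vlat\<^esub> y \<oplus>\<^bsub>vlat\<^esub> z"
    if "x \<in> carrier vlat" "y \<in> carrier vlat" "z \<in> carrier vlat" "x \<preceq>\<^bsub>vlat\<^esub> y" for x y z
    using that by (auto simp: vlat_carrier vlat_add vlat_le Fin_add)
  show "\<zero>\<^bsub>vlat\<^esub> \<preceq>\<^bsub>vlat\<^esub> q \<odot>\<^bsub>vlat\<^esub> x"
    if x: "x \<in> carrier vlat" "0 \<le> q" "\<zero>\<^bsub>vlat\<^esub> \<preceq>\<^bsub>vlat\<^esub> x" for q x
  proof -
    obtain \<phi> where \<phi>: "x = cls \<phi>" "\<phi> \<in> Fin" using x(1) by (auto simp: vlat_carrier)
    then show ?thesis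
      using x pos_scale[of \<phi> q "\<lambda>x. q * \<phi> x"] by (simp add: vlat_zero vlat_smult vlat_le Fin_0 Fin_scale)
  qed
qed

lemma unital_q_vector_lattice_vlat: "unital_q_vector_lattice vlat"
proof (intro unital_q_vector_lattice.intro q_vector_lattice_vlat unital_q_vector_lattice_axioms.intro)
  interpret V: q_vector_lattice vlat by (rule q_vector_lattice_vlat)
  show "vunit vlat \<in> carrier vlat" by (simp add: vlat_unit vlat_carrier)
  have "pos (single \<one>\<^sub>A)" by (rule posI[of 1 "single \<one>\<^sub>A" "\<lambda>x. 0"]) simp_all
  then show "\<zero>\<^bsub>vlat\<^esub> \<preceq>\<^bsub>vlat\<^esub> vunit vlat" by (simp add: vlat_zero vlat_unit vlat_le Fin_0)
  fix v assume v: "v \<in> carrier vlat"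
  obtain N :: nat and a b where N: "N > 0" and a: "a \<in> carrier A" and b: "b \<in> carrier A"
    and va: "v = cls (\<lambda>x. of_nat N * (single a x - single b x))"
    using vlat_form[OF v] .
  have N0: "rat_of_nat N > 0" using N by simp
  have u: "rat_of_nat N \<odot>\<^bsub>vlat\<^esub> vunit vlat = cls (\<lambda>x. rat_of_nat N * single \<one>\<^sub>A x)"
    by (simp add: vlat_unit vlat_smult)
  have p: "pos (\<lambda>x. rat_of_nat N * single \<one>\<^sub>A x - rat_of_nat N * (single c x - single d x))"
    if c: "c \<in> carrier A" "d \<in> carrier A" for c d
  proof -
    \<comment> \<open>The halves keep the total weight at most 1, and the factor
      \<open>2 * N\<close> compensates for them. The term with coefficient 0 only brings
      \<open>?\<beta>\<close> into the shape of \<open>ev_comb\<close>.\<close>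
    let ?\<alpha> = "\<lambda>x. (1 / 2) * single \<one>\<^sub>A x + (1 / 2) * single d x"
    let ?\<beta> = "\<lambda>x. (1 / 2) * single c x + 0 * single d x"
    have "smul (1 / 2) c \<boxplus> smul 0 d \<unlhd> smul (1 / 2) \<one>\<^sub>A \<boxplus> smul (1 / 2) d"
      using c smul_le_iff by (intro plus_mono) simp_all
    moreover have "ev ?\<alpha> = smul (1 / 2) \<one>\<^sub>A \<boxplus> smul (1 / 2) d" "ev ?\<beta> = smul (1 / 2) c \<boxplus> smul 0 d"
      using c by (intro ev_comb(2)[THEN trans]; simp)+
    ultimately have le: "ev ?\<beta> \<unlhd> ev ?\<alpha>" by simp
    have "subconvex ?\<alpha>" "subconvex ?\<beta>" using c by (intro ev_comb(1); simp)+
    then show ?thesis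
      using le N0 by (intro posI[of "2 * rat_of_nat N" ?\<alpha> ?\<beta>]) (simp_all add: algebra_simps)
  qed
  have 1: "v \<preceq>\<^bsub>vlat\<^esub> rat_of_nat N \<odot>\<^bsub>vlat\<^esub> vunit vlat"
    unfolding u using p[OF a b] a b by (subst va) (simp add: vlat_le Fin_form Fin_scale)
  have "\<ominus>\<^bsub>vlat\<^esub> v = cls (\<lambda>x. of_nat N * (single b x - single a x))"
    using v Fin_form[OF a b] Fin_form[OF b a]
    by (simp add: V.uminus_smult) (subst va, simp add: vlat_smult algebra_simps)
  then have 2: "\<ominus>\<^bsub>vlat\<^esub> v \<preceq>\<^bsub>vlat\<^esub> rat_of_nat N \<odot>\<^bsub>vlat\<^esub> vunit vlat"
    unfolding u using p[OF b a] a b by (simp add: vlat_le Fin_form Fin_scale)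
  have "vabs vlat v \<preceq>\<^bsub>vlat\<^esub> rat_of_nat N \<odot>\<^bsub>vlat\<^esub> vunit vlat"
    unfolding vabs_def using 1 2 v \<open>vunit vlat \<in> carrier vlat\<close> by (intro V.vjoin_least) simp_all
  then show "\<exists>n::nat. vabs vlat v \<preceq>\<^bsub>vlat\<^esub> rat_of_nat n \<odot>\<^bsub>vlat\<^esub> vunit vlat" ..
qed

section \<open>Identification of \<open>A\<close> with the unit interval of
  \<open>vlat\<close>\<close>

lemma ev_scale_single:
  assumes "d \<in> carrier A" "0 \<le> q" "q \<le> 1"
  shows "subconvex (\<lambda>x. q * single d x)" "ev (\<lambda>x. q * single d x) = smul q d"
  using ev_comb(1,2)[of "single d" "\<lambda>x. 0" q 0] assms by simp_all

lemma vlat_single_le_iff: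
  assumes "a \<in> carrier A" "b \<in> carrier A"
  shows "cls (single a) \<preceq>\<^bsub>vlat\<^esub> cls (single b) \<longleftrightarrow> a \<unlhd> b"
proof -
  have "pos (\<lambda>x. single b x - single a x) \<longleftrightarrow> ev (single a) \<unlhd> ev (single b)"
    using assms by (intro pos_iff[of 1]) simp_all
  then show ?thesis using assms by (simp add: vlat_le)
qed

text \<open>The formal sum of two generators has weight 2 and cannot be evaluated. Its half can,
  with value half of \<open>a \<boxplus> b\<close> by orthogonality; the resulting equivalence is
  then doubled.\<close>

lemma cls_single_plus:
  assumes "a \<in> carrier A" "b \<in> carrier A" "a \<bottom> b"
  shows "cls (single (a \<boxplus> b)) = cls (single a) \<oplus>\<^bsub>vlat\<^esub> cls (single b)"
proof -
  let ?h = "\<lambda>x. (1 / 2) * single a x + (1 / 2) * single b x"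
  have "subconvex ?h" "ev ?h = smul (1 / 2) a \<boxplus> smul (1 / 2) b"
    using ev_comb(1,2)[of "single a" "single b" "1 / 2" "1 / 2"] assms by simp_all
  moreover have "smul (1 / 2) (a \<boxplus> b) = smul (1 / 2) a \<boxplus> smul (1 / 2) b"
    using assms by (intro smul_plus) simp_all
  ultimately have "eqv (\<lambda>x. (1 / 2) * single (a \<boxplus> b) x) ?h"
    using assms ev_scale_single[of "a \<boxplus> b" "1 / 2"] eqv_subconvex by simp
  then have "eqv (\<lambda>x. 2 * ((1 / 2) * single (a \<boxplus> b) x)) (\<lambda>x. 2 * ?h x)" by (rule eqv_scale)
  then have "eqv (single (a \<boxplus> b)) (\<lambda>x. single a x + single b x)" by (simp add: algebra_simps)
  then show ?thesis using assms cls_eq_iff[of "single (a \<boxplus> b)"] Fin_add by (simp add: vlat_add)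
qed

lemma cls_single_zero: "cls (single \<zero>\<^sub>A) = \<zero>\<^bsub>vlat\<^esub>"
  using cls_eq_iff[of "single \<zero>\<^sub>A" "\<lambda>x. 0"] eqv_subconvex[of "single \<zero>\<^sub>A" "\<lambda>x. 0"] Fin_0
  by (simp add: vlat_zero)

lemma cls_single_delta:
  assumes "n \<ge> 1" "a \<in> carrier A"
  shows "cls (single (\<delta> n a)) = (1 / rat_of_nat n) \<odot>\<^bsub>vlat\<^esub> cls (single a)"
proof -
  let ?h = "\<lambda>x. (1 / rat_of_nat n) * single a x"
  have "subconvex ?h" "ev ?h = \<delta> n a"
    using ev_scale_single[of a "1 / rat_of_nat n"] assms smul_delta by simp_all
  then have "eqv (single (\<delta> n a)) ?h" using assms eqv_subconvex by simp
  moreover have "?h \<in> Fin" using assms by (intro Fin_scale) simp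
  ultimately have "cls (single (\<delta> n a)) = cls ?h" using assms cls_eq_iff by simp
  then show ?thesis using assms by (simp add: vlat_smult)
qed

interpretation V: unital_q_vector_lattice vlat by (rule unital_q_vector_lattice_vlat)

lemma cls_single_closed [simp]: "a \<in> carrier A \<Longrightarrow> cls (single a) \<in> carrier vlat"
  by (simp add: vlat_carrier)

lemma cls_single_mem: "a \<in> carrier A \<Longrightarrow> cls (single a) \<in> carrier (unit_interval vlat)"
  using vlat_single_le_iff[of "\<zero>\<^sub>A" a] vlat_single_le_iff[of a "\<one>\<^sub>A"]
  by (simp add: unit_interval_simps[OF unital_q_vector_lattice_vlat] cls_single_zero vlat_unit)

text \<open>For \<open>v = N (a - b)\<close>, nonnegativity gives \<open>b \<unlhd> a\<close>, so
  \<open>v = N d\<close> with \<open>d\<close> the complement of \<open>b\<close> in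
  \<open>a\<close>. That \<open>v\<close> is at most the unit makes a suitable multiple of a part of
  \<open>d\<close> exact in \<open>A\<close>, and this multiple represents \<open>v\<close>.\<close>

lemma unit_interval_vlat_cases:
  assumes "v \<in> carrier (unit_interval vlat)"
  obtains c where "c \<in> carrier A" "v = cls (single c)"
proof -
  have v: "v \<in> carrier vlat" "\<zero>\<^bsub>vlat\<^esub> \<preceq>\<^bsub>vlat\<^esub> v" "v \<preceq>\<^bsub>vlat\<^esub> vunit vlat"
    using assms by (simp_all add: unit_interval_simps[OF unital_q_vector_lattice_vlat])
  obtain N :: nat and a b where N: "N > 0" and a: "a \<in> carrier A" and b: "b \<in> carrier A"
    and va: "v = cls (\<lambda>x. of_nat N * (single a x - single b x))"
    using vlat_form[OF v(1)] .
  have N0: "rat_of_nat N > 0" using N by simp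
  have "pos (\<lambda>x. of_nat N * (single a x - single b x))"
    using v(2) a b Fin_0 Fin_form[OF a b] by (simp add: va vlat_zero vlat_le)
  then have "b \<unlhd> a" using posD[OF _ N0, of _ "single a" "single b"] a b by simp
  define d where "d = diff a b"
  have d: "d \<in> carrier A" "a = b \<boxplus> d" "b \<bottom> d"
    using a b le_imp_decomp[OF b a \<open>b \<unlhd> a\<close>] by (simp_all add: d_def)
  have "cls (single a) = cls (\<lambda>x. single b x + single d x)"
    using cls_single_plus[OF b d(1,3)] d b by (simp add: vlat_add)
  then have "eqv (single a) (\<lambda>x. single b x + single d x)"
    using cls_eq_iff[of "single a" "\<lambda>x. single b x + single d x"] a b d(1) Fin_add by simp
  then have "eqv (\<lambda>x. single a x + (- 1) * single b x) (\<lambda>x. (single b x + single d x) + (- 1) * single b x)"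
    by (rule eqv_add) simp
  then have "eqv (\<lambda>x. of_nat N * (single a x + (- 1) * single b x))
      (\<lambda>x. of_nat N * ((single b x + single d x) + (- 1) * single b x))" by (rule eqv_scale)
  then have "eqv (\<lambda>x. of_nat N * (single a x - single b x)) (\<lambda>x. of_nat N * single d x)" by simp
  moreover have Nd: "(\<lambda>x. of_nat N * single d x) \<in> Fin" using d(1) by (intro Fin_scale) simp
  ultimately have vd: "v = cls (\<lambda>x. of_nat N * single d x)"
    using cls_eq_iff[OF Fin_form[OF a b] Nd] by (simp add: va)
  \<comment> \<open>Chosen so that \<open>N d = (N + 1) (q d)\<close> with \<open>q \<le> 1\<close>:
    the bound by the unit becomes \<open>q d \<unlhd> \<delta> (N + 1) \<one>\<^sub>A\<close>, which
    makes the sum of \<open>N + 1\<close> copies of \<open>q d\<close> exact.\<close>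
  define q where "q = rat_of_nat N / rat_of_nat (N + 1)"
  have q: "0 \<le> q" "q \<le> 1" "rat_of_nat N = rat_of_nat (N + 1) * q"
    by (simp_all add: q_def)
  define t where "t = smul q d"
  have t: "t \<in> carrier A" using d(1) by (simp add: t_def)
  have "pos (\<lambda>x. single \<one>\<^sub>A x - of_nat N * single d x)"
    using v(3) Nd by (simp add: vd vlat_unit vlat_le)
  moreover have "single \<one>\<^sub>A x - of_nat N * single d x
    = rat_of_nat (N + 1) * ((1 / rat_of_nat (N + 1)) * single \<one>\<^sub>A x - q * single d x)" for x
    unfolding q(3) by (simp add: right_diff_distrib del: of_nat_add)
  moreover have "subconvex (\<lambda>x. (1 / rat_of_nat (N + 1)) * single \<one>\<^sub>A x)" "subconvex (\<lambda>x. q * single d x)"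
    using ev_scale_single(1)[of "\<one>\<^sub>A" "1 / rat_of_nat (N + 1)"] ev_scale_single(1)[of d q] q(1,2) d(1)
    by simp_all
  moreover have "rat_of_nat (N + 1) > 0" by simp
  ultimately have "ev (\<lambda>x. q * single d x) \<unlhd> ev (\<lambda>x. (1 / rat_of_nat (N + 1)) * single \<one>\<^sub>A x)"
    using posD by blast
  then have "t \<unlhd> smul (1 / rat_of_nat (N + 1)) \<one>\<^sub>A"
    using ev_scale_single(2)[of d q] ev_scale_single(2)[of "\<one>\<^sub>A" "1 / rat_of_nat (N + 1)"] q(1,2) d(1)
    by (simp add: t_def)
  then have "t \<unlhd> \<delta> (N + 1) \<one>\<^sub>A" using smul_delta[of "N + 1" "\<one>\<^sub>A"] by simp
  define c where "c = mv_nsum A (N + 1) t"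
  have c: "c \<in> carrier A" "\<delta> (N + 1) c = t"
    using t le_delta_unit[of "N + 1" t] \<open>t \<unlhd> \<delta> (N + 1) \<one>\<^sub>A\<close> by (simp_all add: c_def)
  let ?h = "\<lambda>x. (1 / rat_of_nat (N + 1)) * single c x"
  have "subconvex ?h" "ev ?h = t"
    using ev_scale_single[of c "1 / rat_of_nat (N + 1)"] smul_delta[of "N + 1" c] c by simp_all
  then have "eqv ?h (\<lambda>x. q * single d x)"
    using eqv_subconvex ev_scale_single[OF d(1) q(1,2)] by (simp add: t_def)
  then have "eqv (\<lambda>x. rat_of_nat (N + 1) * ?h x) (\<lambda>x. rat_of_nat (N + 1) * (q * single d x))"
    by (rule eqv_scale)
  moreover have "(\<lambda>x. rat_of_nat (N + 1) * ?h x) = single c"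
    by (simp add: fun_eq_iff del: of_nat_add)
  moreover have "(\<lambda>x. rat_of_nat (N + 1) * (q * single d x)) = (\<lambda>x. of_nat N * single d x)"
    unfolding q(3) by (simp add: mult.assoc)
  ultimately have "eqv (single c) (\<lambda>x. of_nat N * single d x)" by simp
  then have "v = cls (single c)" using cls_eq_iff[OF single_Fin[OF c(1)] Nd] vd by simp
  then show ?thesis using that c(1) by blast
qed

text \<open>\<open>a\<close> and \<open>neg a\<close> form an exact sum with value
  \<open>\<one>\<^sub>A\<close>, so additivity on exact sums gives the complement.\<close>

lemma cls_single_neg:
  assumes "a \<in> carrier A"
  shows "cls (single (neg a)) = vunit vlat \<ominus>\<^bsub>vlat\<^esub> cls (single a)"
proof -
  have "a \<bottom> neg a" using assms by (simp add: orth_def)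
  then have u: "vunit vlat = cls (single a) \<oplus>\<^bsub>vlat\<^esub> cls (single (neg a))"
    unfolding vlat_unit using cls_single_plus[of a "neg a"] assms
    by (simp add: plus_comm[of a "neg a"])
  have cl: "cls (single a) \<in> carrier vlat" "cls (single (neg a)) \<in> carrier vlat" using assms by simp_all
  define v w where "v = cls (single a)" and "w = cls (single (neg a))"
  have vw: "v \<in> carrier vlat" "w \<in> carrier vlat" using cl by (simp_all add: v_def w_def)
  obtain L where L: "V.parametrization L v w w w" using V.ex_parametrization[OF vw vw(2) vw(2)] .
  have "w = (v \<oplus>\<^bsub>vlat\<^esub> w) \<ominus>\<^bsub>vlat\<^esub> v" by (simp add: L[unfolded V.parametrization_def])
  then show ?thesis unfolding u v_def w_def .
qed

text \<open>Halving makes the right side subconvex, so the comparison descends to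
  \<open>\<delta> 2 c \<unlhd> \<delta> 2 x \<boxplus> \<delta> 2 y\<close>. Doubling inside
  \<open>A\<close> is monotone and reintroduces the truncation.\<close>

lemma cls_single_le_plus:
  assumes "x \<in> carrier A" "y \<in> carrier A" "c \<in> carrier A"
    and "cls (single c) \<preceq>\<^bsub>vlat\<^esub> cls (single x) \<oplus>\<^bsub>vlat\<^esub> cls (single y)"
  shows "c \<unlhd> x \<boxplus> y"
proof -
  let ?h = "\<lambda>z. (1 / 2) * single x z + (1 / 2) * single y z"
  have pos: "pos (\<lambda>z. single x z + single y z - single c z)"
    using assms Fin_add by (simp add: vlat_add vlat_le)
  have eq: "single x z + single y z - single c z = 2 * (?h z - (1 / 2) * single c z)" for z
    by simp
  have h: "subconvex ?h" "subconvex (\<lambda>z. (1 / 2) * single c z)"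
    "ev ?h = smul (1 / 2) x \<boxplus> smul (1 / 2) y" "ev (\<lambda>z. (1 / 2) * single c z) = smul (1 / 2) c"
    using ev_comb(1,2)[of "single x" "single y" "1 / 2" "1 / 2"] ev_scale_single[of c "1 / 2"] assms
    by simp_all
  have "ev (\<lambda>z. (1 / 2) * single c z) \<unlhd> ev ?h" by (rule posD[OF pos _ h(1,2) eq]) simp
  then have "\<delta> 2 c \<unlhd> \<delta> 2 x \<boxplus> \<delta> 2 y"
    unfolding h(3,4) using assms smul_delta[of 2] by simp
  then have "mv_nsum A 2 (\<delta> 2 c) \<unlhd> mv_nsum A 2 (\<delta> 2 x \<boxplus> \<delta> 2 y)"
    using assms by (intro nsum_mono) simp_all
  then show ?thesis using assms by (simp add: nsum_plus)
qed

lemma cls_single_oplus: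
  assumes x: "x \<in> carrier A" "y \<in> carrier A"
  shows "cls (single (x \<boxplus> y)) = vmeet vlat (vunit vlat) (cls (single x) \<oplus>\<^bsub>vlat\<^esub> cls (single y))"
proof (rule sym, rule V.vmeet_eqI)
  show "cls (single (x \<boxplus> y)) \<preceq>\<^bsub>vlat\<^esub> vunit vlat"
    using x vlat_single_le_iff[of "x \<boxplus> y" "\<one>\<^sub>A"] by (simp add: vlat_unit)
  \<comment> \<open>The truncated sum is rewritten as an exact sum of \<open>x\<close> with some
    \<open>d \<unlhd> y\<close>, to which \<open>cls_single_plus\<close> applies.\<close>
  define d where "d = diff (x \<boxplus> y) x"
  have d: "d \<in> carrier A" "x \<boxplus> y = x \<boxplus> d" "x \<bottom> d" "d \<unlhd> y"
    using x le_imp_decomp[of x "x \<boxplus> y"] by (simp_all add: d_def diff_le_iff)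
  have "cls (single (x \<boxplus> y)) = cls (single x) \<oplus>\<^bsub>vlat\<^esub> cls (single d)"
    unfolding d(2) using x d by (intro cls_single_plus)
  also have "\<dots> \<preceq>\<^bsub>vlat\<^esub> cls (single x) \<oplus>\<^bsub>vlat\<^esub> cls (single y)"
    using x d vlat_single_le_iff by (intro V.vle_add_mono) simp_all
  finally show "cls (single (x \<boxplus> y)) \<preceq>\<^bsub>vlat\<^esub> cls (single x) \<oplus>\<^bsub>vlat\<^esub> cls (single y)" .
next
  fix w assume w: "w \<in> carrier vlat" "w \<preceq>\<^bsub>vlat\<^esub> vunit vlat"
    "w \<preceq>\<^bsub>vlat\<^esub> cls (single x) \<oplus>\<^bsub>vlat\<^esub> cls (single y)"
  \<comment> \<open>A lower bound \<open>w\<close> need not be nonnegative. Its join with zero is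
    still a lower bound and lies in the unit interval, so it comes from an element of
    \<open>A\<close>.\<close>
  define z where "z = vjoin vlat w \<zero>\<^bsub>vlat\<^esub>"
  have z: "z \<in> carrier vlat" "w \<preceq>\<^bsub>vlat\<^esub> z" "\<zero>\<^bsub>vlat\<^esub> \<preceq>\<^bsub>vlat\<^esub> z"
    using w V.vjoin_ge by (simp_all add: z_def)
  have nn: "\<zero>\<^bsub>vlat\<^esub> \<preceq>\<^bsub>vlat\<^esub> cls (single x)" "\<zero>\<^bsub>vlat\<^esub> \<preceq>\<^bsub>vlat\<^esub> cls (single y)"
    using x vlat_single_le_iff[of "\<zero>\<^sub>A"] by (simp_all add: cls_single_zero)
  have "z \<preceq>\<^bsub>vlat\<^esub> vunit vlat"
    unfolding z_def using w V.unit_nonneg V.unit_closed by (intro V.vjoin_least) simp_all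
  then have "z \<in> carrier (unit_interval vlat)"
    using z by (simp add: unit_interval_simps[OF unital_q_vector_lattice_vlat])
  then obtain c where c: "c \<in> carrier A" "z = cls (single c)" by (rule unit_interval_vlat_cases)
  have "z \<preceq>\<^bsub>vlat\<^esub> cls (single x) \<oplus>\<^bsub>vlat\<^esub> cls (single y)"
    unfolding z_def using w x nn V.nonneg_add by (intro V.vjoin_least) simp_all
  then have "c \<unlhd> x \<boxplus> y" using c x by (intro cls_single_le_plus) simp_all
  then have "z \<preceq>\<^bsub>vlat\<^esub> cls (single (x \<boxplus> y))" using c x vlat_single_le_iff by simp
  then show "w \<preceq>\<^bsub>vlat\<^esub> cls (single (x \<boxplus> y))" using V.vle_trans[OF z(2)] w z x by simp
qed (use x V.unit_closed in simp_all)

end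

text \<open>The inverse map is the one delivered: the canonical map runs from \<open>A\<close> to
  the interval of \<open>vlat\<close>, whereas essential surjectivity asks for an isomorphism in the
  opposite direction.\<close>

lemma is_iso_of_bij_dmv_hom:
  fixes A B :: "'a dmv_alg"
  assumes A: "dmv_algebra A" and B: "dmv_algebra B"
    and f: "f \<in> dmv_hom A B" "bij_betw f (carrier A) (carrier B)"
  shows "\<exists>g. is_iso DMV B A g"
proof -
  interpret A: dmv_algebra A by (rule A)
  interpret B: dmv_algebra B by (rule B)
  define g where "g = restrict (inv_into (carrier A) f) (carrier B)"
  have fcl: "f x \<in> carrier B" if "x \<in> carrier A" for x using f(1) that by (auto simp: dmv_hom_def)
  have gcl: "g y \<in> carrier A" if "y \<in> carrier B" for y
    using that f(2) by (auto simp: g_def bij_betw_def intro: inv_into_into)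
  have gf: "g (f x) = x" if "x \<in> carrier A" for x
    using that f(2) fcl by (simp add: g_def bij_betw_def inv_into_f_f)
  have fg: "f (g y) = y" if "y \<in> carrier B" for y
    using that f(2) by (simp add: g_def bij_betw_def f_inv_into_f)
  have hom: "f (x \<boxplus>\<^bsub>A\<^esub> y) = f x \<boxplus>\<^bsub>B\<^esub> f y" "f (mv_neg A x) = mv_neg B (f x)"
    "f (mv_zero A) = mv_zero B" "n \<ge> 1 \<Longrightarrow> f (dmv_delta A n x) = dmv_delta B n (f x)"
    if "x \<in> carrier A" "y \<in> carrier A" for x y n
    using f(1) that by (simp_all add: dmv_hom_def)
  have "g \<in> dmv_hom B A"
    unfolding dmv_hom_def
  proof (intro CollectI conjI ballI allI impI)
    show "g \<in> carrier B \<rightarrow>\<^sub>E carrier A" using gcl by (auto simp: g_def)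
    show "g (mv_zero B) = mv_zero A" using hom(3)[of "mv_zero A" "mv_zero A"] gf[of "mv_zero A"] by simp
    fix x assume x: "x \<in> carrier B"
    show "g (mv_neg B x) = mv_neg A (g x)"
      using hom(2)[of "g x" "g x"] gf[of "mv_neg A (g x)"] gcl fg x by simp
    show "g (dmv_delta B n x) = dmv_delta A n (g x)" if "n \<ge> 1" for n
      using hom(4)[of "g x" "g x" n] gf[of "dmv_delta A n (g x)"] gcl fg x that by simp
    fix y assume y: "y \<in> carrier B"
    show "g (x \<boxplus>\<^bsub>B\<^esub> y) = g x \<boxplus>\<^bsub>A\<^esub> g y"
      using hom(1)[of "g x" "g y"] gf[of "g x \<boxplus>\<^bsub>A\<^esub> g y"] gcl fg x y by simp
  qed
  moreover have "compose (carrier A) g f = (\<lambda>x \<in> carrier A. x)" "compose (carrier B) f g = (\<lambda>x \<in> carrier B. x)"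
    using gf fg by (auto simp: compose_def restrict_def)
  ultimately have "is_iso DMV B A g"
    unfolding is_iso_def using f(1) by (simp add: DMV_def) blast
  then show ?thesis by (rule exI[of _ g])
qed

lemma ex_unit_interval_iso:
  fixes A :: "'a dmv_alg"
  assumes A: "dmv_algebra A"
  shows "\<exists>V :: 'a u_q_vec_lat. unital_q_vector_lattice V \<and> (\<exists>e. is_iso DMV (unit_interval V) A e)"
proof -
  interpret dmv_algebra A by (rule A)
  note U = unital_q_vector_lattice_vlat
  note simps = unit_interval_simps[OF U]
  define \<iota> where "\<iota> = (\<lambda>a \<in> carrier A. cls (single a))"
  have "\<iota> \<in> dmv_hom A (unit_interval vlat)"
    using cls_single_mem cls_single_oplus cls_single_neg cls_single_zero cls_single_delta
    by (auto simp: dmv_hom_def \<iota>_def simps(2-5) simp del: simps(1))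
  moreover have "bij_betw \<iota> (carrier A) (carrier (unit_interval vlat))"
  proof (rule bij_betwI')
    fix a b assume ab: "a \<in> carrier A" "b \<in> carrier A"
    \<comment> \<open>Injectivity comes from reflection of the order together with antisymmetry in
      \<open>A\<close>.\<close>
    show "\<iota> a = \<iota> b \<longleftrightarrow> a = b"
      using ab vlat_single_le_iff[of a b] vlat_single_le_iff[of b a] vlat_single_le_iff[of a a]
        vlat_single_le_iff[of b b] le_antisym[of a b] by (auto simp: \<iota>_def)
  next
    fix a assume "a \<in> carrier A"
    then show "\<iota> a \<in> carrier (unit_interval vlat)" using cls_single_mem by (simp add: \<iota>_def)
  next
    fix v assume "v \<in> carrier (unit_interval vlat)"
    then obtain c where "c \<in> carrier A" "v = cls (single c)" by (rule unit_interval_vlat_cases)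
    then show "\<exists>a \<in> carrier A. v = \<iota> a" by (auto simp: \<iota>_def)
  qed
  ultimately show ?thesis
    using is_iso_of_bij_dmv_hom[OF A dmv_algebra_unit_interval[OF U]] U by blast
qed

theorem theorem2p1:
  shows "categorical_equivalence
    (uQVL :: ('a u_q_vec_lat, 'a \<Rightarrow> 'a) category)
    (DMV :: ('a dmv_alg, 'a \<Rightarrow> 'a) category)
    Gamma_Q"
proof (rule categorical_equivalence_if_fully_faithful_ess_surj[OF is_functor_Gamma_Q])
  fix V W :: "'a u_q_vec_lat"
  assume "V \<in> Ob uQVL" "W \<in> Ob uQVL"
  then have V: "unital_q_vector_lattice V" and W: "unital_q_vector_lattice W" by (simp_all add: uQVL_def)
  show "\<exists>f \<in> Hom uQVL V W. farr Gamma_Q V W f = g"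
    if "g \<in> Hom DMV (fobj Gamma_Q V) (fobj Gamma_Q W)" for g :: "'a \<Rightarrow> 'a"
  proof -
    have g: "g \<in> dmv_hom (unit_interval V) (unit_interval W)" using that by (simp add: DMV_def Gamma_Q_def)
    show ?thesis
      using extension_hom[OF V W g] extension_restrict[OF V W g] by (auto simp: uQVL_def Gamma_Q_def)
  qed
  show "f = f'" if "f \<in> Hom uQVL V W" "f' \<in> Hom uQVL V W" "farr Gamma_Q V W f = farr Gamma_Q V W f'"
    for f f' :: "'a \<Rightarrow> 'a"
    using uqvl_hom_eqI[OF V W] that by (simp add: uQVL_def Gamma_Q_def)
next
  fix A :: "'a dmv_alg" assume "A \<in> Ob DMV"
  then have "dmv_algebra A" by (simp add: DMV_def)
  then obtain V :: "'a u_q_vec_lat" where "unital_q_vector_lattice V" "\<exists>e. is_iso DMV (unit_interval V) A e"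
    using ex_unit_interval_iso by blast
  then show "\<exists>V \<in> Ob uQVL. \<exists>e. is_iso DMV (fobj Gamma_Q V) A e"
    by (auto simp: uQVL_def Gamma_Q_def)
qed

end
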